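(* Suppose that $0\le j\le k-1$ and let $p_1p_2\cdots p_j$ be a string in $\{1,2\}$. The twig word of $T(p_1p_2\cdots p_j)$ (regarded as a twig at level $k$) consists of the node word $W(p_1p_2\cdots p_j)$ (a node word at level $j$) followed by a single $R$ and then a string of $k-1-j$ occurrences of $V_{j+2}$.
   Context: Work over an algebraically closed field $\mathbf{k}$ of characteristic $0$. **Monster tower.** Let $S$ be a nonsingular surface, $S(0)=S$, $\mathcal{B}(0)=TS$. Recursively, $S(k)=\mathbb{P}(\mathcal{B}(k-1))$ is the total space of the bundle of lines in the rank 2 bundle $\mathcal{B}(k-1)\subset TS(k-1)$, with projection $\pi_k:S(k)\to S(k-1)$ (a $\mathbb{P}^1$-bundle). The rank 2 subbundle $\mathcal{B}(k)\subset TS(k)$ consists, at a point $\tilde p$, of the tangent vectors that $d\pi_k$ maps into the line in $T_{\pi_k(\tilde p)}S(k-1)$ represented by $\tilde p$ (vectors mapped to $0$, called vertical vectors, included). **Charts and nodes.** $U\subset S$ is an open set with local coordinates $x_1,x_2$ (so $dx_1,dx_2$ trivialize the cotangent bundle), on which the curves $x_1=0$ and $x_2=0$ are irreducible and meet in exactly one point, the origin. Everything takes place over $U$. For $p\in\{1,2\}$ let $\overline{p}=3-p$. For each string $p_1\cdots p_k$ in $\{1,2\}$ there is a chart $\mathcal{C}(p_1\cdots p_k)\cong U\times\mathbb{A}^k$ of $S(k)$ with two active coordinates $x_1(p_1\cdots p_k),x_2(p_1\cdots p_k)$, defined recursively: $\mathcal{C}(\varnothing)=U$ with active coordinates $x_i(\varnothing)=x_i$;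 $\mathcal{C}(p_1\cdots p_k)$ is the set of points of $\pi_k^{-1}(\mathcal{C}(p_1\cdots p_{k-1}))$ representing directions on which $dx_{p_k}(p_1\cdots p_{k-1})\ne0$, and on it $$x_{p_k}(p_1\cdots p_k):=x_{p_k}(p_1\cdots p_{k-1}),\qquad x_{\overline{p_k}}(p_1\cdots p_k):=\frac{dx_{\overline{p_k}}(p_1\cdots p_{k-1})}{dx_{p_k}(p_1\cdots p_{k-1})}.$$ The $k+2$ coordinates on $\mathcal{C}(p_1\cdots p_k)$ are $x_1,x_2$ and $x_{\overline{p_j}}(p_1\cdots p_j)$ for $1\le j\le k$. $N(p_1\cdots p_k)$ denotes the origin of $\mathcal{C}(p_1\cdots p_k)$, the point where all $k+2$ coordinates vanish; these points are called nodes of level $k$. **Prolongation.** If $C$ is a curve in $S(j)$ tangent to $\mathcal{B}(j)$ at its nonsingular points, its prolongation is the closure in $S(j+1)=\mathbb{P}(\mathcal{B}(j))$ of the set of tangent directions to $C$ at nonsingular points; this can be iterated. A vertical curve at level $j\ge1$ is a fiber of $\pi_j:S(j)\to S(j-1)$; it is tangent to $\mathcal{B}(j)$. **The family and twigs.** For $t\neq0$ let $X(k)_t\subset S(k)$ be the $k$th (i.e. $k$-fold) prolongation of the curve $x_1x_2=t$ in $U$; $X(k)_0$, the $k$th prolongation of the nodal curve, is the fiber over $t=0$ of the unique flat extension of this family over a neighborhood $T$ of $0$ in the line. The irreducible components of $X(k)_0$ (with reduced structure) are called twigs at level $k$; they form a chain of $2^k+1$ curves whose nodes are the points $N(p_1\cdots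 p_k)$. The two end twigs are the $k$th prolongations of $x_2=0$ and $x_1=0$; the others are interior twigs. Interior twigs are labeled by strings of length $\le k-1$: for $0\le j\le k-1$, $T(p_1\cdots p_j)$ (at level $k$) is the twig that is the $(k-1-j)$-fold prolongation of the vertical curve $\pi_{j+1}^{-1}(N(p_1\cdots p_j))\subset S(j+1)$; equivalently, it emerges at level $j+1$ from $N(p_1\cdots p_j)$ and is mapped isomorphically to that fiber by $S(k)\to S(j+1)$. **Stratification.** For $j\ge2$ and $n\ge0$, let $I_j[n]\subset S(j+n)$ be the union of the $(n+1)$-fold prolongations of all fibers of $S(j-1)\to S(j-2)$; $I_j=I_j[0]\subset S(j)$ is the "divisor at infinity" of points representing vertical directions. Each $I_j[n]$ is a copy of $S(j-1)$. A code word of length $k$ is a word $V_{A_1}V_{A_2}\cdots V_{A_k}$ such that $A_1=\varnothing$ and, for $j\ge2$, $A_j$ is $\varnothing$, or $j$, or $A_{j-1}$; the symbol $V_\varnothing$ is written $R$. For a code word $W$ of length $k$, let $n_j$ be the number of times $j$ occurs among its subscripts ($2\le j\le k$), and let $I_W=\bigcap_{j=2}^k I_j[n_j-1]\subset S(k)$, where $I_j[n_j-1]$ stands for its full inverse image in $S(k)$ and $I_j[-1]$ means $S(k)$. These are exactly the nonempty intersections of this kind. The stratum of $W$ is $I_W$ minus all the lower-dimensional loci $I_{W'}\subsetneq I_W$; the strata partition $S(k)$. The code word of a point is the code word of its stratum (for $k=0$ it is the empty word). The node word $W(p_1\cdots p_k)$ is the code word of $N(p_1\cdots p_k)$. All points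 of a twig other than its nodes (the points $N(p_1\cdots p_k)$ on it) lie in the same stratum; the twig word of the twig is the code word of that stratum. *)

theory Defs
  imports
    "HOL-Analysis.Abstract_Topology"
    "HOL-Computational_Algebra.Polynomial"
begin

section \<open>Varieties as spaces with functions\<close>

text \<open>A variety is given by its points, its Zariski topology and its sheaf of regular functions.
  All three are encoded in one predicate: \<open>X G f\<close> says that \<open>G\<close> is open and that \<open>f\<close> is regular
  on \<open>G\<close>. Functions are total, and the values of \<open>f\<close> outside \<open>G\<close> are irrelevant
  (this is part of the gluing axiom below).\<close>

type_synonym ('p, 'k) fspace = "'p set \<Rightarrow> ('p \<Rightarrow> 'k) \<Rightarrow> bool"

definition zopen :: "('p, 'k) fspace \<Rightarrow> 'p set \<Rightarrow> bool" where
  "zopen X G \<longleftrightarrow> (\<exists>f. X G f)"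

definition points :: "('p, 'k) fspace \<Rightarrow> 'p set" where
  "points X = \<Union>{G. zopen X G}"

definition zariski :: "('p, 'k) fspace \<Rightarrow> 'p topology" where
  "zariski X = topology (zopen X)"

definition open_subspace :: "('p, 'k) fspace \<Rightarrow> 'p set \<Rightarrow> ('p, 'k) fspace" where
  "open_subspace X U = (\<lambda>G f. G \<subseteq> U \<and> X G f)"

definition space_with_functions :: "('p, 'k::field) fspace \<Rightarrow> bool" where
  "space_with_functions X \<longleftrightarrow>
     istopology (zopen X) \<and>
     (\<forall>G c. zopen X G \<longrightarrow> X G (\<lambda>_. c)) \<and>
     (\<forall>G f g. X G f \<and> X G g \<longrightarrow> X G (\<lambda>p. f p + g p) \<and> X G (\<lambda>p. f p * g p)) \<and>
     (\<forall>G f. X G f \<longrightarrow> X {p \<in> G. f p \<noteq> 0} (\<lambda>p. inverse (f p))) \<and>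
     (\<forall>G H f. X G f \<and> zopen X H \<and> H \<subseteq> G \<longrightarrow> X H f) \<and>
     (\<forall>G f. (\<forall>p\<in>G. \<exists>H g. p \<in> H \<and> H \<subseteq> G \<and> X H g \<and> (\<forall>q\<in>H. f q = g q)) \<longrightarrow> X G f)"

text \<open>Affine \<open>n\<close>-space is the set of sequences vanishing from index \<open>n\<close> on.\<close>

inductive polyfun :: "((nat \<Rightarrow> 'k::field) \<Rightarrow> 'k) \<Rightarrow> bool" where
  polyfun_const: "polyfun (\<lambda>_. c)"
| polyfun_coord: "polyfun (\<lambda>a. a i)"
| polyfun_add: "polyfun f \<Longrightarrow> polyfun g \<Longrightarrow> polyfun (\<lambda>a. f a + g a)"
| polyfun_mult: "polyfun f \<Longrightarrow> polyfun g \<Longrightarrow> polyfun (\<lambda>a. f a * g a)"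

definition algebraic_set :: "nat \<Rightarrow> (nat \<Rightarrow> 'k::field) set \<Rightarrow> bool" where
  "algebraic_set n Z \<longleftrightarrow>
     (\<exists>F. (\<forall>f\<in>F. polyfun f) \<and> Z = {a. (\<forall>i\<ge>n. a i = 0) \<and> (\<forall>f\<in>F. f a = 0)})"

definition algebraic_set_space :: "(nat \<Rightarrow> 'k::field) set \<Rightarrow> (nat \<Rightarrow> 'k, 'k) fspace" where
  "algebraic_set_space Z = (\<lambda>G f.
     (\<exists>F. (\<forall>h\<in>F. polyfun h) \<and> G = {a\<in>Z. \<exists>h\<in>F. h a \<noteq> 0}) \<and>
     (\<forall>a\<in>G. \<exists>P Q. polyfun P \<and> polyfun Q \<and> Q a \<noteq> 0 \<and>
        (\<forall>b\<in>G. Q b \<noteq> 0 \<longrightarrow> f b = P b / Q b)))"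

definition fspace_iso :: "('p, 'k) fspace \<Rightarrow> ('q, 'k) fspace \<Rightarrow> ('p \<Rightarrow> 'q) \<Rightarrow> bool" where
  "fspace_iso X Y \<phi> \<longleftrightarrow>
     bij_betw \<phi> (points X) (points Y) \<and>
     (\<forall>G f. G \<subseteq> points X \<longrightarrow> (X G (\<lambda>p. f (\<phi> p)) \<longleftrightarrow> Y (\<phi> ` G) f))"

definition affine_variety :: "('p, 'k::field) fspace \<Rightarrow> bool" where
  "affine_variety X \<longleftrightarrow>
     (\<exists>n Z \<phi>. algebraic_set n Z \<and> fspace_iso X (algebraic_set_space Z) \<phi>)"

text \<open>The diagonal is closed in the product: regular functions on a product of open sets are
  locally quotients of finite sums \<open>\<Sum> f\<^sub>i \<otimes> g\<^sub>i\<close>.\<close>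

definition separated_fspace :: "('p, 'k::field) fspace \<Rightarrow> bool" where
  "separated_fspace X \<longleftrightarrow>
     (\<forall>p\<in>points X. \<forall>q\<in>points X. p \<noteq> q \<longrightarrow>
        (\<exists>G H (n::nat) f g. p \<in> G \<and> q \<in> H \<and> zopen X G \<and> zopen X H \<and>
           (\<forall>i<n. X G (f i) \<and> X H (g i)) \<and>
           (\<Sum>i<n. f i p * g i q) \<noteq> 0 \<and>
           (\<forall>r\<in>G \<inter> H. (\<Sum>i<n. f i r * g i r) = 0)))"

definition variety :: "('p, 'k::field) fspace \<Rightarrow> bool" where
  "variety X \<longleftrightarrow>
     space_with_functions X \<and> separated_fspace X \<and>
     (\<exists>C. finite C \<and> \<Union>C = points X \<and>
        (\<forall>G\<in>C. zopen X G \<and> affine_variety (open_subspace X G)))"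

definition irreducible_set :: "('p, 'k) fspace \<Rightarrow> 'p set \<Rightarrow> bool" where
  "irreducible_set X Z \<longleftrightarrow>
     Z \<noteq> {} \<and> Z \<subseteq> points X \<and>
     (\<forall>A B. closedin (zariski X) A \<and> closedin (zariski X) B \<and> Z \<subseteq> A \<union> B \<longrightarrow> Z \<subseteq> A \<or> Z \<subseteq> B)"

definition irreducible_components :: "('p, 'k) fspace \<Rightarrow> 'p set \<Rightarrow> 'p set set" where
  "irreducible_components X A =
     {Z. irreducible_set X Z \<and> Z \<subseteq> A \<and> (\<forall>Z'. irreducible_set X Z' \<and> Z \<subseteq> Z' \<and> Z' \<subseteq> A \<longrightarrow> Z' = Z)}"

definition irreducible_chain :: "('p, 'k) fspace \<Rightarrow> 'p set \<Rightarrow> nat \<Rightarrow> bool" where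
  "irreducible_chain X A d \<longleftrightarrow>
     (\<exists>Z :: nat \<Rightarrow> 'p set.
        (\<forall>i\<le>d. closedin (zariski X) (Z i) \<and> irreducible_set X (Z i) \<and> Z i \<subseteq> A) \<and>
        (\<forall>i<d. Z i \<subset> Z (Suc i)))"

definition has_dimension :: "('p, 'k) fspace \<Rightarrow> 'p set \<Rightarrow> nat \<Rightarrow> bool" where
  "has_dimension X A d \<longleftrightarrow> irreducible_chain X A d \<and> \<not> irreducible_chain X A (Suc d)"


section \<open>Tangent vectors\<close>

text \<open>A tangent vector is a derivation of the local ring at \<open>p\<close>, extended by \<open>0\<close> to functions that
  are not regular at \<open>p\<close>. It depends only on germs, by the Leibniz rule applied to the
  functions that are \<open>0\<close> or \<open>1\<close> near \<open>p\<close>.\<close>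

type_synonym ('p, 'k) vec = "('p \<Rightarrow> 'k) \<Rightarrow> 'k"

definition local_functions :: "('p, 'k) fspace \<Rightarrow> 'p \<Rightarrow> ('p \<Rightarrow> 'k) set" where
  "local_functions X p = {f. \<exists>G. p \<in> G \<and> X G f}"

definition tangent_space :: "('p, 'k::field) fspace \<Rightarrow> 'p \<Rightarrow> ('p, 'k) vec set" where
  "tangent_space X p = {v.
     (\<forall>f. f \<notin> local_functions X p \<longrightarrow> v f = 0) \<and>
     (\<forall>c. v (\<lambda>_. c) = 0) \<and>
     (\<forall>f\<in>local_functions X p. \<forall>g\<in>local_functions X p.
        v (\<lambda>q. f q + g q) = v f + v g \<and>
        v (\<lambda>q. f q * g q) = f p * v g + g p * v f)}"

definition is_line :: "('p, 'k::field) vec set \<Rightarrow> bool" where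
  "is_line L \<longleftrightarrow> (\<exists>v. v \<noteq> (\<lambda>_. 0) \<and> L = {\<lambda>f. c * v f | c. True})"

definition is_plane :: "('p, 'k::field) vec set \<Rightarrow> bool" where
  "is_plane E \<longleftrightarrow>
     (\<exists>v w. (\<forall>a b. (\<lambda>f. a * v f + b * w f) = (\<lambda>_. 0) \<longrightarrow> a = 0 \<and> b = 0) \<and>
            E = {\<lambda>f. a * v f + b * w f | a b. True})"

definition pushforward ::
  "('p, 'k::field) fspace \<Rightarrow> ('q \<Rightarrow> 'p) \<Rightarrow> 'q \<Rightarrow> ('q, 'k) vec \<Rightarrow> ('p, 'k) vec" where
  "pushforward X \<pi> y v = (\<lambda>f. if f \<in> local_functions X (\<pi> y) then v (\<lambda>z. f (\<pi> z)) else 0)"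

text \<open>The Zariski tangent space at \<open>p\<close> of the reduced subvariety \<open>C\<close>, inside that of \<open>X\<close>.\<close>

definition tangent_to :: "('p, 'k::field) fspace \<Rightarrow> 'p set \<Rightarrow> 'p \<Rightarrow> ('p, 'k) vec set" where
  "tangent_to X C p = {v\<in>tangent_space X p.
     \<forall>G f. p \<in> G \<and> X G f \<and> (\<forall>q\<in>G \<inter> C. f q = 0) \<longrightarrow> v f = 0}"

definition nonsingular_surface :: "('p, 'k::field) fspace \<Rightarrow> bool" where
  "nonsingular_surface X \<longleftrightarrow>
     variety X \<and>
     (\<forall>Z\<in>irreducible_components X (points X). has_dimension X Z 2) \<and>
     (\<forall>p\<in>points X. is_plane (tangent_space X p))"

text \<open>The differentials of \<open>x 1\<close> and \<open>x 2\<close> trivialize the cotangent bundle: they are pointwise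
  independent, and the differential of every regular function on an open set is a combination of
  them with regular coefficients.\<close>

definition trivialize_cotangent :: "('p, 'k::field) fspace \<Rightarrow> (nat \<Rightarrow> 'p \<Rightarrow> 'k) \<Rightarrow> bool" where
  "trivialize_cotangent X x \<longleftrightarrow>
     X (points X) (x 1) \<and> X (points X) (x 2) \<and>
     (\<forall>p\<in>points X. \<forall>a b. (\<forall>v\<in>tangent_space X p. a * v (x 1) + b * v (x 2) = 0) \<longrightarrow> a = 0 \<and> b = 0) \<and>
     (\<forall>G f. X G f \<longrightarrow>
        (\<exists>a b. X G a \<and> X G b \<and>
           (\<forall>p\<in>G. \<forall>v\<in>tangent_space X p. v f = a p * v (x 1) + b p * v (x 2))))"

definition nodal_coordinates :: "('p, 'k::field) fspace \<Rightarrow> (nat \<Rightarrow> 'p \<Rightarrow> 'k) \<Rightarrow> bool" where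
  "nodal_coordinates X x \<longleftrightarrow>
     trivialize_cotangent X x \<and>
     irreducible_set X {p\<in>points X. x 1 p = 0} \<and>
     irreducible_set X {p\<in>points X. x 2 p = 0} \<and>
     (\<exists>!p. p \<in> points X \<and> x 1 p = 0 \<and> x 2 p = 0)"


section \<open>The monster tower\<close>

text \<open>On a line \<open>L\<close> of tangent vectors on which \<open>dg\<close> does not vanish: the value of \<open>df/dg\<close>.\<close>

definition dquot :: "('p, 'k::field) vec set \<Rightarrow> ('p \<Rightarrow> 'k) \<Rightarrow> ('p \<Rightarrow> 'k) \<Rightarrow> 'k" where
  "dquot L f g = (THE c. \<forall>v\<in>L. v f = c * v g)"

text \<open>The variety structure of a bundle of lines: \<open>E\<close> is its set of points, and \<open>y \<in> E\<close> represents
  the line \<open>\<delta> y\<close> of tangent vectors to \<open>X\<close> at \<open>\<pi> y\<close>. The regular functions form the smallest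
  sheaf of functions on \<open>E\<close>, closed under inverting, that contains the pullbacks of regular
  functions on \<open>X\<close> and the quotients \<open>df/dg\<close> (on the lines where \<open>dg\<close> does not vanish).\<close>

inductive line_bundle_space ::
  "('p, 'k::field) fspace \<Rightarrow> 'q set \<Rightarrow> ('q \<Rightarrow> 'p) \<Rightarrow> ('q \<Rightarrow> ('p, 'k) vec set) \<Rightarrow> ('q, 'k) fspace"
  for X E \<pi> \<delta> where
  pullback: "X G f \<Longrightarrow> line_bundle_space X E \<pi> \<delta> {y\<in>E. \<pi> y \<in> G} (\<lambda>y. f (\<pi> y))"
| quotient: "X G f \<Longrightarrow> X G g \<Longrightarrow>
    line_bundle_space X E \<pi> \<delta> {y\<in>E. \<pi> y \<in> G \<and> (\<exists>v\<in>\<delta> y. v g \<noteq> 0)} (\<lambda>y. dquot (\<delta> y) f g)"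
| add: "line_bundle_space X E \<pi> \<delta> G f \<Longrightarrow> line_bundle_space X E \<pi> \<delta> H g \<Longrightarrow>
    line_bundle_space X E \<pi> \<delta> (G \<inter> H) (\<lambda>y. f y + g y)"
| mult: "line_bundle_space X E \<pi> \<delta> G f \<Longrightarrow> line_bundle_space X E \<pi> \<delta> H g \<Longrightarrow>
    line_bundle_space X E \<pi> \<delta> (G \<inter> H) (\<lambda>y. f y * g y)"
| inverse: "line_bundle_space X E \<pi> \<delta> G f \<Longrightarrow>
    line_bundle_space X E \<pi> \<delta> {y\<in>G. f y \<noteq> 0} (\<lambda>y. inverse (f y))"
| glue: "(\<And>y. y \<in> G \<Longrightarrow> \<exists>H g. y \<in> H \<and> H \<subseteq> G \<and> line_bundle_space X E \<pi> \<delta> H g \<and> (\<forall>z\<in>H. f z = g z)) \<Longrightarrow>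
    line_bundle_space X E \<pi> \<delta> G f"

text \<open>The points of \<open>S(k+1)\<close> are pairs of a point \<open>q\<close> of \<open>S(k)\<close> and a line in the fiber of
  \<open>\<B>(k)\<close> at \<open>q\<close>. As the type of such pairs grows with \<open>k\<close>, the points of all
  levels are coded in one type: \<open>y \<in> pts M (k+1)\<close> codes the pair \<open>(pr M (k+1) y, dir M (k+1) y)\<close>, and
  a tower is any system of codes for which this is a bijection. Codes always exist, since all
  levels have the cardinality of the field. Different levels need not be disjoint; \<open>pts M 0\<close>,
  \<open>pr M 0\<close> and \<open>dir M 0\<close> are not used.\<close>

record ('p, 'k) tower =
  base :: "('p, 'k) fspace"
  pts :: "nat \<Rightarrow> 'p set"
  pr :: "nat \<Rightarrow> 'p \<Rightarrow> 'p"
  dir :: "nat \<Rightarrow> 'p \<Rightarrow> ('p, 'k) vec set"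

primrec level :: "('p, 'k::field) tower \<Rightarrow> nat \<Rightarrow> ('p, 'k) fspace" where
  "level M 0 = base M"
| "level M (Suc k) = line_bundle_space (level M k) (pts M (Suc k)) (pr M (Suc k)) (dir M (Suc k))"

primrec focal :: "('p, 'k::field) tower \<Rightarrow> nat \<Rightarrow> 'p \<Rightarrow> ('p, 'k) vec set" where
  "focal M 0 y = tangent_space (level M 0) y"
| "focal M (Suc k) y =
     {v\<in>tangent_space (level M (Suc k)) y. pushforward (level M k) (pr M (Suc k)) y v \<in> dir M (Suc k) y}"

definition monster_tower :: "('p, 'k::field) tower \<Rightarrow> bool" where
  "monster_tower M \<longleftrightarrow>
     (\<forall>k. bij_betw (\<lambda>y. (pr M (Suc k) y, dir M (Suc k) y)) (pts M (Suc k))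
        {(q, L). q \<in> points (level M k) \<and> is_line L \<and> L \<subseteq> focal M k q})"

text \<open>\<open>down M j n\<close> is the projection from level \<open>j + n\<close> to level \<open>j\<close>.\<close>

primrec down :: "('p, 'k) tower \<Rightarrow> nat \<Rightarrow> nat \<Rightarrow> 'p \<Rightarrow> 'p" where
  "down M j 0 y = y"
| "down M j (Suc n) y = down M j n (pr M (j + Suc n) y)"

definition vertical_fiber :: "('p, 'k::field) tower \<Rightarrow> nat \<Rightarrow> 'p \<Rightarrow> 'p set" where
  "vertical_fiber M j q = {y\<in>points (level M (Suc j)). pr M (Suc j) y = q}"


section \<open>Charts and nodes\<close>

text \<open>A string is a list \<open>ps\<close> with entries in \<open>{1, 2}\<close>; its \<open>p\<^sub>n\<^sub>+\<^sub>1\<close> is \<open>ps ! n\<close>.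
  \<open>coord M x ps n i\<close> and \<open>chart M x ps n\<close> belong to the prefix of length \<open>n\<close>.\<close>

primrec coord :: "('p, 'k::field) tower \<Rightarrow> (nat \<Rightarrow> 'p \<Rightarrow> 'k) \<Rightarrow> nat list \<Rightarrow> nat \<Rightarrow> nat \<Rightarrow> 'p \<Rightarrow> 'k" where
  "coord M x ps 0 i = x i"
| "coord M x ps (Suc n) i =
     (if i = ps ! n then (\<lambda>y. coord M x ps n i (pr M (Suc n) y))
      else (\<lambda>y. dquot (dir M (Suc n) y) (coord M x ps n i) (coord M x ps n (ps ! n))))"

primrec chart :: "('p, 'k::field) tower \<Rightarrow> (nat \<Rightarrow> 'p \<Rightarrow> 'k) \<Rightarrow> nat list \<Rightarrow> nat \<Rightarrow> 'p set" where
  "chart M x ps 0 = points (level M 0)"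
| "chart M x ps (Suc n) =
     {y\<in>points (level M (Suc n)). pr M (Suc n) y \<in> chart M x ps n \<and>
        (\<exists>v\<in>dir M (Suc n) y. v (coord M x ps n (ps ! n)) \<noteq> 0)}"

definition node :: "('p, 'k::field) tower \<Rightarrow> (nat \<Rightarrow> 'p \<Rightarrow> 'k) \<Rightarrow> nat list \<Rightarrow> 'p" where
  "node M x ps = (THE y.
     y \<in> chart M x ps (length ps) \<and>
     x 1 (down M 0 (length ps) y) = 0 \<and> x 2 (down M 0 (length ps) y) = 0 \<and>
     (\<forall>n<length ps. coord M x ps (Suc n) (3 - ps ! n) (down M (Suc n) (length ps - Suc n) y) = 0))"

definition nodes :: "('p, 'k::field) tower \<Rightarrow> (nat \<Rightarrow> 'p \<Rightarrow> 'k) \<Rightarrow> nat \<Rightarrow> 'p set" where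
  "nodes M x k = {node M x ps | ps. length ps = k \<and> set ps \<subseteq> {1, 2}}"


section \<open>Prolongation and twigs\<close>

text \<open>A point of a curve is nonsingular iff the tangent space of the curve there is a line.\<close>

definition prolong :: "('p, 'k::field) tower \<Rightarrow> nat \<Rightarrow> 'p set \<Rightarrow> 'p set" where
  "prolong M j C = zariski (level M (Suc j)) closure_of
     {y\<in>points (level M (Suc j)). pr M (Suc j) y \<in> C \<and>
        is_line (tangent_to (level M j) C (pr M (Suc j) y)) \<and>
        dir M (Suc j) y = tangent_to (level M j) C (pr M (Suc j) y)}"

primrec prolongs :: "('p, 'k::field) tower \<Rightarrow> nat \<Rightarrow> nat \<Rightarrow> 'p set \<Rightarrow> 'p set" where
  "prolongs M j 0 C = C"
| "prolongs M j (Suc n) C = prolong M (j + n) (prolongs M j n C)"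

definition family :: "('p, 'k::field) tower \<Rightarrow> (nat \<Rightarrow> 'p \<Rightarrow> 'k) \<Rightarrow> nat \<Rightarrow> 'k \<Rightarrow> 'p set" where
  "family M x k t = prolongs M 0 k {p\<in>points (level M 0). x 1 p * x 2 p = t}"

text \<open>The total space of the flat extension over the \<open>t\<close>-line is the closure of the family over
  \<open>t \<noteq> 0\<close> in the product of \<open>S(k)\<close> with the line. So \<open>y\<close> is in the fiber over \<open>0\<close> iff no
  function \<open>\<Sum> f\<^sub>i t\<^sup>i\<close> that vanishes on the family near \<open>y\<close> is nonzero at \<open>(y, 0)\<close>.\<close>

definition special_fiber :: "('p, 'k::field) tower \<Rightarrow> (nat \<Rightarrow> 'p \<Rightarrow> 'k) \<Rightarrow> nat \<Rightarrow> 'p set" where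
  "special_fiber M x k = {y\<in>points (level M k).
     \<forall>G (n::nat) f. y \<in> G \<and> (\<forall>i\<le>n. level M k G (f i)) \<and>
        (\<forall>t. t \<noteq> 0 \<longrightarrow> (\<forall>z\<in>G \<inter> family M x k t. (\<Sum>i\<le>n. f i z * t ^ i) = 0)) \<longrightarrow>
        f 0 y = 0}"

definition twigs :: "('p, 'k::field) tower \<Rightarrow> (nat \<Rightarrow> 'p \<Rightarrow> 'k) \<Rightarrow> nat \<Rightarrow> 'p set set" where
  "twigs M x k = irreducible_components (level M k) (special_fiber M x k)"

text \<open>\<open>T\<close> is the twig at level \<open>k\<close> with label \<open>ps\<close> (of length at most \<open>k - 1\<close>).\<close>

definition is_interior_twig ::
  "('p, 'k::field) tower \<Rightarrow> (nat \<Rightarrow> 'p \<Rightarrow> 'k) \<Rightarrow> nat \<Rightarrow> nat list \<Rightarrow> 'p set \<Rightarrow> bool" where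
  "is_interior_twig M x k ps T \<longleftrightarrow>
     T \<in> twigs M x k \<and>
     T = prolongs M (length ps + 1) (k - 1 - length ps)
           (vertical_fiber M (length ps) (node M x ps))"


section \<open>Code words and the stratification\<close>

datatype code_symbol = R | V nat

text \<open>In \<open>W = V\<^sub>A\<^sub>1 V\<^sub>A\<^sub>2 \<dots>\<close> the symbol \<open>V\<^sub>A\<^sub>i\<close> is \<open>W ! (i - 1)\<close>, and \<open>R\<close> stands for the
  empty subscript.\<close>

definition is_code_word :: "code_symbol list \<Rightarrow> bool" where
  "is_code_word W \<longleftrightarrow>
     (\<forall>i<length W. W ! i = R \<or> (0 < i \<and> (W ! i = V (i + 1) \<or> W ! i = W ! (i - 1))))"

text \<open>\<open>infinity_locus M j n\<close> is \<open>I\<^sub>j[n]\<close>, for \<open>j \<ge> 2\<close>; it lies at level \<open>j + n\<close>.\<close>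

definition infinity_locus :: "('p, 'k::field) tower \<Rightarrow> nat \<Rightarrow> nat \<Rightarrow> 'p set" where
  "infinity_locus M j n =
     (\<Union>q\<in>points (level M (j - 2)). prolongs M (j - 1) (n + 1) (vertical_fiber M (j - 2) q))"

text \<open>For a code word of length \<open>k\<close> in which \<open>j\<close> occurs \<open>n > 0\<close> times, \<open>j + n - 1 \<le> k\<close>.\<close>

definition code_locus :: "('p, 'k::field) tower \<Rightarrow> code_symbol list \<Rightarrow> 'p set" where
  "code_locus M W = {y\<in>points (level M (length W)).
     \<forall>j\<in>{2..length W}. let n = count_list W (V j) in
       n > 0 \<longrightarrow> down M (j + n - 1) (length W - (j + n - 1)) y \<in> infinity_locus M j (n - 1)}"

definition stratum :: "('p, 'k::field) tower \<Rightarrow> code_symbol list \<Rightarrow> 'p set" where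
  "stratum M W = code_locus M W -
     \<Union>{code_locus M W' | W'. is_code_word W' \<and> length W' = length W \<and> code_locus M W' \<subset> code_locus M W}"

definition code_word :: "('p, 'k::field) tower \<Rightarrow> nat \<Rightarrow> 'p \<Rightarrow> code_symbol list" where
  "code_word M k y = (THE W. is_code_word W \<and> length W = k \<and> y \<in> stratum M W)"

definition node_word :: "('p, 'k::field) tower \<Rightarrow> (nat \<Rightarrow> 'p \<Rightarrow> 'k) \<Rightarrow> nat list \<Rightarrow> code_symbol list" where
  "node_word M x ps = code_word M (length ps) (node M x ps)"

definition twig_word :: "('p, 'k::field) tower \<Rightarrow> (nat \<Rightarrow> 'p \<Rightarrow> 'k) \<Rightarrow> nat \<Rightarrow> 'p set \<Rightarrow> code_symbol list" where
  "twig_word M x k T = (THE W. is_code_word W \<and> length W = k \<and> T - nodes M x k \<subseteq> stratum M W)"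

end

theory Submission
  imports Defs
begin

text \<open>The proof replaces all the geometry by coordinates in the charts. In the chart of a string, at
  any level, the two active coordinates are coordinates on the focal planes: their differentials
  take all pairs of values on a focal plane, and they locally generate the differentials of all
  regular functions along it (\<open>frame_chart\<close>). So a point over a given point, in the chart of the
  next letter \<open>p\<close>, is the same as a scalar, the slope. Focal vectors with prescribed values are
  obtained by pushing a vector forward along sections of the projection with varying slope
  (\<open>focal_vector_lift\<close>), and curves in a chart lift with any regular slope
  (\<open>morphism_lift\<close>).

  The prolongations of a vertical fiber are again nonsingular closed curves; at each step the set of
  tangent directions is already closed. If the fiber is the one over a point \<open>q\<close> of level \<open>m\<close>, then
  in the chart of a string \<open>p\<^sub>1p\<^sub>2\<dots>\<close> its prolongation consists of the points over \<open>q\<close> at which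
  the new coordinates of all levels above \<open>m + 1\<close> vanish, if all letters after \<open>p\<^sub>m\<^sub>+\<^sub>1\<close> are
  opposite to it, and is empty otherwise (\<open>fiber_prolongation_Suc_iff\<close>). The tangent line is identified with the
  help of a parametrization by the affine line (\<open>tangent_to_curve\<close>).

  As the loci \<open>I\<^sub>j[n]\<close> are unions of such curves, they have the same description. It follows
  that a point at level \<open>l\<close> lies in \<open>I\<^sub>j[l - j]\<close> for at most one \<open>j\<close>. Recording this \<open>j\<close> at each
  level attaches a code word to every point; every code word occurs, and the stratum of \<open>W\<close> is the
  set of points with word \<open>W\<close> (\<open>stratum_eq\<close>).

  On the twig that emerges from a node at level \<open>j\<close>, the first \<open>j\<close> symbols are those of the node. The next
  symbol is \<open>R\<close> unless the direction at the node is a coordinate direction, in which case the point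
  of the twig is a node. The remaining symbols are \<open>V (j + 2)\<close>, because the twig lies in the loci
  \<open>I\<^sub>j\<^sub>+\<^sub>2[n]\<close> (\<open>twig_point\<close>).\<close>

section \<open>Spaces with functions\<close>

lemma open_subset_points: "zopen X G \<Longrightarrow> G \<subseteq> points X"
  by (auto simp: points_def)

lemma space_with_functionsI:
  assumes "istopology (zopen X)"
    and "\<And>G c. zopen X G \<Longrightarrow> X G (\<lambda>_. c)"
    and "\<And>G f g. X G f \<Longrightarrow> X G g \<Longrightarrow> X G (\<lambda>p. f p + g p)"
    and "\<And>G f g. X G f \<Longrightarrow> X G g \<Longrightarrow> X G (\<lambda>p. f p * g p)"
    and "\<And>G f. X G f \<Longrightarrow> X {p \<in> G. f p \<noteq> 0} (\<lambda>p. inverse (f p))"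
    and "\<And>G H f. X G f \<Longrightarrow> zopen X H \<Longrightarrow> H \<subseteq> G \<Longrightarrow> X H f"
    and "\<And>G f. (\<And>p. p \<in> G \<Longrightarrow> \<exists>H g. p \<in> H \<and> H \<subseteq> G \<and> X H g \<and> (\<forall>q\<in>H. f q = g q)) \<Longrightarrow> X G f"
  shows "space_with_functions X"
  unfolding space_with_functions_def
  apply (intro conjI allI impI; (elim conjE)?)
  subgoal by (fact assms(1))
  subgoal by (rule assms(2))
  subgoal by (rule assms(3))
  subgoal by (rule assms(4))
  subgoal by (rule assms(5))
  subgoal by (rule assms(6))
  subgoal by (rule assms(7)) (rule bspec)
  done

context
  fixes X :: "('p, 'k::field) fspace"
  assumes space: "space_with_functions X"
begin

lemma regular_open: "X G f \<Longrightarrow> zopen X G"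
  unfolding zopen_def by (rule exI)

lemma local_functionsI: "X G f \<Longrightarrow> p \<in> G \<Longrightarrow> f \<in> local_functions X p"
  unfolding local_functions_def by blast

lemma local_functionsE:
  assumes "f \<in> local_functions X p"
  obtains G where "p \<in> G" "X G f"
  using assms unfolding local_functions_def by blast

lemma istopology_zopen: "istopology (zopen X)"
  using space by (simp add: space_with_functions_def)

lemma open_Int: "zopen X G \<Longrightarrow> zopen X H \<Longrightarrow> zopen X (G \<inter> H)"
  using istopology_zopen by (simp add: istopology_def)

lemma open_points: "zopen X (points X)"
proof -
  have "zopen X (\<Union>{G. zopen X G})"
    using istopology_zopen unfolding istopology_def by blast
  then show ?thesis by (simp add: points_def)
qed

lemma regular_const:
  assumes "zopen X G"
  shows "X G (\<lambda>_. c)"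
proof -
  have "\<forall>G c. zopen X G \<longrightarrow> X G (\<lambda>_. c)"
    using space unfolding space_with_functions_def by (elim conjE)
  then show ?thesis using assms by simp
qed

lemma
  assumes "X G f" "X G g"
  shows regular_add: "X G (\<lambda>p. f p + g p)" and regular_mult: "X G (\<lambda>p. f p * g p)"
proof -
  have "\<forall>G f g. X G f \<and> X G g \<longrightarrow> X G (\<lambda>p. f p + g p) \<and> X G (\<lambda>p. f p * g p)"
    using space unfolding space_with_functions_def by (elim conjE)
  then show "X G (\<lambda>p. f p + g p)" "X G (\<lambda>p. f p * g p)" using assms by simp_all
qed

lemma regular_inverse:
  assumes "X G f"
  shows "X {p \<in> G. f p \<noteq> 0} (\<lambda>p. inverse (f p))"
proof -
  have "\<forall>G f. X G f \<longrightarrow> X {p \<in> G. f p \<noteq> 0} (\<lambda>p. inverse (f p))"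
    using space unfolding space_with_functions_def by (elim conjE)
  then show ?thesis using assms by simp
qed

lemma regular_restrict:
  assumes "X G f" "zopen X H" "H \<subseteq> G"
  shows "X H f"
proof -
  have "\<forall>G H f. X G f \<and> zopen X H \<and> H \<subseteq> G \<longrightarrow> X H f"
    using space unfolding space_with_functions_def by (elim conjE)
  from this[rule_format, of G f H] show ?thesis using assms by simp
qed

lemma regular_glue:
  assumes "\<And>p. p \<in> G \<Longrightarrow> \<exists>H g. p \<in> H \<and> H \<subseteq> G \<and> X H g \<and> (\<forall>q\<in>H. f q = g q)"
  shows "X G f"
proof -
  have "\<forall>G f. (\<forall>p\<in>G. \<exists>H g. p \<in> H \<and> H \<subseteq> G \<and> X H g \<and> (\<forall>q\<in>H. f q = g q)) \<longrightarrow> X G f"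
    using space unfolding space_with_functions_def by (elim conjE)
  from this[rule_format, of G f] show ?thesis using assms by simp
qed

lemma regular_cong: "X G f \<Longrightarrow> (\<And>p. p \<in> G \<Longrightarrow> f p = g p) \<Longrightarrow> X G g"
  by (rule regular_glue, rule exI[of _ G], rule exI[of _ f]) simp

lemma regular_diff:
  assumes "X G f" "X G g"
  shows "X G (\<lambda>p. f p - g p)"
proof -
  have "X G (\<lambda>p. f p + (- 1) * g p)"
    by (intro regular_add regular_mult regular_const regular_open[OF assms(1)] assms)
  then show ?thesis by simp
qed

lemma regular_divide:
  assumes "X G f" "X G g" "\<And>p. p \<in> G \<Longrightarrow> g p \<noteq> 0"
  shows "X G (\<lambda>p. f p / g p)"
proof -
  have "{p \<in> G. g p \<noteq> 0} = G" using assms(3) by auto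
  then have "X G (\<lambda>p. inverse (g p))" using regular_inverse[OF assms(2)] by simp
  from regular_mult[OF assms(1) this] show ?thesis by (simp add: divide_inverse)
qed

lemma open_nonzero: "X G f \<Longrightarrow> zopen X {p \<in> G. f p \<noteq> 0}"
  by (rule regular_open, rule regular_inverse)

lemma open_locally:
  assumes "\<And>p. p \<in> G \<Longrightarrow> \<exists>H. p \<in> H \<and> H \<subseteq> G \<and> zopen X H"
  shows "zopen X G"
proof -
  have "X G (\<lambda>_. 0)"
  proof (rule regular_glue)
    fix p assume "p \<in> G"
    then obtain H where "p \<in> H" "H \<subseteq> G" "zopen X H" using assms by blast
    moreover from this have "X H (\<lambda>_. 0)" by (intro regular_const)
    ultimately show "\<exists>H g. p \<in> H \<and> H \<subseteq> G \<and> X H g \<and> (\<forall>q\<in>H. 0 = g q)"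
      by (intro exI[of _ H] exI[of _ "\<lambda>_. 0"]) simp
  qed
  then show ?thesis by (rule regular_open)
qed

lemma local_add: "f \<in> local_functions X p \<Longrightarrow> g \<in> local_functions X p \<Longrightarrow> (\<lambda>q. f q + g q) \<in> local_functions X p"
  and local_mult: "f \<in> local_functions X p \<Longrightarrow> g \<in> local_functions X p \<Longrightarrow> (\<lambda>q. f q * g q) \<in> local_functions X p"
proof -
  assume f: "f \<in> local_functions X p" and g: "g \<in> local_functions X p"
  obtain G where G: "p \<in> G" "X G f" by (rule local_functionsE[OF f])
  obtain H where H: "p \<in> H" "X H g" by (rule local_functionsE[OF g])
  have o: "zopen X (G \<inter> H)" by (rule open_Int[OF regular_open[OF G(2)] regular_open[OF H(2)]])
  have f': "X (G \<inter> H) f" by (rule regular_restrict[OF G(2) o]) simp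
  have g': "X (G \<inter> H) g" by (rule regular_restrict[OF H(2) o]) simp
  have p: "p \<in> G \<inter> H" using G(1) H(1) by simp
  show "(\<lambda>q. f q + g q) \<in> local_functions X p"
    by (rule local_functionsI[OF regular_add[OF f' g'] p])
  show "(\<lambda>q. f q * g q) \<in> local_functions X p"
    by (rule local_functionsI[OF regular_mult[OF f' g'] p])
qed

lemma openin_zariski: "openin (zariski X) G \<longleftrightarrow> zopen X G"
  by (simp add: zariski_def topology_inverse'[OF istopology_zopen])

lemma topspace_zariski: "topspace (zariski X) = points X"
  by (simp add: topspace_def openin_zariski points_def)

lemma closedin_zariski: "closedin (zariski X) A \<longleftrightarrow> A \<subseteq> points X \<and> zopen X (points X - A)"
  by (simp add: closedin_def openin_zariski topspace_zariski)

lemma space_open_subspace: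
  assumes U: "zopen X U"
  shows "space_with_functions (open_subspace X U)"
proof -
  have o: "zopen (open_subspace X U) = (\<lambda>G. G \<subseteq> U \<and> zopen X G)"
    by (simp add: zopen_def open_subspace_def fun_eq_iff)
  show ?thesis
  proof (rule space_with_functionsI)
    show "istopology (zopen (open_subspace X U))"
      using istopology_zopen unfolding istopology_def o by blast
  next
    fix G c assume "zopen (open_subspace X U) G"
    then show "open_subspace X U G (\<lambda>_. c)"
      using regular_const[of G c] unfolding o by (simp add: open_subspace_def)
  next
    fix G f g assume "open_subspace X U G f" "open_subspace X U G g"
    then show "open_subspace X U G (\<lambda>p. f p + g p)" "open_subspace X U G (\<lambda>p. f p * g p)"
      using regular_add[of G f g] regular_mult[of G f g] by (simp_all add: open_subspace_def)
  next
    fix G f assume "open_subspace X U G f"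
    then show "open_subspace X U {p \<in> G. f p \<noteq> 0} (\<lambda>p. inverse (f p))"
      using regular_inverse[of G f] by (auto simp: open_subspace_def)
  next
    fix G H f assume G: "open_subspace X U G f" and H: "zopen (open_subspace X U) H" and "H \<subseteq> G"
    then have "zopen X H" "X G f" "H \<subseteq> U" by (simp_all add: o) (simp add: open_subspace_def)
    then show "open_subspace X U H f"
      using \<open>H \<subseteq> G\<close> regular_restrict[of G f H] by (simp add: open_subspace_def)
  next
    fix G f
    assume *: "\<And>p. p \<in> G \<Longrightarrow>
      \<exists>H g. p \<in> H \<and> H \<subseteq> G \<and> open_subspace X U H g \<and> (\<forall>q\<in>H. f q = g q)"
    have "X G f"
    proof (rule regular_glue)
      fix p assume "p \<in> G"
      then show "\<exists>H g. p \<in> H \<and> H \<subseteq> G \<and> X H g \<and> (\<forall>q\<in>H. f q = g q)"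
        using * unfolding open_subspace_def by meson
    qed
    moreover have "G \<subseteq> U" using * unfolding open_subspace_def by blast
    ultimately show "open_subspace X U G f" by (simp add: open_subspace_def)
  qed
qed

lemma points_open_subspace: "zopen X U \<Longrightarrow> points (open_subspace X U) = U"
  by (auto simp: points_def zopen_def open_subspace_def)

lemma local_functions_open_subspace:
  assumes "zopen X U" "p \<in> U"
  shows "local_functions (open_subspace X U) p = local_functions X p"
proof -
  have "\<exists>H. p \<in> H \<and> H \<subseteq> U \<and> X H f" if G: "p \<in> G" "X G f" for G f
  proof (intro exI conjI)
    show "X (G \<inter> U) f"
      by (rule regular_restrict[OF G(2) open_Int[OF regular_open[OF G(2)] assms(1)]]) simp
  qed (use G assms(2) in auto)
  then show ?thesis
    unfolding local_functions_def open_subspace_def by (intro Collect_cong) metis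
qed

lemma tangent_space_open_subspace:
  "zopen X U \<Longrightarrow> p \<in> U \<Longrightarrow> tangent_space (open_subspace X U) p = tangent_space X p"
  by (simp add: tangent_space_def local_functions_open_subspace)

end

lemma closed_point_separated:
  assumes X: "space_with_functions X" and sep: "separated_fspace X" and q: "q \<in> points X"
  shows "zopen X (points X - {q})"
proof (rule open_locally[OF X])
  fix p assume p: "p \<in> points X - {q}"
  then have "q \<noteq> p" "p \<in> points X" by auto
  then have "\<exists>G H (n::nat) f g. q \<in> G \<and> p \<in> H \<and> zopen X G \<and> zopen X H \<and>
           (\<forall>i<n. X G (f i) \<and> X H (g i)) \<and> (\<Sum>i<n. f i q * g i p) \<noteq> 0 \<and>
           (\<forall>r\<in>G \<inter> H. (\<Sum>i<n. f i r * g i r) = 0)"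
    using sep q unfolding separated_fspace_def by simp
  then obtain G H and n :: nat and f g where GH: "q \<in> G" "p \<in> H" "zopen X G" "zopen X H"
    and fg: "\<forall>i<n. X G (f i) \<and> X H (g i)" and nz: "(\<Sum>i<n. f i q * g i p) \<noteq> 0"
    and z: "\<forall>r\<in>G \<inter> H. (\<Sum>i<n. f i r * g i r) = 0"
    by (elim exE conjE)
  \<comment> \<open>On \<open>H\<close>, the function with values \<open>\<Sum> f\<^sub>i(q) g\<^sub>i\<close> separates \<open>p\<close> from \<open>q\<close>.\<close>
  have "X H (\<lambda>r. \<Sum>i<m. f i q * g i r)" if "m \<le> n" for m
    using that
  proof (induction m)
    case 0
    then show ?case using regular_const[OF X, OF GH(4), of 0] by simp
  next
    case (Suc m)
    then have "X H (g m)" "X H (\<lambda>r. \<Sum>i<m. f i q * g i r)" using fg by simp_all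
    then have "X H (\<lambda>r. (\<Sum>i<m. f i q * g i r) + f m q * g m r)"
      using regular_add[OF X, of H "\<lambda>r. \<Sum>i<m. f i q * g i r" "\<lambda>r. f m q * g m r"]
        regular_mult[OF X, of H "\<lambda>_. f m q" "g m"] regular_const[OF X, OF GH(4), of "f m q"]
      by simp
    then show ?case by simp
  qed
  from open_nonzero[OF X, OF this[OF order_refl]]
  have o: "zopen X {r \<in> H. (\<Sum>i<n. f i q * g i r) \<noteq> 0}" .
  have "q \<notin> {r \<in> H. (\<Sum>i<n. f i q * g i r) \<noteq> 0}" using z GH(1) by auto
  then show "\<exists>H. p \<in> H \<and> H \<subseteq> points X - {q} \<and> zopen X H"
    using o open_subset_points[OF o] GH(2) nz
    by (intro exI[of _ "{r \<in> H. (\<Sum>i<n. f i q * g i r) \<noteq> 0}"]) auto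
qed

lemma space_scale_add:
  assumes X: "space_with_functions X" and f: "X G f"
  shows "X G (\<lambda>z. k + c * f z)"
proof -
  note o = regular_open[OF X, OF f]
  show ?thesis
    by (rule regular_add[OF X, OF regular_const[OF X, OF o]
          regular_mult[OF X, OF regular_const[OF X, OF o] f]])
qed

section \<open>Tangent vectors and morphisms\<close>

lemma tangent_spaceI:
  assumes "\<And>f. f \<notin> local_functions X p \<Longrightarrow> v f = 0" "\<And>c. v (\<lambda>_. c) = 0"
    and "\<And>f g. f \<in> local_functions X p \<Longrightarrow> g \<in> local_functions X p \<Longrightarrow>
      v (\<lambda>q. f q + g q) = v f + v g"
    and "\<And>f g. f \<in> local_functions X p \<Longrightarrow> g \<in> local_functions X p \<Longrightarrow>
      v (\<lambda>q. f q * g q) = f p * v g + g p * v f"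
  shows "v \<in> tangent_space X p"
  using assms unfolding tangent_space_def by simp

lemma tangent_nonlocal: "v \<in> tangent_space X p \<Longrightarrow> f \<notin> local_functions X p \<Longrightarrow> v f = 0"
  by (simp add: tangent_space_def)

lemma tangent_const: "v \<in> tangent_space X p \<Longrightarrow> v (\<lambda>_. c) = 0"
  by (simp add: tangent_space_def)

lemma tangent_add:
  "v \<in> tangent_space X p \<Longrightarrow> f \<in> local_functions X p \<Longrightarrow> g \<in> local_functions X p \<Longrightarrow>
    v (\<lambda>q. f q + g q) = v f + v g"
  by (simp add: tangent_space_def)

lemma tangent_mult:
  "v \<in> tangent_space X p \<Longrightarrow> f \<in> local_functions X p \<Longrightarrow> g \<in> local_functions X p \<Longrightarrow>
    v (\<lambda>q. f q * g q) = f p * v g + g p * v f"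
  by (simp add: tangent_space_def)

lemma tangent_lincomb:
  "v \<in> tangent_space X p \<Longrightarrow> w \<in> tangent_space X p \<Longrightarrow> (\<lambda>f. a * v f + b * w f) \<in> tangent_space X p"
  by (auto simp: tangent_space_def algebra_simps)

context
  fixes X :: "('p, 'k::field) fspace"
  assumes space: "space_with_functions X"
begin

text \<open>Tangent vectors depend only on germs of functions.\<close>

lemma tangent_germ:
  assumes v: "v \<in> tangent_space X p"
    and H: "zopen X H" "p \<in> H" and eq: "\<And>q. q \<in> H \<Longrightarrow> f q = g q"
  shows "v f = v g"
proof -
  have loc: "g' \<in> local_functions X p"
    if f': "f' \<in> local_functions X p" and eq': "\<And>q. q \<in> H \<Longrightarrow> f' q = g' q" for f' g'
  proof -
    obtain G where G: "p \<in> G" "X G f'" by (rule local_functionsE[OF space, OF f'])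
    have "X (G \<inter> H) f'"
      by (rule regular_restrict[OF space, OF G(2) open_Int[OF space, OF regular_open[OF space, OF G(2)] H(1)]]) simp
    then have "X (G \<inter> H) g'"
      by (rule regular_cong[OF space]) (use eq' in simp)
    then show ?thesis by (rule local_functionsI[OF space]) (use G H in simp)
  qed
  show ?thesis
  proof (cases "f \<in> local_functions X p")
    case True
    then have g: "g \<in> local_functions X p" using loc eq by blast
    let ?h = "\<lambda>q. if q \<in> H then 1 else 0 :: 'k"
    have h: "?h \<in> local_functions X p"
    proof (rule loc[of "\<lambda>_. 1"])
      show "(\<lambda>_. 1) \<in> local_functions X p"
        by (rule local_functionsI[OF space, OF regular_const[OF space, OF H(1)] H(2)])
    qed simp
    \<comment> \<open>The function that is 1 on \<open>H\<close> and 0 elsewhere is idempotent, so it has derivative 0.\<close>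
    have "v (\<lambda>q. ?h q * ?h q) = ?h p * v ?h + ?h p * v ?h"
      by (rule tangent_mult[OF v h h])
    moreover have "(\<lambda>q. ?h q * ?h q) = ?h" by auto
    ultimately have "v ?h = v ?h + v ?h" using H(2) by simp
    then have "v ?h = 0" by (simp only: add_cancel_right_right)
    then have cut: "v (\<lambda>q. ?h q * f' q) = v f'" if "f' \<in> local_functions X p" for f'
      using tangent_mult[OF v h that] H(2) by simp
    have "(\<lambda>q. ?h q * f q) = (\<lambda>q. ?h q * g q)" using eq by auto
    then have "v (\<lambda>q. ?h q * f q) = v (\<lambda>q. ?h q * g q)" by (rule arg_cong)
    then show ?thesis unfolding cut[OF True] cut[OF g] .
  next
    case False
    moreover have "g \<notin> local_functions X p" using False loc[of g f] eq by metis
    ultimately show ?thesis using tangent_nonlocal[OF v] by simp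
  qed
qed

lemma tangent_diff_const:
  assumes v: "v \<in> tangent_space X p" and f: "f \<in> local_functions X p"
  shows "v (\<lambda>q. f q - c) = v f"
proof -
  obtain G where G: "p \<in> G" "X G f" by (rule local_functionsE[OF space, OF f])
  have "(\<lambda>_. - c) \<in> local_functions X p"
    by (rule local_functionsI[OF space, OF regular_const[OF space, OF regular_open[OF space, OF G(2)]] G(1)])
  then show ?thesis
    using tangent_add[OF v f, of "\<lambda>_. - c"] tangent_const[OF v, of "- c"] by simp
qed

lemma tangent_inverse:
  assumes v: "v \<in> tangent_space X p" and f: "X G f" "p \<in> G" "f p \<noteq> 0"
  shows "v (\<lambda>q. inverse (f q)) = - (inverse (f p))\<^sup>2 * v f"
proof -
  let ?H = "{q \<in> G. f q \<noteq> 0}"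
  have H: "X ?H (\<lambda>q. inverse (f q))" by (rule regular_inverse[OF space, OF f(1)])
  have "f p * v (\<lambda>q. inverse (f q)) + inverse (f p) * v f = v (\<lambda>q. f q * inverse (f q))"
    by (rule tangent_mult[OF v local_functionsI[OF space, of G f] local_functionsI[OF space, of ?H], symmetric])
      (use f H in auto)
  also have "\<dots> = v (\<lambda>_. 1)"
    by (rule tangent_germ[OF v regular_open[OF space, OF H]]) (use f in auto)
  also have "\<dots> = 0" by (rule tangent_const[OF v])
  finally show ?thesis using f(3) by (simp add: field_simps power2_eq_square eq_neg_iff_add_eq_0)
qed

end

lemma tangent_to_tangent: "v \<in> tangent_to X F z \<Longrightarrow> v \<in> tangent_space X z"
  by (simp add: tangent_to_def)

lemma tangent_to_zero:
  assumes "v \<in> tangent_to X F z" "X G f" "z \<in> G" "\<And>q. q \<in> G \<Longrightarrow> q \<in> F \<Longrightarrow> f q = 0"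
  shows "v f = 0"
proof -
  have "\<forall>G f. z \<in> G \<and> X G f \<and> (\<forall>q\<in>G \<inter> F. f q = 0) \<longrightarrow> v f = 0"
    using assms(1) unfolding tangent_to_def by simp
  from this[THEN spec[of _ G], THEN spec[of _ f]] show ?thesis using assms(2-4) by simp
qed

lemma tangent_to_scale:
  assumes "v \<in> tangent_to X F z"
  shows "(\<lambda>f. c * v f) \<in> tangent_to X F z"
proof -
  have "(\<lambda>f. c * v f + 0 * v f) \<in> tangent_space X z"
    by (rule tangent_lincomb) (rule tangent_to_tangent[OF assms])+
  moreover have "c * v f = 0" if "z \<in> G \<and> X G f \<and> (\<forall>q\<in>G \<inter> F. f q = 0)" for G f
    using tangent_to_zero[OF assms, of G f] that by simp
  ultimately show ?thesis unfolding tangent_to_def by simp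
qed

lemma tangent_scale_add:
  assumes X: "space_with_functions X" and v: "v \<in> tangent_space X q" and f: "X G f" and q: "q \<in> G"
  shows "v (\<lambda>z. k + c * f z) = c * v f"
proof -
  note o = regular_open[OF X, OF f]
  note const = local_functionsI[OF X, OF regular_const[OF X, OF o] q]
  note loc = local_functionsI[OF X, OF f q]
  show ?thesis
    using tangent_add[OF v const local_mult[OF X, OF const loc], of k c]
      tangent_mult[OF v const loc, of c] tangent_const[OF v, of k] tangent_const[OF v, of c]
    by simp
qed

text \<open>Regular functions pull back to regular functions on the full preimage, so that a morphism is in
  particular continuous.\<close>

definition morphism :: "('q, 'k::field) fspace \<Rightarrow> ('p, 'k) fspace \<Rightarrow> ('q \<Rightarrow> 'p) \<Rightarrow> bool" where
  "morphism Z X \<phi> \<longleftrightarrow>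
     (\<forall>z\<in>points Z. \<phi> z \<in> points X) \<and>
     (\<forall>G f. X G f \<longrightarrow> Z {z\<in>points Z. \<phi> z \<in> G} (\<lambda>z. f (\<phi> z)))"

lemma morphism_regular:
  "morphism Z X \<phi> \<Longrightarrow> X G f \<Longrightarrow> Z {z\<in>points Z. \<phi> z \<in> G} (\<lambda>z. f (\<phi> z))"
  unfolding morphism_def by simp

lemma morphism_points: "morphism Z X \<phi> \<Longrightarrow> z \<in> points Z \<Longrightarrow> \<phi> z \<in> points X"
  unfolding morphism_def by simp

lemma morphism_const:
  assumes Z: "space_with_functions Z" and X: "space_with_functions X" and q: "q \<in> points X"
  shows "morphism Z X (\<lambda>_. q)"
  unfolding morphism_def
proof (intro conjI ballI allI impI q)
  fix G f
  have "Z {} (\<lambda>_. f q)"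
    by (rule regular_glue[OF Z]) simp
  moreover have "Z (points Z) (\<lambda>_. f q)" by (rule regular_const[OF Z, OF open_points[OF Z]])
  ultimately show "Z {z \<in> points Z. q \<in> G} (\<lambda>_. f q)" by (cases "q \<in> G") auto
qed

lemma pushforward_apply:
  assumes "space_with_functions X" "X G f" "\<phi> z \<in> G"
  shows "pushforward X \<phi> z v f = v (\<lambda>z. f (\<phi> z))"
  using local_functionsI[OF assms] by (simp add: pushforward_def)

lemma pushforward_tangent:
  assumes X: "space_with_functions X" and \<phi>: "morphism Z X \<phi>" and z: "z \<in> points Z"
    and v: "v \<in> tangent_space Z z"
  shows "pushforward X \<phi> z v \<in> tangent_space X (\<phi> z)"
proof -
  have loc: "(\<lambda>z. f (\<phi> z)) \<in> local_functions Z z" if f: "f \<in> local_functions X (\<phi> z)" for f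
  proof -
    obtain G where G: "\<phi> z \<in> G" "X G f" by (rule local_functionsE[OF X, OF f])
    have "Z {z\<in>points Z. \<phi> z \<in> G} (\<lambda>z. f (\<phi> z))" using \<phi> G(2) unfolding morphism_def by simp
    then show ?thesis
      unfolding local_functions_def
      by (intro CollectI exI[of _ "{z \<in> points Z. \<phi> z \<in> G}"]) (use G(1) z in simp)
  qed
  show ?thesis
  proof (rule tangent_spaceI)
    fix f g assume fg: "f \<in> local_functions X (\<phi> z)" "g \<in> local_functions X (\<phi> z)"
    show "pushforward X \<phi> z v (\<lambda>q. f q + g q) = pushforward X \<phi> z v f + pushforward X \<phi> z v g"
      using tangent_add[OF v loc[OF fg(1)] loc[OF fg(2)]] fg local_add[OF X fg]
      by (simp add: pushforward_def)
    show "pushforward X \<phi> z v (\<lambda>q. f q * g q) =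
        f (\<phi> z) * pushforward X \<phi> z v g + g (\<phi> z) * pushforward X \<phi> z v f"
      using tangent_mult[OF v loc[OF fg(1)] loc[OF fg(2)]] fg local_mult[OF X fg]
      by (simp add: pushforward_def)
  qed (simp_all add: pushforward_def tangent_const[OF v])
qed

section \<open>The affine line\<close>

text \<open>A function on a set \<open>G\<close> of scalars is regular at \<open>u \<in> G\<close> if it is a fraction of polynomials
  outside the zeros of a denominator that does not vanish at \<open>u\<close>; \<open>G\<close> must contain the complement
  of these zeros, so that it is open.\<close>

definition affine_line :: "('k::field, 'k) fspace" where
  "affine_line G f \<longleftrightarrow>
     (\<forall>u\<in>G. \<exists>P Q. poly Q u \<noteq> 0 \<and> (\<forall>w. poly Q w \<noteq> 0 \<longrightarrow> w \<in> G \<and> f w = poly P w / poly Q w))"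

lemma affine_lineE:
  assumes "affine_line G f" "u \<in> G"
  obtains Q P where "poly Q u \<noteq> 0"
    "\<forall>w. poly Q w \<noteq> 0 \<longrightarrow> w \<in> G \<and> f w = poly P w / poly Q w"
  using assms unfolding affine_line_def by meson

lemma affine_lineI:
  assumes "\<And>u. u \<in> G \<Longrightarrow> \<exists>P Q. poly Q u \<noteq> 0 \<and>
    (\<forall>w. poly Q w \<noteq> 0 \<longrightarrow> w \<in> G \<and> f w = poly P w / poly Q w)"
  shows "affine_line G f"
  using assms unfolding affine_line_def by blast

lemma points_affine_line: "points affine_line = UNIV"
proof -
  have "affine_line UNIV (\<lambda>_. 0)"
    by (rule affine_lineI, rule exI[of _ 0], rule exI[of _ 1]) simp
  then show ?thesis by (auto simp: points_def zopen_def)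
qed

lemma affine_line_id: "affine_line UNIV (\<lambda>u. u)"
  by (rule affine_lineI, rule exI[of _ "[:0, 1:]"], rule exI[of _ 1]) simp

lemma zopen_affine_line:
  "zopen affine_line G \<longleftrightarrow> (\<forall>u\<in>G. \<exists>Q. poly Q u \<noteq> 0 \<and> (\<forall>w. poly Q w \<noteq> 0 \<longrightarrow> w \<in> G))"
proof
  assume G: "\<forall>u\<in>G. \<exists>Q. poly Q u \<noteq> 0 \<and> (\<forall>w. poly Q w \<noteq> 0 \<longrightarrow> w \<in> G)"
  have "affine_line G (\<lambda>_. 0)"
  proof (rule affine_lineI)
    fix u assume "u \<in> G"
    then obtain Q where "poly Q u \<noteq> 0" "\<forall>w. poly Q w \<noteq> 0 \<longrightarrow> w \<in> G" using G by blast
    then show "\<exists>P Q. poly Q u \<noteq> 0 \<and> (\<forall>w. poly Q w \<noteq> 0 \<longrightarrow> w \<in> G \<and> 0 = poly P w / poly Q w)"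
      by (intro exI[of _ 0] exI[of _ Q]) auto
  qed
  then show "zopen affine_line G" unfolding zopen_def by (rule exI[of "affine_line G"])
qed (unfold zopen_def affine_line_def, blast)

lemma space_affine_line: "space_with_functions (affine_line :: ('k::field, 'k) fspace)"
proof (rule space_with_functionsI)
  have "zopen affine_line (G \<inter> H)"
    if G: "zopen affine_line G" and H: "zopen affine_line H" for G H :: "'k set"
    unfolding zopen_affine_line
  proof
    fix u assume u: "u \<in> G \<inter> H"
    obtain Q where "poly Q u \<noteq> 0" "\<forall>w. poly Q w \<noteq> 0 \<longrightarrow> w \<in> G"
      using G u unfolding zopen_affine_line by blast
    moreover obtain Q' where "poly Q' u \<noteq> 0" "\<forall>w. poly Q' w \<noteq> 0 \<longrightarrow> w \<in> H"
      using H u unfolding zopen_affine_line by blast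
    ultimately show "\<exists>Q. poly Q u \<noteq> 0 \<and> (\<forall>w. poly Q w \<noteq> 0 \<longrightarrow> w \<in> G \<inter> H)"
      by (intro exI[of _ "Q * Q'"]) auto
  qed
  moreover have "zopen affine_line (\<Union>K)" if K: "\<forall>G\<in>K. zopen affine_line G" for K :: "'k set set"
    unfolding zopen_affine_line
  proof
    fix u assume "u \<in> \<Union>K"
    then obtain G where "G \<in> K" "u \<in> G" by blast
    moreover from this obtain Q where "poly Q u \<noteq> 0" "\<forall>w. poly Q w \<noteq> 0 \<longrightarrow> w \<in> G"
      using K unfolding zopen_affine_line by blast
    ultimately show "\<exists>Q. poly Q u \<noteq> 0 \<and> (\<forall>w. poly Q w \<noteq> 0 \<longrightarrow> w \<in> \<Union>K)" by blast
  qed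
  ultimately show "istopology (zopen (affine_line :: ('k, 'k) fspace))"
    unfolding istopology_def by simp
next
  fix G :: "'k set" and c :: 'k
  assume G: "zopen affine_line G"
  show "affine_line G (\<lambda>_. c)"
  proof (rule affine_lineI)
    fix u assume "u \<in> G"
    then obtain Q where "poly Q u \<noteq> 0" "\<forall>w. poly Q w \<noteq> 0 \<longrightarrow> w \<in> G"
      using G unfolding zopen_affine_line by blast
    then show "\<exists>P Q. poly Q u \<noteq> 0 \<and> (\<forall>w. poly Q w \<noteq> 0 \<longrightarrow> w \<in> G \<and> c = poly P w / poly Q w)"
      by (intro exI[of _ "smult c Q"] exI[of _ Q]) auto
  qed
next
  fix G :: "'k set" and f g
  assume f: "affine_line G f" and g: "affine_line G g"
  show "affine_line G (\<lambda>p. f p + g p)"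
  proof (rule affine_lineI)
    fix u assume u: "u \<in> G"
    obtain P Q where PQ: "poly Q u \<noteq> 0" "\<forall>w. poly Q w \<noteq> 0 \<longrightarrow> w \<in> G \<and> f w = poly P w / poly Q w"
      by (rule affine_lineE[OF f u])
    obtain P' Q' where PQ': "poly Q' u \<noteq> 0" "\<forall>w. poly Q' w \<noteq> 0 \<longrightarrow> w \<in> G \<and> g w = poly P' w / poly Q' w"
      by (rule affine_lineE[OF g u])
    show "\<exists>P Q. poly Q u \<noteq> 0 \<and> (\<forall>w. poly Q w \<noteq> 0 \<longrightarrow> w \<in> G \<and> f w + g w = poly P w / poly Q w)"
      using PQ PQ'
      by (intro exI[of _ "P * Q' + P' * Q"] exI[of _ "Q * Q'"]) (auto simp: add_frac_eq)
  qed
  show "affine_line G (\<lambda>p. f p * g p)"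
  proof (rule affine_lineI)
    fix u assume u: "u \<in> G"
    obtain P Q where PQ: "poly Q u \<noteq> 0" "\<forall>w. poly Q w \<noteq> 0 \<longrightarrow> w \<in> G \<and> f w = poly P w / poly Q w"
      by (rule affine_lineE[OF f u])
    obtain P' Q' where PQ': "poly Q' u \<noteq> 0" "\<forall>w. poly Q' w \<noteq> 0 \<longrightarrow> w \<in> G \<and> g w = poly P' w / poly Q' w"
      by (rule affine_lineE[OF g u])
    show "\<exists>P Q. poly Q u \<noteq> 0 \<and> (\<forall>w. poly Q w \<noteq> 0 \<longrightarrow> w \<in> G \<and> f w * g w = poly P w / poly Q w)"
      using PQ PQ' by (intro exI[of _ "P * P'"] exI[of _ "Q * Q'"]) auto
  qed
next
  fix G :: "'k set" and f
  assume f: "affine_line G f"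
  show "affine_line {p \<in> G. f p \<noteq> 0} (\<lambda>p. inverse (f p))"
  proof (rule affine_lineI)
    fix u assume u: "u \<in> {p \<in> G. f p \<noteq> 0}"
    then have uG: "u \<in> G" by simp
    obtain P Q where PQ: "poly Q u \<noteq> 0" "\<forall>w. poly Q w \<noteq> 0 \<longrightarrow> w \<in> G \<and> f w = poly P w / poly Q w"
      by (rule affine_lineE[OF f uG])
    then show "\<exists>P Q. poly Q u \<noteq> 0 \<and>
        (\<forall>w. poly Q w \<noteq> 0 \<longrightarrow> w \<in> {p \<in> G. f p \<noteq> 0} \<and> inverse (f w) = poly P w / poly Q w)"
      using u by (intro exI[of _ "Q * Q"] exI[of _ "P * Q"]) auto
  qed
next
  fix G H :: "'k set" and f
  assume f: "affine_line G f" and H: "zopen affine_line H" and "H \<subseteq> G"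
  show "affine_line H f"
  proof (rule affine_lineI)
    fix u assume u: "u \<in> H"
    obtain P Q where PQ: "poly Q u \<noteq> 0"
      "\<forall>w. poly Q w \<noteq> 0 \<longrightarrow> w \<in> G \<and> f w = poly P w / poly Q w"
      by (rule affine_lineE[OF f subsetD[OF \<open>H \<subseteq> G\<close> u]])
    obtain R where "poly R u \<noteq> 0" "\<forall>w. poly R w \<noteq> 0 \<longrightarrow> w \<in> H"
      using H u unfolding zopen_affine_line by blast
    then show "\<exists>P Q. poly Q u \<noteq> 0 \<and> (\<forall>w. poly Q w \<noteq> 0 \<longrightarrow> w \<in> H \<and> f w = poly P w / poly Q w)"
      using PQ by (intro exI[of _ "P * R"] exI[of _ "Q * R"]) auto
  qed
next
  fix G :: "'k set" and f
  assume as: "\<And>p. p \<in> G \<Longrightarrow> \<exists>H g. p \<in> H \<and> H \<subseteq> G \<and> affine_line H g \<and> (\<forall>q\<in>H. f q = g q)"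
  show "affine_line G f"
  proof (rule affine_lineI)
    fix u assume "u \<in> G"
    then obtain H g where H: "u \<in> H" "H \<subseteq> G" "affine_line H g" "\<forall>q\<in>H. f q = g q"
      using as by metis
    obtain P Q where "poly Q u \<noteq> 0" "\<forall>w. poly Q w \<noteq> 0 \<longrightarrow> w \<in> H \<and> g w = poly P w / poly Q w"
      by (rule affine_lineE[OF H(3,1)])
    then show "\<exists>P Q. poly Q u \<noteq> 0 \<and> (\<forall>w. poly Q w \<noteq> 0 \<longrightarrow> w \<in> G \<and> f w = poly P w / poly Q w)"
      using H by (intro exI[of _ P] exI[of _ Q]) auto
  qed
qed

text \<open>The quotient rule gives the same value for two fractions that agree wherever both are
  defined, as a polynomial over an infinite field is determined by its values.\<close>

lemma fraction_derivative_unique: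
  fixes P Q P' Q' :: "'k::field_char_0 poly"
  assumes Q: "poly Q u \<noteq> 0" and Q': "poly Q' u \<noteq> 0"
    and eq: "\<And>w. poly Q w \<noteq> 0 \<Longrightarrow> poly Q' w \<noteq> 0 \<Longrightarrow> poly P w / poly Q w = poly P' w / poly Q' w"
  shows "(poly (pderiv P) u * poly Q u - poly P u * poly (pderiv Q) u) / (poly Q u)\<^sup>2 =
         (poly (pderiv P') u * poly Q' u - poly P' u * poly (pderiv Q') u) / (poly Q' u)\<^sup>2"
proof -
  have "poly ((P * Q' - P' * Q) * (Q * Q')) w = 0" for w
    using eq[of w] by (cases "poly Q w = 0"; cases "poly Q' w = 0") (auto simp: field_simps)
  then have "(P * Q' - P' * Q) * (Q * Q') = 0" using poly_all_0_iff_0 by blast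
  then have PQ: "P * Q' = P' * Q" using Q Q' by auto
  then have "poly (pderiv (P * Q')) u = poly (pderiv (P' * Q)) u" by simp
  then have d: "poly P u * poly (pderiv Q') u + poly (pderiv P) u * poly Q' u =
      poly P' u * poly (pderiv Q) u + poly (pderiv P') u * poly Q u"
    by (simp add: pderiv_mult algebra_simps)
  have e: "poly P u * poly Q' u = poly P' u * poly Q u" using arg_cong[OF PQ, of "\<lambda>R. poly R u"] by simp
  have "(dp * q - p * dq) * q'\<^sup>2 = (dp' * q' - p' * dq') * q\<^sup>2"
    if "p * q' = p' * q" "p * dq' + dp * q' = p' * dq + dp' * q" for p q p' q' dp dq dp' dq' :: 'k
    using that by algebra
  from this[OF e d] show ?thesis using Q Q' by (simp add: frac_eq_eq)
qed

lemma affine_line_derivation: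
  fixes u :: "'k::field_char_0"
  shows "\<exists>v\<in>tangent_space affine_line u. v (\<lambda>w. w) = 1"
proof -
  define frac where "frac f P Q \<longleftrightarrow> poly Q u \<noteq> 0 \<and> (\<forall>w. poly Q w \<noteq> 0 \<longrightarrow> f w = poly P w / poly Q w)"
    for f :: "'k \<Rightarrow> 'k" and P Q
  define der where "der P Q = (poly (pderiv P) u * poly Q u - poly P u * poly (pderiv Q) u) / (poly Q u)\<^sup>2"
    for P Q
  define v where "v f = (if f \<in> local_functions affine_line u
      then THE d. \<exists>P Q. frac f P Q \<and> d = der P Q else 0)" for f
  have ex: "\<exists>P Q. frac f P Q" if "f \<in> local_functions affine_line u" for f
    using that unfolding local_functions_def affine_line_def frac_def by blast
  have der: "v f = der P Q" if "f \<in> local_functions affine_line u" "frac f P Q" for f P Q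
  proof -
    have "der P' Q' = der P Q" if fr: "frac f P' Q'" for P' Q'
      unfolding der_def using fr \<open>frac f P Q\<close> unfolding frac_def
      by (intro fraction_derivative_unique) auto
    then have "(THE d. \<exists>P Q. frac f P Q \<and> d = der P Q) = der P Q"
      using that(2) by (intro the_equality) blast+
    then show ?thesis using that(1) by (simp add: v_def)
  qed
  have G: "zopen affine_line (UNIV :: 'k set)"
    using open_points[OF space_affine_line] by (simp add: points_affine_line)
  have const: "(\<lambda>_. c) \<in> local_functions affine_line u" for c :: 'k
    by (rule local_functionsI[OF space_affine_line, OF regular_const[OF space_affine_line, OF G] UNIV_I])
  have v_const: "v (\<lambda>_. c) = 0" for c
    using der[OF const, of c "[:c:]" 1] by (simp add: frac_def der_def)
  have v_ring: "v (\<lambda>q. f q + g q) = v f + v g \<and> v (\<lambda>q. f q * g q) = f u * v g + g u * v f"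
    if f: "f \<in> local_functions affine_line u" and g: "g \<in> local_functions affine_line u" for f g
  proof -
    note loc = local_add[OF space_affine_line f g] and loc' = local_mult[OF space_affine_line f g]
    obtain P Q where PQ: "frac f P Q" using ex[OF f] by blast
    obtain P' Q' where PQ': "frac g P' Q'" using ex[OF g] by blast
    have "frac (\<lambda>q. f q + g q) (P * Q' + P' * Q) (Q * Q')" "frac (\<lambda>q. f q * g q) (P * P') (Q * Q')"
      using PQ PQ' by (auto simp: frac_def add_frac_eq)
    then have "v (\<lambda>q. f q + g q) = der (P * Q' + P' * Q) (Q * Q')"
      "v (\<lambda>q. f q * g q) = der (P * P') (Q * Q')" "v f = der P Q" "v g = der P' Q'"
      using der[OF loc] der[OF loc'] der[OF f PQ] der[OF g PQ'] by auto
    moreover have fg: "f u = poly P u / poly Q u" "g u = poly P' u / poly Q' u"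
      "poly Q u \<noteq> 0" "poly Q' u \<noteq> 0"
      using PQ PQ' by (auto simp: frac_def)
    have "der (P * Q' + P' * Q) (Q * Q') = der P Q + der P' Q'"
      "der (P * P') (Q * Q') = f u * der P' Q' + g u * der P Q"
      using fg(3,4) unfolding fg(1,2)
      by (simp_all add: der_def pderiv_mult pderiv_add field_simps power2_eq_square)
    ultimately show ?thesis by simp
  qed
  have v_tangent: "v \<in> tangent_space affine_line u"
  proof (rule tangent_spaceI)
    show "v f = 0" if "f \<notin> local_functions affine_line u" for f using that by (simp add: v_def)
    show "v (\<lambda>_. c) = 0" for c by (rule v_const)
    fix f g assume "f \<in> local_functions affine_line u" "g \<in> local_functions affine_line u"
    from v_ring[OF this] show "v (\<lambda>q. f q + g q) = v f + v g" "v (\<lambda>q. f q * g q) = f u * v g + g u * v f"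
      by simp_all
  qed
  have loc_id: "(\<lambda>w. w) \<in> local_functions affine_line u"
    by (rule local_functionsI[OF space_affine_line, OF affine_line_id UNIV_I])
  have "frac (\<lambda>w. w) [:0, 1:] 1" by (simp add: frac_def)
  then have "v (\<lambda>w. w) = der [:0, 1:] 1" by (rule der[OF loc_id])
  then have "v (\<lambda>w. w) = 1" by (simp add: der_def pderiv_pCons)
  then show ?thesis using v_tangent by (rule bexI[of _ v])
qed

section \<open>Bundles of lines\<close>

context
  fixes X :: "('p, 'k::field) fspace" and E :: "'q set" and \<pi> :: "'q \<Rightarrow> 'p"
    and \<delta> :: "'q \<Rightarrow> ('p, 'k) vec set"
  assumes space: "space_with_functions X" and \<pi>: "\<And>y. y \<in> E \<Longrightarrow> \<pi> y \<in> points X"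
begin

lemma line_bundle_subset: "line_bundle_space X E \<pi> \<delta> G f \<Longrightarrow> G \<subseteq> E"
proof (induction rule: line_bundle_space.induct)
  case (glue G f)
  show ?case
  proof
    fix y assume "y \<in> G"
    from glue.IH[OF this] show "y \<in> E" by (elim exE conjE) (erule subsetD, assumption)
  qed
qed auto

lemma line_bundle_const: "line_bundle_space X E \<pi> \<delta> E (\<lambda>_. c)"
proof -
  have "{y \<in> E. \<pi> y \<in> points X} = E" using \<pi> by blast
  then show ?thesis
    using line_bundle_space.pullback[of X "points X" "\<lambda>_. c" E \<pi> \<delta>,
      OF regular_const[OF space, OF open_points[OF space]]] by simp
qed

lemma line_bundle_const_on:
  assumes "line_bundle_space X E \<pi> \<delta> G f"
  shows "line_bundle_space X E \<pi> \<delta> G (\<lambda>_. c)"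
proof -
  have "E \<inter> G = G" "G \<inter> E = G" using line_bundle_subset[OF assms] by blast+
  then show ?thesis
    using line_bundle_space.add[OF line_bundle_space.mult[OF assms line_bundle_const[of 0]]
      line_bundle_const[of c]]
    by simp
qed

lemma points_line_bundle: "points (line_bundle_space X E \<pi> \<delta>) = E"
proof
  show "points (line_bundle_space X E \<pi> \<delta>) \<subseteq> E"
    unfolding points_def zopen_def using line_bundle_subset by blast
  have "zopen (line_bundle_space X E \<pi> \<delta>) E"
    unfolding zopen_def using line_bundle_const[of 0]
    by (rule exI[of "line_bundle_space X E \<pi> \<delta> E"])
  then show "E \<subseteq> points (line_bundle_space X E \<pi> \<delta>)" unfolding points_def by blast
qed

lemma space_line_bundle: "space_with_functions (line_bundle_space X E \<pi> \<delta>)"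
proof (rule space_with_functionsI)
  let ?L = "line_bundle_space X E \<pi> \<delta>"
  have "zopen ?L (G \<inter> H)" if G: "zopen ?L G" and H: "zopen ?L H" for G H
  proof -
    obtain f where "?L G f" using G unfolding zopen_def by (rule exE)
    moreover obtain g where "?L H g" using H unfolding zopen_def by (rule exE)
    ultimately have "?L (G \<inter> H) (\<lambda>y. f y + g y)" by (rule line_bundle_space.add)
    then show ?thesis unfolding zopen_def by (rule exI[of "?L (G \<inter> H)"])
  qed
  moreover have "zopen ?L (\<Union>K)" if K: "\<forall>G\<in>K. zopen ?L G" for K
  proof -
    have "?L (\<Union>K) (\<lambda>_. 0)"
    proof (rule line_bundle_space.glue)
      fix y assume "y \<in> \<Union>K"
      then obtain G where G: "G \<in> K" "y \<in> G" by blast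
      then have "zopen ?L G" using K by blast
      then obtain f where "?L G f" unfolding zopen_def by (rule exE)
      then have "?L G (\<lambda>_. 0)" by (rule line_bundle_const_on)
      then show "\<exists>H g. y \<in> H \<and> H \<subseteq> \<Union>K \<and> ?L H g \<and> (\<forall>z\<in>H. 0 = g z)"
        using G by (intro exI[of _ G] exI[of _ "\<lambda>_. 0"]) auto
    qed
    then show ?thesis unfolding zopen_def by (rule exI[of "?L (\<Union>K)"])
  qed
  ultimately show "istopology (zopen ?L)" unfolding istopology_def by simp
next
  fix G and c :: 'k
  assume "zopen (line_bundle_space X E \<pi> \<delta>) G"
  then obtain f where "line_bundle_space X E \<pi> \<delta> G f" unfolding zopen_def by (rule exE)
  then show "line_bundle_space X E \<pi> \<delta> G (\<lambda>_. c)" by (rule line_bundle_const_on)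
next
  fix G f g
  assume fg: "line_bundle_space X E \<pi> \<delta> G f" "line_bundle_space X E \<pi> \<delta> G g"
  show "line_bundle_space X E \<pi> \<delta> G (\<lambda>y. f y + g y)" "line_bundle_space X E \<pi> \<delta> G (\<lambda>y. f y * g y)"
    using line_bundle_space.add[OF fg] line_bundle_space.mult[OF fg] by simp_all
next
  fix G f
  assume "line_bundle_space X E \<pi> \<delta> G f"
  then show "line_bundle_space X E \<pi> \<delta> {y \<in> G. f y \<noteq> 0} (\<lambda>y. inverse (f y))"
    by (rule line_bundle_space.inverse)
next
  fix G H f
  assume f: "line_bundle_space X E \<pi> \<delta> G f" and H: "zopen (line_bundle_space X E \<pi> \<delta>) H" and "H \<subseteq> G"
  obtain h where "line_bundle_space X E \<pi> \<delta> H h" using H unfolding zopen_def by (rule exE)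
  then have "line_bundle_space X E \<pi> \<delta> H (\<lambda>_. 0)" by (rule line_bundle_const_on)
  moreover have "G \<inter> H = H" using \<open>H \<subseteq> G\<close> by blast
  ultimately show "line_bundle_space X E \<pi> \<delta> H f"
    using line_bundle_space.add[OF f \<open>line_bundle_space X E \<pi> \<delta> H (\<lambda>_. 0)\<close>] by simp
next
  fix G f
  assume "\<And>y. y \<in> G \<Longrightarrow> \<exists>H g. y \<in> H \<and> H \<subseteq> G \<and> line_bundle_space X E \<pi> \<delta> H g \<and> (\<forall>q\<in>H. f q = g q)"
  then show "line_bundle_space X E \<pi> \<delta> G f" by (rule line_bundle_space.glue)
qed

end

text \<open>On a line of tangent vectors, \<open>df/dg\<close> can be computed with any vector on which \<open>dg\<close> is
  nonzero.\<close>

lemma dquot_eq: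
  assumes L: "is_line L" and v: "v \<in> L" "v g \<noteq> 0"
  shows "dquot L f g = v f / v g"
proof -
  obtain v0 where v0: "L = {\<lambda>f. c * v0 f | c. True}" using L unfolding is_line_def by blast
  obtain b where b: "v = (\<lambda>f. b * v0 f)" using v v0 by blast
  show ?thesis
    unfolding dquot_def
  proof (rule the_equality)
    show "\<forall>w\<in>L. w f = v f / v g * w g"
    proof
      fix w assume "w \<in> L"
      then obtain c where "w = (\<lambda>f. c * v0 f)" using v0 by blast
      then show "w f = v f / v g * w g" using v(2) unfolding b by simp
    qed
    fix c assume "\<forall>w\<in>L. w f = c * w g"
    then have "v f = c * v g" using v(1) by blast
    then show "c = v f / v g" using v(2) by simp
  qed
qed

lemma line_scale: "is_line L \<Longrightarrow> v \<in> L \<Longrightarrow> (\<lambda>f. c * v f) \<in> L"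
  unfolding is_line_def by (force simp: mult.assoc[symmetric])

lemma line_lincomb:
  assumes "is_line L" "v \<in> L" "w \<in> L"
  shows "(\<lambda>f. a * v f + b * w f) \<in> L"
proof -
  obtain v0 where v0: "L = {\<lambda>f. c * v0 f | c. True}" using assms(1) unfolding is_line_def by blast
  obtain c d where "v = (\<lambda>f. c * v0 f)" "w = (\<lambda>f. d * v0 f)" using assms v0 by blast
  then have "(\<lambda>f. a * v f + b * w f) = (\<lambda>f. (a * c + b * d) * v0 f)"
    by (simp add: fun_eq_iff algebra_simps)
  then show ?thesis unfolding v0 by blast
qed

lemma line_zero: "is_line L \<Longrightarrow> (\<lambda>_. 0) \<in> L"
  unfolding is_line_def by force

lemma line_nonzero:
  assumes "is_line L"
  obtains v where "v \<in> L" "v \<noteq> (\<lambda>_. 0)"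
proof -
  obtain v where v: "v \<noteq> (\<lambda>_. 0)" "L = {\<lambda>f. c * v f | c. True}"
    using assms unfolding is_line_def by blast
  have "(\<lambda>f. 1 * v f) \<in> L" unfolding v(2) by blast
  then show ?thesis using that v(1) by simp
qed

section \<open>Charts of the monster tower\<close>

lemma letter_cases:
  fixes r s :: nat
  assumes "s \<in> {1, 2}" "r \<in> {1, 2}"
  shows "s = r \<and> r \<noteq> 3 - s \<or> s = 3 - r \<and> r = 3 - s"
proof -
  have "s = 1 \<or> s = 2" "r = 1 \<or> r = 2" using assms by simp_all
  then show ?thesis by (elim disjE; hypsubst) simp_all
qed

lemma letter_opposite:
  fixes r :: nat
  assumes "r \<in> {1, 2}"
  shows "3 - r \<in> {1, 2}" "3 - (3 - r) = r" "3 - r \<noteq> r"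
proof -
  have "r = 1 \<or> r = 2" using assms by simp
  then show "3 - r \<in> {1, 2}" "3 - (3 - r) = r" "3 - r \<noteq> r" by (elim disjE; simp)+
qed

text \<open>Active coordinates and the chart of a string, at the level given by its length.\<close>

definition act :: "('p, 'k::field) tower \<Rightarrow> (nat \<Rightarrow> 'p \<Rightarrow> 'k) \<Rightarrow> nat list \<Rightarrow> nat \<Rightarrow> 'p \<Rightarrow> 'k" where
  "act M x ps i = coord M x ps (length ps) i"

definition Chart :: "('p, 'k::field) tower \<Rightarrow> (nat \<Rightarrow> 'p \<Rightarrow> 'k) \<Rightarrow> nat list \<Rightarrow> 'p set" where
  "Chart M x ps = chart M x ps (length ps)"

lemma coord_append: "n \<le> length ps \<Longrightarrow> coord M x (ps @ qs) n i = coord M x ps n i"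
  by (induction n arbitrary: i) (auto simp: nth_append)

lemma chart_append: "n \<le> length ps \<Longrightarrow> chart M x (ps @ qs) n = chart M x ps n"
  by (induction n) (auto simp: nth_append coord_append)

lemma act_Nil: "act M x [] i = x i"
  by (simp add: act_def)

lemma act_snoc:
  "act M x (ps @ [p]) i =
     (if i = p then (\<lambda>y. act M x ps i (pr M (Suc (length ps)) y))
      else (\<lambda>y. dquot (dir M (Suc (length ps)) y) (act M x ps i) (act M x ps p)))"
  by (simp add: act_def coord_append)

lemma Chart_Nil: "Chart M x [] = points (level M 0)"
  by (simp add: Chart_def)

lemma Chart_snoc:
  "Chart M x (ps @ [p]) =
     {y\<in>points (level M (Suc (length ps))). pr M (Suc (length ps)) y \<in> Chart M x ps \<and>
        (\<exists>v\<in>dir M (Suc (length ps)) y. v (act M x ps p) \<noteq> 0)}"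
  by (simp add: Chart_def act_def coord_append chart_append)

text \<open>The tower over a base \<open>U\<close> with closed points, on which \<open>x\<^sub>1\<close> and \<open>x\<^sub>2\<close> trivialize the
  cotangent bundle and have a single common zero.\<close>

locale coordinate_tower =
  fixes M :: "('p, 'k::field_char_0) tower" and x :: "nat \<Rightarrow> 'p \<Rightarrow> 'k"
  assumes space_base: "space_with_functions (base M)"
    and cotangent: "trivialize_cotangent (base M) x"
    and tower: "monster_tower M"
    and closed_points: "\<And>q. q \<in> points (base M) \<Longrightarrow> zopen (base M) (points (base M) - {q})"
    and origin: "\<exists>!p. p \<in> points (base M) \<and> x 1 p = 0 \<and> x 2 p = 0"
begin

lemma pts_properties:
  assumes "y \<in> pts M (Suc k)"
  shows pr_points: "pr M (Suc k) y \<in> points (level M k)"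
    and dir_line: "is_line (dir M (Suc k) y)"
    and dir_focal: "dir M (Suc k) y \<subseteq> focal M k (pr M (Suc k) y)"
proof -
  have "bij_betw (\<lambda>y. (pr M (Suc k) y, dir M (Suc k) y)) (pts M (Suc k))
        {(q, L). q \<in> points (level M k) \<and> is_line L \<and> L \<subseteq> focal M k q}"
    using tower unfolding monster_tower_def by blast
  from bij_betwE[OF this] assms
  show "pr M (Suc k) y \<in> points (level M k)" "is_line (dir M (Suc k) y)"
    "dir M (Suc k) y \<subseteq> focal M k (pr M (Suc k) y)"
    by auto
qed

lemma point_of_line:
  assumes "q \<in> points (level M k)" "is_line L" "L \<subseteq> focal M k q"
  shows "\<exists>y\<in>pts M (Suc k). pr M (Suc k) y = q \<and> dir M (Suc k) y = L"
proof -
  have "(\<lambda>y. (pr M (Suc k) y, dir M (Suc k) y)) ` pts M (Suc k) =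
        {(q, L). q \<in> points (level M k) \<and> is_line L \<and> L \<subseteq> focal M k q}"
    using tower unfolding monster_tower_def bij_betw_def by blast
  moreover have "(q, L) \<in> {(q, L). q \<in> points (level M k) \<and> is_line L \<and> L \<subseteq> focal M k q}"
    using assms by simp
  ultimately have "(q, L) \<in> (\<lambda>y. (pr M (Suc k) y, dir M (Suc k) y)) ` pts M (Suc k)"
    by simp
  then show ?thesis by auto
qed

lemma point_eqI:
  assumes "y \<in> pts M (Suc k)" "y' \<in> pts M (Suc k)"
    "pr M (Suc k) y = pr M (Suc k) y'" "dir M (Suc k) y = dir M (Suc k) y'"
  shows "y = y'"
proof -
  have "inj_on (\<lambda>y. (pr M (Suc k) y, dir M (Suc k) y)) (pts M (Suc k))"
    using tower unfolding monster_tower_def bij_betw_def by blast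
  then show ?thesis using assms by (auto dest: inj_onD)
qed

lemma space_level: "space_with_functions (level M k)"
  by (induction k) (simp_all add: space_base space_line_bundle pr_points)

lemma points_level_Suc: "points (level M (Suc k)) = pts M (Suc k)"
  by (simp add: points_line_bundle space_level pr_points)

\<comment> \<open>The structure of a level is used only through its points, its regular functions and the
  projection from it.\<close>
declare level.simps(2) [simp del]

lemma morphism_pr: "morphism (level M (Suc k)) (level M k) (pr M (Suc k))"
  unfolding morphism_def
proof (intro conjI allI impI ballI)
  fix y assume "y \<in> points (level M (Suc k))"
  then show "pr M (Suc k) y \<in> points (level M k)" by (simp add: points_level_Suc pr_points)
next
  fix G f assume "level M k G f"
  then show "level M (Suc k) {z \<in> points (level M (Suc k)). pr M (Suc k) z \<in> G} (\<lambda>z. f (pr M (Suc k) z))"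
    unfolding points_level_Suc unfolding level.simps(2) by (rule line_bundle_space.pullback)
qed

lemma focal_tangent: "focal M k y \<subseteq> tangent_space (level M k) y"
  by (cases k) auto

lemma focal_dir:
  "v \<in> focal M (Suc k) y \<Longrightarrow> pushforward (level M k) (pr M (Suc k)) y v \<in> dir M (Suc k) y"
  by simp

lemma focal_lincomb:
  assumes "y \<in> points (level M k)" "v \<in> focal M k y" "w \<in> focal M k y"
  shows "(\<lambda>f. a * v f + b * w f) \<in> focal M k y"
proof (cases k)
  case 0
  then show ?thesis using assms tangent_lincomb by auto
next
  case (Suc n)
  have "pushforward (level M n) (pr M (Suc n)) y (\<lambda>f. a * v f + b * w f) =
      (\<lambda>f. a * pushforward (level M n) (pr M (Suc n)) y v f + b * pushforward (level M n) (pr M (Suc n)) y w f)"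
    by (auto simp: pushforward_def)
  also have "\<dots> \<in> dir M (Suc n) y"
    by (rule line_lincomb) (use assms dir_line in \<open>auto simp: Suc points_level_Suc\<close>)
  finally show ?thesis
    using assms tangent_lincomb by (auto simp: Suc)
qed

end

section \<open>Coordinates on the focal bundles\<close>

text \<open>On the open set \<open>H\<close>, the differential of the regular function \<open>f\<close>, restricted to the subspaces
  \<open>E z\<close> of the tangent spaces, is the combination \<open>A da + B db\<close> with regular coefficients.\<close>

definition differential_on ::
  "('p, 'k::field) fspace \<Rightarrow> ('p \<Rightarrow> ('p, 'k) vec set) \<Rightarrow> ('p \<Rightarrow> 'k) \<Rightarrow> ('p \<Rightarrow> 'k) \<Rightarrow>
    ('p \<Rightarrow> 'k) \<Rightarrow> 'p set \<Rightarrow> ('p \<Rightarrow> 'k) \<Rightarrow> ('p \<Rightarrow> 'k) \<Rightarrow> bool" where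
  "differential_on X E a b f H A B \<longleftrightarrow>
     X H f \<and> X H A \<and> X H B \<and> (\<forall>z\<in>H. \<forall>v\<in>E z. v f = A z * v a + B z * v b)"

context
  fixes X :: "('p, 'k::field) fspace" and E :: "'p \<Rightarrow> ('p, 'k) vec set" and a b :: "'p \<Rightarrow> 'k"
  assumes space: "space_with_functions X" and E: "\<And>z. E z \<subseteq> tangent_space X z"
begin

lemma differential_onI:
  assumes "X H f" "X H A" "X H B" "\<And>z v. z \<in> H \<Longrightarrow> v \<in> E z \<Longrightarrow> v f = A z * v a + B z * v b"
  shows "differential_on X E a b f H A B"
  using assms unfolding differential_on_def by simp

lemma differential_onD:
  assumes "differential_on X E a b f H A B"
  shows "X H f" "X H A" "X H B" "z \<in> H \<Longrightarrow> v \<in> E z \<Longrightarrow> v f = A z * v a + B z * v b"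
  using assms unfolding differential_on_def by simp_all

lemma differential_restrict:
  assumes f: "differential_on X E a b f H A B" and H': "zopen X H'" "H' \<subseteq> H"
  shows "differential_on X E a b f H' A B"
proof (rule differential_onI)
  show "X H' f" by (rule regular_restrict[OF space, OF differential_onD(1)[OF f] H'])
  show "X H' A" by (rule regular_restrict[OF space, OF differential_onD(2)[OF f] H'])
  show "X H' B" by (rule regular_restrict[OF space, OF differential_onD(3)[OF f] H'])
  show "v f = A z * v a + B z * v b" if "z \<in> H'" "v \<in> E z" for z v
    by (rule differential_onD(4)[OF f]) (use that H'(2) in auto)
qed

lemma differential_cong:
  assumes f: "differential_on X E a b f H A B" and eq: "\<And>z. z \<in> H \<Longrightarrow> f z = g z"
  shows "differential_on X E a b g H A B"
proof (rule differential_onI)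
  show "X H g" by (rule regular_cong[OF space, OF differential_onD(1)[OF f] eq])
  show "v g = A z * v a + B z * v b" if z: "z \<in> H" and v: "v \<in> E z" for z v
  proof -
    have "v f = v g"
      by (rule tangent_germ[OF space, OF subsetD[OF E v] regular_open[OF space, OF differential_onD(1)[OF f]] z eq])
    then show ?thesis using differential_onD(4)[OF f z v] by simp
  qed
qed (fact differential_onD(2)[OF f], fact differential_onD(3)[OF f])

lemma differential_add:
  assumes f: "differential_on X E a b f H A B" and g: "differential_on X E a b g H A' B'"
  shows "differential_on X E a b (\<lambda>z. f z + g z) H (\<lambda>z. A z + A' z) (\<lambda>z. B z + B' z)"
proof (rule differential_onI)
  show "v (\<lambda>z. f z + g z) = (A z + A' z) * v a + (B z + B' z) * v b" if z: "z \<in> H" and v: "v \<in> E z" for z v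
    using tangent_add[OF subsetD[OF E v] local_functionsI[OF space, OF differential_onD(1)[OF f] z]
        local_functionsI[OF space, OF differential_onD(1)[OF g] z]]
      differential_onD(4)[OF f z v] differential_onD(4)[OF g z v]
    by (simp add: algebra_simps)
qed (rule regular_add[OF space], rule differential_onD[OF f], rule differential_onD[OF g])+

lemma differential_mult:
  assumes f: "differential_on X E a b f H A B" and g: "differential_on X E a b g H A' B'"
  shows "differential_on X E a b (\<lambda>z. f z * g z) H
    (\<lambda>z. f z * A' z + g z * A z) (\<lambda>z. f z * B' z + g z * B z)"
proof (rule differential_onI)
  note fD = differential_onD(1-3)[OF f] and gD = differential_onD(1-3)[OF g]
  show "X H (\<lambda>z. f z * g z)" by (rule regular_mult[OF space, OF fD(1) gD(1)])
  show "X H (\<lambda>z. f z * A' z + g z * A z)"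
    by (rule regular_add[OF space, OF regular_mult[OF space, OF fD(1) gD(2)] regular_mult[OF space, OF gD(1) fD(2)]])
  show "X H (\<lambda>z. f z * B' z + g z * B z)"
    by (rule regular_add[OF space, OF regular_mult[OF space, OF fD(1) gD(3)] regular_mult[OF space, OF gD(1) fD(3)]])
  show "v (\<lambda>z. f z * g z) = (f z * A' z + g z * A z) * v a + (f z * B' z + g z * B z) * v b"
    if z: "z \<in> H" and v: "v \<in> E z" for z v
    using tangent_mult[OF subsetD[OF E v] local_functionsI[OF space, OF fD(1) z]
        local_functionsI[OF space, OF gD(1) z]]
      differential_onD(4)[OF f z v] differential_onD(4)[OF g z v]
    by (simp add: algebra_simps)
qed

lemma differential_inverse:
  assumes f: "differential_on X E a b f H A B" and nz: "\<And>z. z \<in> H \<Longrightarrow> f z \<noteq> 0"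
  shows "differential_on X E a b (\<lambda>z. inverse (f z)) H
    (\<lambda>z. - (inverse (f z))\<^sup>2 * A z) (\<lambda>z. - (inverse (f z))\<^sup>2 * B z)"
proof (rule differential_onI)
  note fD = differential_onD(1-3)[OF f]
  have "{z \<in> H. f z \<noteq> 0} = H" using nz by blast
  then have i: "X H (\<lambda>z. inverse (f z))" using regular_inverse[OF space, OF fD(1)] by simp
  then show "X H (\<lambda>z. inverse (f z))" .
  have m: "X H (\<lambda>z. - (inverse (f z))\<^sup>2)"
    using regular_mult[OF space, OF regular_const[OF space, OF regular_open[OF space, OF i], of "- 1"]
        regular_mult[OF space, OF i i]]
    by (simp add: power2_eq_square)
  show "X H (\<lambda>z. - (inverse (f z))\<^sup>2 * A z)" by (rule regular_mult[OF space, OF m fD(2)])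
  show "X H (\<lambda>z. - (inverse (f z))\<^sup>2 * B z)" by (rule regular_mult[OF space, OF m fD(3)])
  show "v (\<lambda>z. inverse (f z)) = - (inverse (f z))\<^sup>2 * A z * v a + - (inverse (f z))\<^sup>2 * B z * v b"
    if z: "z \<in> H" and v: "v \<in> E z" for z v
    using tangent_inverse[OF space, OF subsetD[OF E v] fD(1) z nz[OF z]] differential_onD(4)[OF f z v]
    by (simp add: algebra_simps)
qed

end

text \<open>The functions \<open>a\<close> and \<open>b\<close> are coordinates for the subspaces \<open>E z\<close> of the tangent spaces
  at the points \<open>z\<close> of \<open>C\<close>: they are regular, their differentials take all pairs of values on each
  \<open>E z\<close>, and locally they generate the differentials of all regular functions.\<close>

definition frame :: "('p, 'k::field) fspace \<Rightarrow> ('p \<Rightarrow> ('p, 'k) vec set) \<Rightarrow> 'p set \<Rightarrow>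
    ('p \<Rightarrow> 'k) \<Rightarrow> ('p \<Rightarrow> 'k) \<Rightarrow> bool" where
  "frame X E C a b \<longleftrightarrow>
     X C a \<and> X C b \<and>
     (\<forall>y\<in>C. \<forall>\<alpha> \<beta>. \<exists>v\<in>E y. v a = \<alpha> \<and> v b = \<beta>) \<and>
     (\<forall>G f. X G f \<longrightarrow> (\<forall>y\<in>G \<inter> C. \<exists>H A B. y \<in> H \<and> H \<subseteq> G \<inter> C \<and> differential_on X E a b f H A B))"

lemma differential_swap: "differential_on X E a b f H A B \<Longrightarrow> differential_on X E b a f H B A"
  unfolding differential_on_def by (simp add: add.commute)

lemma frame_swap:
  assumes "frame X E C a b"
  shows "frame X E C b a"
  unfolding frame_def
proof (intro conjI allI ballI impI)
  show "X C b" "X C a" using assms unfolding frame_def by simp_all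
  show "\<exists>v\<in>E y. v b = \<alpha> \<and> v a = \<beta>" if "y \<in> C" for y \<alpha> \<beta>
    using assms that unfolding frame_def by (simp add: conj_commute)
  fix G f y
  assume "X G f" "y \<in> G \<inter> C"
  then have "\<exists>H A B. y \<in> H \<and> H \<subseteq> G \<inter> C \<and> differential_on X E a b f H A B"
    using assms unfolding frame_def by simp
  then obtain H A B where "y \<in> H" "H \<subseteq> G \<inter> C" "differential_on X E a b f H A B"
    by (elim exE conjE)
  then show "\<exists>H A B. y \<in> H \<and> H \<subseteq> G \<inter> C \<and> differential_on X E b a f H A B"
    using differential_swap by (intro exI[of _ H] exI[of _ B] exI[of _ A]) simp
qed

text \<open>The passage from the chart \<open>C\<close> of \<open>ps\<close> at one level to the chart \<open>D\<close> of \<open>ps @ [p]\<close> at the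
  next one, assuming that the active coordinates \<open>a\<close> and \<open>b\<close> of \<open>C\<close> are coordinates on its focal
  spaces. The new active coordinate \<open>slope = db/da\<close> has index \<open>3 - p\<close>, and the other one is \<open>a\<close>.\<close>

locale coordinate_tower_chart = coordinate_tower M x
  for M :: "('p, 'k::field_char_0) tower" and x +
  fixes ps :: "nat list" and p :: nat
  assumes frame: "frame (level M (length ps)) (focal M (length ps)) (Chart M x ps) (act M x ps p) (act M x ps (3 - p))"
    and p: "p \<in> {1, 2}"
begin

abbreviation "X \<equiv> level M (length ps)"
abbreviation "Y \<equiv> level M (Suc (length ps))"
abbreviation "\<pi> \<equiv> pr M (Suc (length ps))"
abbreviation "\<delta> \<equiv> dir M (Suc (length ps))"
abbreviation "a \<equiv> act M x ps p"
abbreviation "b \<equiv> act M x ps (3 - p)"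
abbreviation "slope \<equiv> act M x (ps @ [p]) (3 - p)"
abbreviation "C \<equiv> Chart M x ps"
abbreviation "D \<equiv> Chart M x (ps @ [p])"

lemma p_neq: "3 - p \<noteq> p" "p \<noteq> 3 - p"
  using p by auto

lemma a_regular: "X C a" and b_regular: "X C b"
  using frame unfolding frame_def by simp_all

lemma C_points: "C \<subseteq> points X"
  by (rule open_subset_points[OF regular_open[OF space_level, OF a_regular]])

lemma focal_vector: "y \<in> C \<Longrightarrow> \<exists>v\<in>focal M (length ps) y. v a = \<alpha> \<and> v b = \<beta>"
  using frame unfolding frame_def by simp

lemma focal_differential:
  assumes f: "X G f" and y: "y \<in> G" "y \<in> C"
  obtains H A B where "y \<in> H" "H \<subseteq> G \<inter> C" "differential_on X (focal M (length ps)) a b f H A B"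
proof -
  have "\<exists>H A B. y \<in> H \<and> H \<subseteq> G \<inter> C \<and> differential_on X (focal M (length ps)) a b f H A B"
    using frame f y unfolding frame_def by simp
  then show ?thesis using that by (elim exE conjE)
qed

lemma focal_zero:
  assumes y: "y \<in> C" and v: "v \<in> focal M (length ps) y" and "v a = 0" "v b = 0"
  shows "v = (\<lambda>_. 0)"
proof
  fix f
  show "v f = 0"
  proof (cases "f \<in> local_functions X y")
    case True
    obtain G where G: "y \<in> G" "X G f" by (rule local_functionsE[OF space_level, OF True])
    obtain H A B where H: "y \<in> H" and d: "differential_on X (focal M (length ps)) a b f H A B"
      by (rule focal_differential[OF G(2,1) y])
    show ?thesis
      using differential_onD(4)[OF space_level, OF focal_tangent d H v] assms(3,4) by simp
  next
    case False
    then show ?thesis using tangent_nonlocal[OF subsetD[OF focal_tangent v]] by simp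
  qed
qed

lemma focal_eqI:
  assumes y: "y \<in> C" and v: "v \<in> focal M (length ps) y" and w: "w \<in> focal M (length ps) y"
    and "v a = w a" "v b = w b"
  shows "v = w"
proof -
  have "(\<lambda>f. 1 * v f + (- 1) * w f) = (\<lambda>_. 0)"
    by (rule focal_zero[OF y focal_lincomb[OF subsetD[OF C_points y] v w]]) (use assms in simp_all)
  then have "v f + - w f = 0" for f by (simp add: fun_eq_iff)
  then show ?thesis by (simp add: fun_eq_iff)
qed

lemma line_of_slope:
  assumes q: "q \<in> C"
  shows "is_line {v \<in> focal M (length ps) q. v b = s * v a}"
proof -
  obtain v0 where v0: "v0 \<in> focal M (length ps) q" "v0 a = 1" "v0 b = s"
    using focal_vector[OF q, of 1 s] by (elim bexE conjE)
  have "v \<in> {\<lambda>f. c * v0 f | c. True}" if v: "v \<in> focal M (length ps) q" "v b = s * v a" for v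
  proof -
    have "v = (\<lambda>f. v a * v0 f + 0 * v0 f)"
      by (rule focal_eqI[OF q v(1) focal_lincomb[OF subsetD[OF C_points q] v0(1) v0(1)]])
        (use v v0 in simp_all)
    then have "v = (\<lambda>f. v a * v0 f)" by simp
    then show ?thesis by (intro CollectI exI[of _ "v a"]) simp
  qed
  moreover have "(\<lambda>f. c * v0 f) \<in> focal M (length ps) q" for c
    using focal_lincomb[OF subsetD[OF C_points q] v0(1) v0(1), of c 0] by simp
  ultimately have "{v \<in> focal M (length ps) q. v b = s * v a} = {\<lambda>f. c * v0 f | c. True}"
    using v0 by auto
  moreover have "v0 \<noteq> (\<lambda>_. 0)" using v0(2) by auto
  ultimately show ?thesis unfolding is_line_def by (intro exI[of _ v0]) simp
qed

lemma D_iff: "y \<in> D \<longleftrightarrow> y \<in> points Y \<and> \<pi> y \<in> C \<and> (\<exists>v\<in>\<delta> y. v a \<noteq> 0)"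
  by (simp add: Chart_snoc)

lemma slope_eq: "slope = (\<lambda>y. dquot (\<delta> y) b a)"
  using p_neq by (simp add: act_snoc)

lemma act_snoc_same: "act M x (ps @ [p]) p = (\<lambda>y. a (\<pi> y))"
  by (simp add: act_snoc)

lemma D_properties:
  assumes "y \<in> D"
  shows "y \<in> pts M (Suc (length ps))" "\<pi> y \<in> C" "is_line (\<delta> y)" "\<delta> y \<subseteq> focal M (length ps) (\<pi> y)"
  using assms dir_line dir_focal unfolding D_iff points_level_Suc by auto

text \<open>A point of \<open>D\<close> represents the line with equation \<open>db = slope da\<close>; so \<open>D\<close> is in bijection with
  the pairs of a point of \<open>C\<close> and a scalar.\<close>

lemma dir_eq_slope:
  assumes y: "y \<in> D"
  shows "\<delta> y = {v \<in> focal M (length ps) (\<pi> y). v b = slope y * v a}"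
proof
  note yD = D_properties[OF y]
  obtain v0 where v0: "v0 \<in> \<delta> y" "v0 a \<noteq> 0" using y unfolding D_iff by (elim conjE bexE)
  have s: "slope y = v0 b / v0 a"
    using dquot_eq[of "\<delta> y" v0 a b] yD(3) v0 by (simp add: slope_eq)
  obtain e where e: "\<delta> y = {\<lambda>f. c * e f | c. True}" using yD(3) unfolding is_line_def by (elim exE conjE)
  obtain c0 where c0: "v0 = (\<lambda>f. c0 * e f)" using v0(1) unfolding e by blast
  show "\<delta> y \<subseteq> {v \<in> focal M (length ps) (\<pi> y). v b = slope y * v a}"
  proof
    fix v assume v: "v \<in> \<delta> y"
    then obtain c where c: "v = (\<lambda>f. c * e f)" unfolding e by blast
    have "v b = slope y * v a" using v0(2) unfolding s c c0 by simp
    then show "v \<in> {v \<in> focal M (length ps) (\<pi> y). v b = slope y * v a}" using v yD(4) by blast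
  qed
  show "{v \<in> focal M (length ps) (\<pi> y). v b = slope y * v a} \<subseteq> \<delta> y"
  proof
    fix v assume "v \<in> {v \<in> focal M (length ps) (\<pi> y). v b = slope y * v a}"
    then have v: "v \<in> focal M (length ps) (\<pi> y)" "v b = slope y * v a" by simp_all
    let ?w = "\<lambda>f. v a / v0 a * v0 f"
    have w: "?w \<in> \<delta> y" by (rule line_scale[OF yD(3) v0(1)])
    have "v = ?w"
      by (rule focal_eqI[OF yD(2) v(1) subsetD[OF yD(4) w]]) (use v(2) v0(2) s in simp_all)
    then show "v \<in> \<delta> y" using w by simp
  qed
qed

lemma slope_point_ex:
  assumes q: "q \<in> C"
  shows "\<exists>y. y \<in> D \<and> \<pi> y = q \<and> slope y = s"
proof -
  let ?L = "{v \<in> focal M (length ps) q. v b = s * v a}"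
  have L: "is_line ?L" by (rule line_of_slope[OF q])
  have "?L \<subseteq> focal M (length ps) q" by (rule Collect_restrict)
  from point_of_line[OF subsetD[OF C_points q] L this]
  obtain y where y: "y \<in> pts M (Suc (length ps))" "\<pi> y = q" "\<delta> y = ?L"
    by (elim bexE conjE)
  obtain v0 where v0: "v0 \<in> focal M (length ps) q" "v0 a = 1" "v0 b = s"
    using focal_vector[OF q, of 1 s] by (elim bexE conjE)
  have v0L: "v0 \<in> \<delta> y" using v0 y(3) by simp
  have "y \<in> D"
    unfolding D_iff points_level_Suc using y q v0(2)
    by (intro conjI bexI[of _ v0] v0L) simp_all
  moreover have "slope y = s"
    unfolding slope_eq using dquot_eq[of "\<delta> y" v0 a b] L y(3) v0L v0 by simp
  ultimately show ?thesis using y(2) by (intro exI[of _ y]) simp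
qed

lemma slope_point_unique:
  assumes "y \<in> D" "y' \<in> D" "\<pi> y = \<pi> y'" "slope y = slope y'"
  shows "y = y'"
  by (rule point_eqI[OF D_properties(1)[OF assms(1)] D_properties(1)[OF assms(2)] assms(3)])
    (simp only: dir_eq_slope[OF assms(1)] dir_eq_slope[OF assms(2)] assms(3,4))

end

text \<open>The point in the chart of \<open>ps @ [p]\<close> that lies over \<open>q\<close> and has slope \<open>s\<close>.\<close>

definition (in coordinate_tower) lift :: "nat list \<Rightarrow> nat \<Rightarrow> 'p \<Rightarrow> 'k \<Rightarrow> 'p" where
  "lift ps p q s = (THE y. y \<in> Chart M x (ps @ [p]) \<and> pr M (Suc (length ps)) y = q \<and>
     act M x (ps @ [p]) (3 - p) y = s)"

context coordinate_tower_chart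
begin

lemma lift_eqI: "y \<in> D \<Longrightarrow> \<pi> y = q \<Longrightarrow> slope y = s \<Longrightarrow> lift ps p q s = y"
  unfolding lift_def by (rule the_equality) (auto intro: slope_point_unique)

lemma lift:
  assumes "q \<in> C"
  shows "lift ps p q s \<in> D" "\<pi> (lift ps p q s) = q" "slope (lift ps p q s) = s"
  using slope_point_ex[OF assms, of s] lift_eqI by auto

text \<open>On the line represented by \<open>y\<close>, the differential \<open>A da + B db\<close> equals
  \<open>(A + B slope) da\<close>. This makes every quotient \<open>df/dg\<close> an explicit fraction in the slope.\<close>

lemma dir_differential:
  assumes y: "y \<in> D" and v: "v \<in> \<delta> y"
    and f: "differential_on X (focal M (length ps)) a b f H A B" and H: "\<pi> y \<in> H"
  shows "v f = (A (\<pi> y) + B (\<pi> y) * slope y) * v a"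
proof -
  have "v \<in> focal M (length ps) (\<pi> y)" and s: "v b = slope y * v a"
    using v unfolding dir_eq_slope[OF y] by simp_all
  from differential_onD(4)[OF space_level, OF focal_tangent f H this(1)] show ?thesis
    by (simp add: s algebra_simps)
qed

lemma dquot_differential:
  assumes y: "y \<in> D" and f: "differential_on X (focal M (length ps)) a b f H A B" "\<pi> y \<in> H"
    and g: "differential_on X (focal M (length ps)) a b g H' A' B'" "\<pi> y \<in> H'"
  shows "(\<exists>v\<in>\<delta> y. v g \<noteq> 0) \<longleftrightarrow> A' (\<pi> y) + B' (\<pi> y) * slope y \<noteq> 0"
    and "A' (\<pi> y) + B' (\<pi> y) * slope y \<noteq> 0 \<Longrightarrow>
      dquot (\<delta> y) f g = (A (\<pi> y) + B (\<pi> y) * slope y) / (A' (\<pi> y) + B' (\<pi> y) * slope y)"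
proof -
  obtain v where v: "v \<in> \<delta> y" "v a \<noteq> 0" using y unfolding D_iff by (elim conjE bexE)
  note vf = dir_differential[OF y v(1) f] and vg = dir_differential[OF y _ g]
  show "(\<exists>v\<in>\<delta> y. v g \<noteq> 0) \<longleftrightarrow> A' (\<pi> y) + B' (\<pi> y) * slope y \<noteq> 0"
  proof
    assume "\<exists>w\<in>\<delta> y. w g \<noteq> 0"
    then obtain w where "w \<in> \<delta> y" "w g \<noteq> 0" by (elim bexE)
    then show "A' (\<pi> y) + B' (\<pi> y) * slope y \<noteq> 0" using vg[of w] by auto
  next
    assume "A' (\<pi> y) + B' (\<pi> y) * slope y \<noteq> 0"
    then have "v g \<noteq> 0" using vg[OF v(1)] v(2) by simp
    then show "\<exists>v\<in>\<delta> y. v g \<noteq> 0" using v(1) by (rule bexI[of _ v])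
  qed
  assume nz: "A' (\<pi> y) + B' (\<pi> y) * slope y \<noteq> 0"
  then have "v g \<noteq> 0" using vg[OF v(1)] v(2) by simp
  from dquot_eq[of "\<delta> y" v g f, OF D_properties(3)[OF y] v(1) this]
  show "dquot (\<delta> y) f g = (A (\<pi> y) + B (\<pi> y) * slope y) / (A' (\<pi> y) + B' (\<pi> y) * slope y)"
    using v(2) nz by (simp add: vf vg[OF v(1)])
qed

lemma D_open: "zopen Y D" and slope_regular: "Y D slope" and a_pr_regular: "Y D (\<lambda>y. a (\<pi> y))"
proof -
  have "D = {y \<in> pts M (Suc (length ps)). \<pi> y \<in> C \<and> (\<exists>v\<in>\<delta> y. v a \<noteq> 0)}"
    by (simp add: Chart_snoc points_level_Suc)
  then show s: "Y D slope"
    unfolding slope_eq using line_bundle_space.quotient[of X C b a, OF b_regular a_regular]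
    by (simp add: level.simps(2))
  then show D: "zopen Y D" by (rule regular_open[OF space_level])
  show "Y D (\<lambda>y. a (\<pi> y))"
    by (rule regular_restrict[OF space_level, OF morphism_regular[OF morphism_pr, OF a_regular] D])
      (auto simp: D_iff)
qed

text \<open>Morphisms to a chart of the tower lift to the next level, with prescribed regular slope.\<close>

lemma morphism_lift:
  fixes Z :: "('z, 'k) fspace"
  assumes Z: "space_with_functions Z" and \<theta>: "morphism Z X \<theta>"
    and C: "\<And>z. z \<in> points Z \<Longrightarrow> \<theta> z \<in> C" and s: "Z (points Z) s"
  shows "morphism Z Y (\<lambda>z. lift ps p (\<theta> z) (s z))"
proof -
  define \<phi> where "\<phi> z = lift ps p (\<theta> z) (s z)" for z
  have \<phi>: "\<phi> z \<in> D" "\<pi> (\<phi> z) = \<theta> z" "slope (\<phi> z) = s z" if "z \<in> points Z" for z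
    using lift[OF C[OF that]] by (simp_all add: \<phi>_def)
  have \<phi>_pts: "\<phi> z \<in> pts M (Suc (length ps))" if "z \<in> points Z" for z
    using D_properties(1)[OF \<phi>(1)[OF that]] .
  have main: "Z {z \<in> points Z. \<phi> z \<in> G} (\<lambda>z. f (\<phi> z))"
    if "line_bundle_space X (pts M (Suc (length ps))) \<pi> \<delta> G f" for G f
    using that
  proof (induction rule: line_bundle_space.induct)
    case (pullback G f)
    have e: "{z \<in> points Z. \<phi> z \<in> {y \<in> pts M (Suc (length ps)). \<pi> y \<in> G}} = {z \<in> points Z. \<theta> z \<in> G}"
      using \<phi> \<phi>_pts by auto
    show ?case
      unfolding e by (rule regular_cong[OF Z, OF morphism_regular[OF \<theta>, OF pullback]]) (simp add: \<phi>)
  next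
    case (quotient G f g)
    let ?W = "{z \<in> points Z. \<phi> z \<in> {y \<in> pts M (Suc (length ps)). \<pi> y \<in> G \<and> (\<exists>v\<in>\<delta> y. v g \<noteq> 0)}}"
    show ?case
    proof (rule regular_glue[OF Z])
      fix z0 assume z0: "z0 \<in> ?W"
      then have z0': "z0 \<in> points Z" "\<theta> z0 \<in> G" using \<phi> by auto
      obtain H A B where H: "\<theta> z0 \<in> H" "H \<subseteq> G \<inter> C"
        and f: "differential_on X (focal M (length ps)) a b f H A B"
        by (rule focal_differential[OF quotient(1) z0'(2) C[OF z0'(1)]])
      obtain H' A' B' where H': "\<theta> z0 \<in> H'" "H' \<subseteq> G \<inter> C"
        and g: "differential_on X (focal M (length ps)) a b g H' A' B'"
        by (rule focal_differential[OF quotient(2) z0'(2) C[OF z0'(1)]])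
      note fD = differential_onD(2,3)[OF space_level, OF focal_tangent f]
        and gD = differential_onD(2,3)[OF space_level, OF focal_tangent g]
      have oH: "zopen X (H \<inter> H')"
        by (rule open_Int[OF space_level, OF regular_open[OF space_level, OF fD(1)] regular_open[OF space_level, OF gD(1)]])
      define N where "N = {z \<in> points Z. \<theta> z \<in> H \<inter> H'}"
      have regN: "Z N (\<lambda>z. h (\<theta> z))" if "X (H \<inter> H') h" for h
        unfolding N_def by (rule morphism_regular[OF \<theta>, OF that])
      have A: "Z N (\<lambda>z. A (\<theta> z))" "Z N (\<lambda>z. B (\<theta> z))"
        by (rule regN, rule regular_restrict[OF space_level, OF fD(1) oH], simp,
          rule regN, rule regular_restrict[OF space_level, OF fD(2) oH], simp)
      have A': "Z N (\<lambda>z. A' (\<theta> z))" "Z N (\<lambda>z. B' (\<theta> z))"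
        by (rule regN, rule regular_restrict[OF space_level, OF gD(1) oH], simp,
          rule regN, rule regular_restrict[OF space_level, OF gD(2) oH], simp)
      have sN: "Z N s"
        by (rule regular_restrict[OF Z, OF s regular_open[OF Z, OF A(1)]]) (auto simp: N_def)
      define F F' where "F z = A (\<theta> z) + B (\<theta> z) * s z" and "F' z = A' (\<theta> z) + B' (\<theta> z) * s z" for z
      have F: "Z N F" "Z N F'"
        unfolding F_def F'_def
        by (rule regular_add[OF Z, OF A(1) regular_mult[OF Z, OF A(2) sN]],
          rule regular_add[OF Z, OF A'(1) regular_mult[OF Z, OF A'(2) sN]])
      define N' where "N' = {z \<in> N. F' z \<noteq> 0}"
      have N': "zopen Z N'" unfolding N'_def by (rule open_nonzero[OF Z, OF F(2)])
      have FN': "Z N' F" "Z N' F'"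
        by (rule regular_restrict[OF Z, OF F(1) N'], simp add: N'_def,
          rule regular_restrict[OF Z, OF F(2) N'], simp add: N'_def)
      have reg: "Z N' (\<lambda>z. F z / F' z)"
        by (rule regular_divide[OF Z, OF FN']) (simp add: N'_def)
      have fg: "(\<exists>v\<in>\<delta> (\<phi> z). v g \<noteq> 0) \<longleftrightarrow> F' z \<noteq> 0"
        "F' z \<noteq> 0 \<Longrightarrow> dquot (\<delta> (\<phi> z)) f g = F z / F' z" if z: "z \<in> points Z" "\<theta> z \<in> H" "\<theta> z \<in> H'" for z
        using dquot_differential[OF \<phi>(1)[OF z(1)] f _ g] z \<phi>[OF z(1)] by (simp_all add: F_def F'_def)
      have "z0 \<in> N'" using z0 z0' H(1) H'(1) fg(1)[of z0] by (auto simp: N_def N'_def)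
      moreover have "N' \<subseteq> ?W"
        using H(2) \<phi>_pts \<phi> fg(1) by (auto simp: N_def N'_def)
      moreover have "\<forall>z\<in>N'. dquot (\<delta> (\<phi> z)) f g = F z / F' z"
        using fg(2) by (auto simp: N_def N'_def)
      ultimately show "\<exists>H h. z0 \<in> H \<and> H \<subseteq> ?W \<and> Z H h \<and> (\<forall>z\<in>H. dquot (\<delta> (\<phi> z)) f g = h z)"
        using reg by (intro exI[of _ N'] exI[of _ "\<lambda>z. F z / F' z"] conjI)
    qed
  next
    case (add G f H g)
    have o: "zopen Z ({z \<in> points Z. \<phi> z \<in> G} \<inter> {z \<in> points Z. \<phi> z \<in> H})"
      by (rule open_Int[OF Z, OF regular_open[OF Z, OF add.IH(1)] regular_open[OF Z, OF add.IH(2)]])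
    have e: "{z \<in> points Z. \<phi> z \<in> G \<inter> H} = {z \<in> points Z. \<phi> z \<in> G} \<inter> {z \<in> points Z. \<phi> z \<in> H}" by auto
    show ?case
      unfolding e
      by (rule regular_add[OF Z, OF regular_restrict[OF Z, OF add.IH(1) o] regular_restrict[OF Z, OF add.IH(2) o]]) auto
  next
    case (mult G f H g)
    have o: "zopen Z ({z \<in> points Z. \<phi> z \<in> G} \<inter> {z \<in> points Z. \<phi> z \<in> H})"
      by (rule open_Int[OF Z, OF regular_open[OF Z, OF mult.IH(1)] regular_open[OF Z, OF mult.IH(2)]])
    have e: "{z \<in> points Z. \<phi> z \<in> G \<inter> H} = {z \<in> points Z. \<phi> z \<in> G} \<inter> {z \<in> points Z. \<phi> z \<in> H}" by auto
    show ?case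
      unfolding e
      by (rule regular_mult[OF Z, OF regular_restrict[OF Z, OF mult.IH(1) o] regular_restrict[OF Z, OF mult.IH(2) o]]) auto
  next
    case (inverse G f)
    have e: "{z \<in> points Z. \<phi> z \<in> {y \<in> G. f y \<noteq> 0}} = {z \<in> {z \<in> points Z. \<phi> z \<in> G}. f (\<phi> z) \<noteq> 0}" by auto
    show ?case unfolding e by (rule regular_inverse[OF Z, OF inverse.IH])
  next
    case (glue G f)
    show ?case
    proof (rule regular_glue[OF Z])
      fix z assume z: "z \<in> {z \<in> points Z. \<phi> z \<in> G}"
      then have "\<phi> z \<in> G" by simp
      from glue.IH[OF this] obtain H g where
        H: "\<phi> z \<in> H" "H \<subseteq> G" "Z {z \<in> points Z. \<phi> z \<in> H} (\<lambda>z. g (\<phi> z))" "\<forall>y\<in>H. f y = g y"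
        by (elim exE conjE)
      then show "\<exists>H h. z \<in> H \<and> H \<subseteq> {z \<in> points Z. \<phi> z \<in> G} \<and> Z H h \<and> (\<forall>q\<in>H. f (\<phi> q) = h q)"
        using z by (intro exI[of _ "{z \<in> points Z. \<phi> z \<in> H}"] exI[of _ "\<lambda>z. g (\<phi> z)"] conjI) auto
    qed
  qed
  have "morphism Z Y \<phi>"
    unfolding morphism_def
  proof (intro conjI allI impI ballI)
    show "\<phi> z \<in> points Y" if "z \<in> points Z" for z
      unfolding points_level_Suc by (rule \<phi>_pts[OF that])
    show "Z {z \<in> points Z. \<phi> z \<in> G} (\<lambda>z. f (\<phi> z))" if "Y G f" for G f
      by (rule main) (use that in \<open>simp add: level.simps(2)\<close>)
  qed
  then show ?thesis by (simp add: \<phi>_def[abs_def])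
qed

end

context coordinate_tower_chart
begin

text \<open>A tangent vector of slope \<open>slope y\<close> at \<open>\<pi> y\<close> lifts to the focal space at \<open>y\<close>: it is pushed
  forward along the section of \<open>\<pi>\<close> through \<open>y\<close> whose slope is an affine function of \<open>a\<close> with
  leading coefficient \<open>c\<close>.\<close>

lemma focal_vector_lift:
  assumes y: "y \<in> D"
  shows "\<exists>v\<in>focal M (Suc (length ps)) y. v (\<lambda>y. a (\<pi> y)) = 1 \<and> v slope = c"
proof -
  define q where "q = \<pi> y"
  have q: "q \<in> C" using D_properties(2)[OF y] by (simp add: q_def)
  have C_open: "zopen X C" by (rule regular_open[OF space_level, OF a_regular])
  obtain w where w: "w \<in> focal M (length ps) q" "w a = 1" "w b = slope y"
    using focal_vector[OF q, of 1 "slope y"] by (elim bexE conjE)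
  have w_dir: "w \<in> \<delta> y" unfolding dir_eq_slope[OF y] using w by (simp add: q_def)
  have wX: "w \<in> tangent_space X q" by (rule subsetD[OF focal_tangent w(1)])
  define Z where "Z = open_subspace X C"
  have Z: "space_with_functions Z" unfolding Z_def by (rule space_open_subspace[OF space_level, OF C_open])
  have Z_points: "points Z = C" unfolding Z_def by (rule points_open_subspace[OF space_level, OF C_open])
  have wZ: "w \<in> tangent_space Z q"
    unfolding Z_def tangent_space_open_subspace[OF space_level, OF C_open q] by (rule wX)
  have \<theta>: "morphism Z X (\<lambda>z. z)"
    unfolding morphism_def Z_points
  proof (intro conjI ballI allI impI)
    show "z \<in> points X" if "z \<in> C" for z by (rule subsetD[OF C_points that])
    fix G f assume f: "X G f"
    have e: "{z \<in> C. z \<in> G} = G \<inter> C" by auto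
    have "X (G \<inter> C) f"
      by (rule regular_restrict[OF space_level, OF f
            open_Int[OF space_level, OF regular_open[OF space_level, OF f] C_open]]) simp
    then show "Z {z \<in> C. z \<in> G} f" unfolding e Z_def open_subspace_def by simp
  qed
  define s where "s z = (slope y - c * a q) + c * a z" for z
  have s: "X C s" unfolding s_def by (rule space_scale_add[OF space_level, OF a_regular])
  have sZ: "Z (points Z) s" unfolding Z_points unfolding Z_def open_subspace_def using s by simp
  define \<phi> where "\<phi> z = lift ps p z (s z)" for z
  have \<phi>_mor: "morphism Z Y \<phi>"
    using morphism_lift[OF Z \<theta> _ sZ] Z_points by (simp add: \<phi>_def[abs_def])
  have \<phi>: "\<phi> z \<in> D" "\<pi> (\<phi> z) = z" "slope (\<phi> z) = s z" if "z \<in> C" for z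
    using lift[OF that] by (simp_all add: \<phi>_def)
  have \<phi>q: "\<phi> q = y"
    unfolding \<phi>_def by (rule lift_eqI[OF y]) (simp_all add: q_def s_def)
  define v where "v = pushforward Y \<phi> q w"
  have v: "v \<in> tangent_space Y y"
    using pushforward_tangent[OF space_level \<phi>_mor _ wZ] q by (simp add: v_def \<phi>q Z_points)
  have v_apply: "v f = w (\<lambda>z. f (\<phi> z))" if "Y G f" "y \<in> G" for G f
    using pushforward_apply[OF space_level, of "Suc (length ps)" G f \<phi> q w] that
    by (simp add: v_def \<phi>q)
  have w_germ: "w f = w g" if "\<And>z. z \<in> C \<Longrightarrow> f z = g z" for f g
    by (rule tangent_germ[OF space_level, OF wX C_open q that])
  have push: "pushforward X \<pi> y v = w"
  proof
    fix f
    show "pushforward X \<pi> y v f = w f"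
    proof (cases "f \<in> local_functions X q")
      case True
      obtain G where G: "q \<in> G" "X G f" by (rule local_functionsE[OF space_level, OF True])
      have "pushforward X \<pi> y v f = v (\<lambda>z. f (\<pi> z))"
        using pushforward_apply[OF space_level, of "length ps" G f \<pi> y v] G by (simp add: q_def)
      also have "\<dots> = w (\<lambda>z. f (\<pi> (\<phi> z)))"
        by (rule v_apply[OF morphism_regular[OF morphism_pr, OF G(2)]])
          (use G(1) y D_iff in \<open>auto simp: q_def\<close>)
      also have "\<dots> = w f" by (rule w_germ) (simp add: \<phi>)
      finally show ?thesis .
    next
      case False
      then show ?thesis using tangent_nonlocal[OF wX] by (simp add: pushforward_def q_def)
    qed
  qed
  have "v \<in> focal M (Suc (length ps)) y" using v push w_dir by simp
  moreover have "v (\<lambda>y. a (\<pi> y)) = 1"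
  proof -
    have "v (\<lambda>y. a (\<pi> y)) = w (\<lambda>z. a (\<pi> (\<phi> z)))" by (rule v_apply[OF a_pr_regular y])
    also have "\<dots> = w a" by (rule w_germ) (simp add: \<phi>)
    finally show ?thesis using w(2) by simp
  qed
  moreover have "v slope = c"
  proof -
    have "v slope = w (\<lambda>z. slope (\<phi> z))" by (rule v_apply[OF slope_regular y])
    also have "\<dots> = w (\<lambda>z. (slope y - c * a q) + c * a z)" by (rule w_germ) (simp add: \<phi> s_def)
    also have "\<dots> = c * w a" by (rule tangent_scale_add[OF space_level, OF wX a_regular q])
    finally show ?thesis using w(2) by simp
  qed
  ultimately show ?thesis by (intro bexI[of _ v] conjI)
qed

lemma D_points: "D \<subseteq> points Y"
  by (rule open_subset_points[OF D_open])

lemma focal_vector_Suc: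
  assumes y: "y \<in> D"
  shows "\<exists>v\<in>focal M (Suc (length ps)) y. v (\<lambda>y. a (\<pi> y)) = \<alpha> \<and> v slope = \<beta>"
proof -
  obtain v0 where v0: "v0 \<in> focal M (Suc (length ps)) y" "v0 (\<lambda>y. a (\<pi> y)) = 1" "v0 slope = 0"
    using focal_vector_lift[OF y, of 0] by (elim bexE conjE)
  obtain v1 where v1: "v1 \<in> focal M (Suc (length ps)) y" "v1 (\<lambda>y. a (\<pi> y)) = 1" "v1 slope = 1"
    using focal_vector_lift[OF y, of 1] by (elim bexE conjE)
  \<comment> \<open>The difference of the two lifts is vertical.\<close>
  show ?thesis
    by (rule bexI[OF _ focal_lincomb[OF subsetD[OF D_points y] v0(1) v1(1), of "\<alpha> - \<beta>" \<beta>]])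
      (simp add: v0 v1)
qed

text \<open>Near \<open>y\<close>, the differential of \<open>f\<close> on the focal spaces of the new level is a combination of
  those of the new active coordinates, with regular coefficients.\<close>

abbreviation "differential_Suc \<equiv> differential_on Y (focal M (Suc (length ps))) (\<lambda>y. a (\<pi> y)) slope"

definition differential_at :: "'p \<Rightarrow> ('p \<Rightarrow> 'k) \<Rightarrow> bool" where
  "differential_at y f \<longleftrightarrow> (\<exists>H A B. y \<in> H \<and> H \<subseteq> D \<and> differential_Suc f H A B)"

lemma differential_atI: "y \<in> H \<Longrightarrow> H \<subseteq> D \<Longrightarrow> differential_Suc f H A B \<Longrightarrow> differential_at y f"
  unfolding differential_at_def by (intro exI[of _ H] exI[of _ A] exI[of _ B] conjI)

lemma differential_atE:
  assumes "differential_at y f"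
  obtains H A B where "y \<in> H" "H \<subseteq> D" "differential_Suc f H A B" "zopen Y H"
  using assms unfolding differential_at_def
  by (elim exE conjE) (blast dest: differential_onD(1)[OF space_level, OF focal_tangent]
      intro: regular_open[OF space_level])

lemma differential_at_germ:
  assumes f: "differential_at y f" and N: "zopen Y N" "y \<in> N" and eq: "\<And>z. z \<in> N \<Longrightarrow> f z = g z"
  shows "differential_at y g"
proof -
  obtain H A B where H: "y \<in> H" "H \<subseteq> D" "differential_Suc f H A B" "zopen Y H"
    by (rule differential_atE[OF f])
  have "differential_Suc f (H \<inter> N) A B"
    by (rule differential_restrict[OF space_level, OF focal_tangent H(3) open_Int[OF space_level, OF H(4) N(1)]]) simp
  from differential_cong[OF space_level, OF focal_tangent this] have "differential_Suc g (H \<inter> N) A B"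
    using eq by simp
  then show ?thesis by (rule differential_atI[rotated 2]) (use H N in auto)
qed

lemma differential_at_ring:
  assumes f: "differential_at y f" and g: "differential_at y g"
  shows differential_at_add: "differential_at y (\<lambda>z. f z + g z)"
    and differential_at_mult: "differential_at y (\<lambda>z. f z * g z)"
proof -
  obtain H A B where H: "y \<in> H" "H \<subseteq> D" "differential_Suc f H A B" "zopen Y H"
    by (rule differential_atE[OF f])
  obtain H' A' B' where H': "y \<in> H'" "H' \<subseteq> D" "differential_Suc g H' A' B'" "zopen Y H'"
    by (rule differential_atE[OF g])
  have o: "zopen Y (H \<inter> H')" by (rule open_Int[OF space_level, OF H(4) H'(4)])
  have f': "differential_Suc f (H \<inter> H') A B"
    by (rule differential_restrict[OF space_level, OF focal_tangent H(3) o]) simp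
  have g': "differential_Suc g (H \<inter> H') A' B'"
    by (rule differential_restrict[OF space_level, OF focal_tangent H'(3) o]) simp
  have y: "y \<in> H \<inter> H'" "H \<inter> H' \<subseteq> D" using H H' by auto
  show "differential_at y (\<lambda>z. f z + g z)"
    by (rule differential_atI[OF y differential_add[OF space_level, OF focal_tangent f' g']])
  show "differential_at y (\<lambda>z. f z * g z)"
    by (rule differential_atI[OF y differential_mult[OF space_level, OF focal_tangent f' g']])
qed

lemma differential_at_inverse:
  assumes f: "differential_at y f" and nz: "f y \<noteq> 0"
  shows "differential_at y (\<lambda>z. inverse (f z))"
proof -
  obtain H A B where H: "y \<in> H" "H \<subseteq> D" "differential_Suc f H A B" "zopen Y H"
    by (rule differential_atE[OF f])
  let ?N = "{z \<in> H. f z \<noteq> 0}"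
  have o: "zopen Y ?N"
    by (rule open_nonzero[OF space_level, OF differential_onD(1)[OF space_level, OF focal_tangent H(3)]])
  have f': "differential_Suc f ?N A B"
    by (rule differential_restrict[OF space_level, OF focal_tangent H(3) o]) auto
  have y: "y \<in> ?N" "?N \<subseteq> D" using H nz by auto
  show ?thesis
    by (rule differential_atI[OF y differential_inverse[OF space_level, OF focal_tangent f']]) simp
qed

lemma differential_at_slope: "y \<in> D \<Longrightarrow> differential_at y slope"
proof (rule differential_atI[of y D slope "\<lambda>_. 0" "\<lambda>_. 1"])
  show "differential_Suc slope D (\<lambda>_. 0) (\<lambda>_. 1)"
    by (rule differential_onI[OF space_level, OF focal_tangent slope_regular])
      (simp_all add: regular_const[OF space_level, OF D_open])
qed simp_all

lemma open_preimage:
  assumes "zopen X H"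
  shows "zopen Y {z \<in> D. \<pi> z \<in> H}"
proof -
  have "Y {z \<in> points Y. \<pi> z \<in> H} (\<lambda>z. 0)"
    by (rule morphism_regular[OF morphism_pr, OF regular_const[OF space_level, OF assms]])
  from open_Int[OF space_level, OF D_open regular_open[OF space_level, OF this]]
  have "zopen Y (D \<inter> {z \<in> points Y. \<pi> z \<in> H})" .
  moreover have "D \<inter> {z \<in> points Y. \<pi> z \<in> H} = {z \<in> D. \<pi> z \<in> H}" using D_points by auto
  ultimately show ?thesis by simp
qed

lemma differential_at_pullback:
  assumes f: "X G f" and y: "y \<in> D" "\<pi> y \<in> G"
  shows "differential_at y (\<lambda>z. f (\<pi> z))"
proof -
  obtain H A B where H: "\<pi> y \<in> H" "H \<subseteq> G \<inter> C" "differential_on X (focal M (length ps)) a b f H A B"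
    by (rule focal_differential[OF f y(2) D_properties(2)[OF y(1)]])
  note fD = differential_onD(1-3)[OF space_level, OF focal_tangent H(3)]
  let ?N = "{z \<in> D. \<pi> z \<in> H}"
  have N: "zopen Y ?N" by (rule open_preimage[OF regular_open[OF space_level, OF fD(1)]])
  have reg: "Y ?N (\<lambda>z. h (\<pi> z))" if "X H h" for h
    by (rule regular_restrict[OF space_level, OF morphism_regular[OF morphism_pr, OF that] N])
      (use D_points in auto)
  have sN: "Y ?N slope" by (rule regular_restrict[OF space_level, OF slope_regular N]) auto
  have "differential_Suc (\<lambda>z. f (\<pi> z)) ?N (\<lambda>z. A (\<pi> z) + B (\<pi> z) * slope z) (\<lambda>_. 0)"
  proof (rule differential_onI[OF space_level, OF focal_tangent])
    show "Y ?N (\<lambda>z. f (\<pi> z))" by (rule reg[OF fD(1)])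
    show "Y ?N (\<lambda>z. A (\<pi> z) + B (\<pi> z) * slope z)"
      by (rule regular_add[OF space_level, OF reg[OF fD(2)] regular_mult[OF space_level, OF reg[OF fD(3)] sN]])
    show "Y ?N (\<lambda>_. 0)" by (rule regular_const[OF space_level, OF N])
    fix z v assume z: "z \<in> ?N" and v: "v \<in> focal M (Suc (length ps)) z"
    have zD: "z \<in> D" "\<pi> z \<in> H" "\<pi> z \<in> C" using z D_properties(2) by auto
    have "v (\<lambda>z. f (\<pi> z)) = pushforward X \<pi> z v f"
      by (rule pushforward_apply[OF space_level, of "length ps" H f \<pi> z v, OF fD(1) zD(2), symmetric])
    also have "\<dots> = (A (\<pi> z) + B (\<pi> z) * slope z) * pushforward X \<pi> z v a"
      by (rule dir_differential[OF zD(1) focal_dir[OF v] H(3) zD(2)])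
    also have "pushforward X \<pi> z v a = v (\<lambda>z. a (\<pi> z))"
      by (rule pushforward_apply[OF space_level, of "length ps" C a \<pi> z v, OF a_regular zD(3)])
    finally show "v (\<lambda>z. f (\<pi> z)) = (A (\<pi> z) + B (\<pi> z) * slope z) * v (\<lambda>z. a (\<pi> z)) + 0 * v slope"
      by simp
  qed
  then show ?thesis by (rule differential_atI[rotated 2]) (use y H in auto)
qed

text \<open>The functions with this property form a sheaf closed under the operations that generate the
  regular functions on the next level.\<close>

lemma differential_at_regular:
  assumes "Y G f" "y \<in> G" "y \<in> D"
  shows "differential_at y f"
proof -
  have "\<forall>y\<in>G \<inter> D. differential_at y f"
    if "line_bundle_space X (pts M (Suc (length ps))) \<pi> \<delta> G f" for G f
    using that
  proof (induction rule: line_bundle_space.induct)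
    case (pullback G f)
    show ?case by (auto intro: differential_at_pullback[OF pullback])
  next
    case (quotient G f g)
    show ?case
    proof
      fix y assume y: "y \<in> {y \<in> pts M (Suc (length ps)). \<pi> y \<in> G \<and> (\<exists>v\<in>\<delta> y. v g \<noteq> 0)} \<inter> D"
      then have yD: "y \<in> D" "\<pi> y \<in> G" "\<pi> y \<in> C" using D_properties(2) by auto
      obtain H A B where H: "\<pi> y \<in> H" "H \<subseteq> G \<inter> C"
        and f: "differential_on X (focal M (length ps)) a b f H A B"
        by (rule focal_differential[OF quotient(1) yD(2,3)])
      obtain H' A' B' where H': "\<pi> y \<in> H'" "H' \<subseteq> G \<inter> C"
        and g: "differential_on X (focal M (length ps)) a b g H' A' B'"
        by (rule focal_differential[OF quotient(2) yD(2,3)])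
      note fD = differential_onD(2,3)[OF space_level, OF focal_tangent f]
        and gD = differential_onD(2,3)[OF space_level, OF focal_tangent g]
      define F F' where "F z = A (\<pi> z) + B (\<pi> z) * slope z" and "F' z = A' (\<pi> z) + B' (\<pi> z) * slope z" for z
      have F: "differential_at y F"
        unfolding F_def
        by (rule differential_at_add[OF differential_at_pullback[OF fD(1) yD(1) H(1)]
              differential_at_mult[OF differential_at_pullback[OF fD(2) yD(1) H(1)] differential_at_slope[OF yD(1)]]])
      have F': "differential_at y F'"
        unfolding F'_def
        by (rule differential_at_add[OF differential_at_pullback[OF gD(1) yD(1) H'(1)]
              differential_at_mult[OF differential_at_pullback[OF gD(2) yD(1) H'(1)] differential_at_slope[OF yD(1)]]])
      note q = dquot_differential[OF _ f _ g, folded F_def F'_def]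
      have nz: "F' y \<noteq> 0" using q(1)[OF yD(1) H(1) H'(1)] y by simp
      have FF': "differential_at y (\<lambda>z. F z * inverse (F' z))"
        by (rule differential_at_mult[OF F differential_at_inverse[OF F' nz]])
      obtain K A1 B1 where K: "y \<in> K" "K \<subseteq> D" "differential_Suc F' K A1 B1" "zopen Y K"
        by (rule differential_atE[OF F'])
      let ?K = "{z \<in> K. F' z \<noteq> 0}"
      have oK: "zopen Y ?K"
        by (rule open_nonzero[OF space_level, OF differential_onD(1)[OF space_level, OF focal_tangent K(3)]])
      have oH: "zopen Y {z \<in> D. \<pi> z \<in> H \<inter> H'}"
        by (rule open_preimage[OF open_Int[OF space_level, OF regular_open[OF space_level, OF fD(1)]
                regular_open[OF space_level, OF gD(1)]]])
      show "differential_at y (\<lambda>y. dquot (\<delta> y) f g)"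
        by (rule differential_at_germ[OF FF' open_Int[OF space_level, OF oK oH]])
          (use K(1) nz yD(1) H(1) H'(1) q(2) in \<open>auto simp: divide_inverse\<close>)
    qed
  next
    case (add G f H g)
    then show ?case using differential_at_add by simp
  next
    case (mult G f H g)
    then show ?case using differential_at_mult by simp
  next
    case (inverse G f)
    then show ?case using differential_at_inverse by simp
  next
    case (glue G f)
    show ?case
    proof
      fix y assume y: "y \<in> G \<inter> D"
      then have "y \<in> G" by simp
      from glue.IH[OF this] obtain H g where
        H: "y \<in> H" "H \<subseteq> G" "line_bundle_space X (pts M (Suc (length ps))) \<pi> \<delta> H g"
          "\<forall>y\<in>H \<inter> D. differential_at y g" "\<forall>z\<in>H. f z = g z"
        by (elim exE conjE)
      have oH: "zopen Y H"
        by (rule regular_open[OF space_level, of _ H g]) (use H(3) in \<open>simp add: level.simps(2)\<close>)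
      have "differential_at y g" using H(1,4) y by simp
      from differential_at_germ[OF this oH H(1)] show "differential_at y f" using H(5) by simp
    qed
  qed
  then have "\<forall>y\<in>G \<inter> D. differential_at y f" using assms(1) by (simp add: level.simps(2))
  then show ?thesis using assms(2,3) by simp
qed

lemma frame_Suc:
  "frame Y (focal M (Suc (length ps))) D (act M x (ps @ [p]) p) slope"
  unfolding frame_def act_snoc_same
proof (intro conjI ballI allI impI)
  show "Y D (\<lambda>y. a (\<pi> y))" "Y D slope" by (fact a_pr_regular, fact slope_regular)
  show "\<exists>v\<in>focal M (Suc (length ps)) y. v (\<lambda>y. a (\<pi> y)) = \<alpha> \<and> v slope = \<beta>" if "y \<in> D" for y \<alpha> \<beta>
    by (rule focal_vector_Suc[OF that])
  fix G f y
  assume f: "Y G f" and y: "y \<in> G \<inter> D"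
  then have "differential_at y f" using differential_at_regular[OF f] by simp
  then obtain H A B where H: "y \<in> H" "H \<subseteq> D" "differential_Suc f H A B" "zopen Y H"
    by (rule differential_atE)
  have "differential_Suc f (H \<inter> G) A B"
    by (rule differential_restrict[OF space_level, OF focal_tangent H(3)
          open_Int[OF space_level, OF H(4) regular_open[OF space_level, OF f]]]) simp
  then show "\<exists>H A B. y \<in> H \<and> H \<subseteq> G \<inter> D \<and> differential_Suc f H A B"
    using H y by (intro exI[of _ "H \<inter> G"] exI[of _ A] exI[of _ B] conjI) auto
qed

end

context coordinate_tower
begin

lemma frame_base:
  "frame (base M) (focal M 0) (points (base M)) (x 1) (x 2)"
  unfolding frame_def
proof (intro conjI ballI allI impI)
  show "base M (points (base M)) (x 1)"
    using cotangent unfolding trivialize_cotangent_def by (elim conjE)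
  show "base M (points (base M)) (x 2)"
    using cotangent unfolding trivialize_cotangent_def by (elim conjE)
  have foc: "focal M 0 y = tangent_space (base M) y" for y by simp
  fix y \<alpha> \<beta>
  assume y: "y \<in> points (base M)"
  have indep: "\<exists>v\<in>tangent_space (base M) y. r * v (x 1) + s * v (x 2) \<noteq> 0" if "r \<noteq> 0 \<or> s \<noteq> 0" for r s
  proof (rule ccontr)
    assume "\<not> ?thesis"
    then have "\<forall>v\<in>tangent_space (base M) y. r * v (x 1) + s * v (x 2) = 0" by simp
    moreover have "\<forall>p\<in>points (base M). \<forall>a b.
        (\<forall>v\<in>tangent_space (base M) p. a * v (x 1) + b * v (x 2) = 0) \<longrightarrow> a = 0 \<and> b = 0"
      using cotangent unfolding trivialize_cotangent_def by (elim conjE)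
    from bspec[OF this y, THEN spec, THEN spec, THEN mp, OF calculation]
    show False using that by simp
  qed
  \<comment> \<open>The set of values is a subspace of the plane that lies in no line.\<close>
  have "\<exists>v\<in>tangent_space (base M) y. v (x 1) \<noteq> 0" using indep[of 1 0] by simp
  then obtain v where v: "v \<in> tangent_space (base M) y" "v (x 1) \<noteq> 0" by (rule bexE)
  have "\<exists>w\<in>tangent_space (base M) y. v (x 2) / v (x 1) * w (x 1) + (- 1) * w (x 2) \<noteq> 0"
    using indep[of "v (x 2) / v (x 1)" "- 1"] by simp
  then obtain w where w: "w \<in> tangent_space (base M) y"
    "v (x 2) / v (x 1) * w (x 1) + (- 1) * w (x 2) \<noteq> 0" by (rule bexE)
  define d where "d = w (x 2) * v (x 1) - w (x 1) * v (x 2)"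
  have d: "d \<noteq> 0" using v(2) w(2) by (auto simp: d_def field_simps)
  let ?u = "\<lambda>f. (\<alpha> * w (x 2) - \<beta> * w (x 1)) / d * v f + (\<beta> * v (x 1) - \<alpha> * v (x 2)) / d * w f"
  have "?u \<in> focal M 0 y" unfolding foc by (rule tangent_lincomb[OF v(1) w(1)])
  moreover have "?u (x 1) = (\<alpha> * d) / d" "?u (x 2) = (\<beta> * d) / d"
    unfolding times_divide_eq_left add_divide_distrib[symmetric] by (simp_all add: d_def algebra_simps)
  then have "?u (x 1) = \<alpha> \<and> ?u (x 2) = \<beta>" using d by simp
  ultimately show "\<exists>v\<in>focal M 0 y. v (x 1) = \<alpha> \<and> v (x 2) = \<beta>" by (rule bexI[of _ ?u, rotated])
next
  fix G f y
  assume f: "base M G f" and y: "y \<in> G \<inter> points (base M)"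
  have "\<forall>G f. base M G f \<longrightarrow> (\<exists>a b. base M G a \<and> base M G b \<and>
      (\<forall>p\<in>G. \<forall>v\<in>tangent_space (base M) p. v f = a p * v (x 1) + b p * v (x 2)))"
    using cotangent unfolding trivialize_cotangent_def by (elim conjE)
  from this[THEN spec, THEN spec, THEN mp, OF f] obtain A B where "base M G A" "base M G B"
    "\<forall>p\<in>G. \<forall>v\<in>tangent_space (base M) p. v f = A p * v (x 1) + B p * v (x 2)"
    by (elim exE conjE)
  then have "differential_on (base M) (focal M 0) (x 1) (x 2) f G A B"
    using f by (simp add: differential_on_def)
  moreover have "G \<subseteq> points (base M)" by (rule open_subset_points[OF regular_open[OF space_base, OF f]])
  ultimately show "\<exists>H A B. y \<in> H \<and> H \<subseteq> G \<inter> points (base M) \<and>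
      differential_on (base M) (focal M 0) (x 1) (x 2) f H A B"
    using y by (intro exI[of _ G] exI[of _ A] exI[of _ B] conjI) auto
qed

text \<open>In every chart of every level, the active coordinates are coordinates on the focal spaces; in
  particular the focal spaces are planes.\<close>

lemma frame_chart:
  "set ps \<subseteq> {1, 2} \<Longrightarrow> p \<in> {1, 2} \<Longrightarrow>
    frame (level M (length ps)) (focal M (length ps)) (Chart M x ps) (act M x ps p) (act M x ps (3 - p))"
proof (induction ps arbitrary: p rule: rev_induct)
  case Nil
  have f: "frame (level M 0) (focal M 0) (Chart M x []) (act M x [] 1) (act M x [] 2)"
    using frame_base by (simp add: Chart_Nil act_Nil)
  from Nil(2) have "p = 1 \<or> p = 2" by simp
  then show ?case using f frame_swap[OF f] by (auto simp del: focal.simps)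
next
  case (snoc r ps)
  then have r: "r \<in> {1, 2}" by simp
  interpret coordinate_tower_chart M x ps r
    by unfold_locales (use snoc r in auto)
  have "p = r \<or> p = 3 - r" using snoc.prems(2) r by auto
  then show ?case
  proof
    assume "p = r"
    then show ?thesis using frame_Suc by (simp del: focal.simps)
  next
    assume p: "p = 3 - r"
    then have "r = 3 - p" using r by auto
    then show ?thesis using frame_swap[OF frame_Suc] p by (simp del: focal.simps)
  qed
qed

lemma chart_locale: "set ps \<subseteq> {1, 2} \<Longrightarrow> p \<in> {1, 2} \<Longrightarrow> coordinate_tower_chart M x ps p"
  by unfold_locales (use frame_chart in auto)

end

section \<open>Prolongations of vertical fibers\<close>

context coordinate_tower_chart
begin

lemma chart_cover:
  assumes y: "y \<in> points Y" "\<pi> y \<in> C"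
  shows "y \<in> D \<or> y \<in> Chart M x (ps @ [3 - p])"
proof -
  have yp: "y \<in> pts M (Suc (length ps))" using y(1) by (simp add: points_level_Suc)
  obtain v where v: "v \<in> \<delta> y" "v \<noteq> (\<lambda>_. 0)" by (rule line_nonzero[OF dir_line[OF yp]])
  have "v a \<noteq> 0 \<or> v b \<noteq> 0"
    using focal_zero[OF y(2) subsetD[OF dir_focal[OF yp] v(1)]] v(2) by blast
  then show ?thesis
    unfolding Chart_snoc using y bexI[OF _ v(1), of "\<lambda>v. v a \<noteq> 0"] bexI[OF _ v(1), of "\<lambda>v. v b \<noteq> 0"]
    by auto
qed

end

text \<open>The \<open>n\<close>-fold prolongation, at level \<open>m + 1 + n\<close>, of the vertical fiber over a point \<open>q\<close> of level
  \<open>m\<close>.\<close>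

definition (in coordinate_tower) fiber_prolongation :: "nat \<Rightarrow> nat \<Rightarrow> 'p \<Rightarrow> 'p set" where
  "fiber_prolongation m n q = prolongs M (Suc m) n (vertical_fiber M m q)"

text \<open>A closed set \<open>F\<close> at level \<open>k > m\<close> that is a nonsingular curve tangent to the focal bundle, such
  that in each chart \<open>rs\<close> one of the active coordinates is constant on \<open>F\<close> and the other one,
  with index \<open>3 - rs ! m\<close>, is a parameter running over the whole affine line.\<close>

definition (in coordinate_tower) parametrized_curve :: "nat \<Rightarrow> nat \<Rightarrow> 'p set \<Rightarrow> bool" where
  "parametrized_curve m k F \<longleftrightarrow>
     F \<subseteq> points (level M k) \<and> zopen (level M k) (points (level M k) - F) \<and>
     (\<forall>rs. length rs = k \<and> set rs \<subseteq> {1, 2} \<longrightarrow>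
        (\<exists>\<kappa>. \<forall>z\<in>F \<inter> Chart M x rs. act M x rs (rs ! m) z = \<kappa>) \<and>
        (\<forall>z\<in>F \<inter> Chart M x rs.
           tangent_to (level M k) F z = {v \<in> focal M k z. v (act M x rs (rs ! m)) = 0} \<and>
           (\<exists>\<theta>. morphism affine_line (level M k) \<theta> \<and> (\<forall>u. \<theta> u \<in> F \<inter> Chart M x rs) \<and>
              (\<forall>u. act M x rs (3 - rs ! m) (\<theta> u) = u) \<and> \<theta> (act M x rs (3 - rs ! m) z) = z)))"

context coordinate_tower
begin

lemma open_pr_preimage:
  assumes "zopen (level M k) H"
  shows "zopen (level M (Suc k)) {z \<in> points (level M (Suc k)). pr M (Suc k) z \<in> H}"
  using regular_open[OF space_level, OF morphism_regular[OF morphism_pr, OF regular_const[OF space_level, OF assms]]] .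

lemma Chart_points: "set ps \<subseteq> {1, 2} \<Longrightarrow> Chart M x ps \<subseteq> points (level M (length ps))"
  using coordinate_tower_chart.C_points[OF chart_locale[of ps 1]] by simp

lemma chart_extend:
  assumes "y \<in> points (level M (Suc (length ps)))" "pr M (Suc (length ps)) y \<in> Chart M x ps" "set ps \<subseteq> {1, 2}"
  obtains p where "p \<in> {1, 2}" "y \<in> Chart M x (ps @ [p])"
  using coordinate_tower_chart.chart_cover[OF chart_locale[OF assms(3), of 1] assms(1,2)] that by force

lemma chart_exists:
  assumes "y \<in> points (level M k)"
  shows "\<exists>ps. length ps = k \<and> set ps \<subseteq> {1, 2} \<and> y \<in> Chart M x ps"
  using assms
proof (induction k arbitrary: y)
  case 0
  then show ?case by (intro exI[of _ "[]"]) (simp add: Chart_Nil)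
next
  case (Suc k)
  have "pr M (Suc k) y \<in> points (level M k)" by (rule morphism_points[OF morphism_pr Suc.prems])
  from Suc.IH[OF this] obtain ps where
    ps: "length ps = k" "set ps \<subseteq> {1, 2}" "pr M (Suc k) y \<in> Chart M x ps" by (elim exE conjE)
  then obtain p where "p \<in> {1, 2}" "y \<in> Chart M x (ps @ [p])"
    using chart_extend[of y ps] Suc.prems by blast
  then show ?case using ps by (intro exI[of _ "ps @ [p]"]) simp
qed

lemma chart_exists_snoc:
  assumes "y \<in> points (level M (Suc k))"
  obtains ps p where "length ps = k" "set ps \<subseteq> {1, 2}" "p \<in> {1, 2}" "pr M (Suc k) y \<in> Chart M x ps"
    "y \<in> Chart M x (ps @ [p])"
proof -
  obtain ps where ps: "length ps = k" "set ps \<subseteq> {1, 2}" "pr M (Suc k) y \<in> Chart M x ps"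
    using chart_exists[OF morphism_points[OF morphism_pr assms]] by (elim exE conjE)
  then obtain p where "p \<in> {1, 2}" "y \<in> Chart M x (ps @ [p])"
    using chart_extend[of y ps] assms by blast
  with ps show ?thesis using that by blast
qed

text \<open>Points are closed on all levels: two points with the same projection are separated by a chart
  or by the slope.\<close>

lemma closed_point:
  "q \<in> points (level M k) \<Longrightarrow> zopen (level M k) (points (level M k) - {q})"
proof (induction k arbitrary: q)
  case 0
  then show ?case using closed_points by simp
next
  case (Suc k)
  show ?case
  proof (rule open_locally[OF space_level])
    fix y assume y: "y \<in> points (level M (Suc k)) - {q}"
    then have yY: "y \<in> points (level M (Suc k))" by simp
    obtain ps p where ps: "length ps = k" "set ps \<subseteq> {1, 2}" "p \<in> {1, 2}" "y \<in> Chart M x (ps @ [p])"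
      by (rule chart_exists_snoc[OF yY])
    interpret coordinate_tower_chart M x ps p by (rule chart_locale[OF ps(2,3)])
    have D: "zopen (level M (Suc k)) D" "D \<subseteq> points (level M (Suc k))" "y \<in> D"
      using D_open D_points ps by simp_all
    consider "pr M (Suc k) y \<noteq> pr M (Suc k) q" | "q \<notin> D" | "pr M (Suc k) y = pr M (Suc k) q" "q \<in> D" by blast
    then show "\<exists>H. y \<in> H \<and> H \<subseteq> points (level M (Suc k)) - {q} \<and> zopen (level M (Suc k)) H"
    proof cases
      case 1
      have "pr M (Suc k) q \<in> points (level M k)" by (rule morphism_points[OF morphism_pr Suc.prems])
      note o = open_pr_preimage[OF Suc.IH[OF this]]
      have "pr M (Suc k) y \<in> points (level M k)" by (rule morphism_points[OF morphism_pr yY])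
      then show ?thesis using o yY 1
        by (intro exI[of _ "{z \<in> points (level M (Suc k)). pr M (Suc k) z \<in> points (level M k) - {pr M (Suc k) q}}"]) auto
    next
      case 2
      then show ?thesis using D by (intro exI[of _ D]) auto
    next
      case 3
      have "slope y \<noteq> slope q" using slope_point_unique[of y q] 3 D(3) y ps(1) by auto
      moreover have "level M (Suc k) D (\<lambda>z. slope z + (- 1) * slope q)"
        using regular_add[OF space_level, OF slope_regular regular_const[OF space_level, OF D_open, of "- slope q"]] ps(1)
        by simp
      from open_nonzero[OF space_level, OF this]
      have "zopen (level M (Suc k)) {z \<in> D. slope z + (- 1) * slope q \<noteq> 0}" .
      ultimately show ?thesis using D(2,3)
        by (intro exI[of _ "{z \<in> D. slope z + (- 1) * slope q \<noteq> 0}"]) auto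
    qed
  qed
qed

text \<open>The tangent space of a curve that is parametrized by an active coordinate in a chart, the other
  active coordinate being constant.\<close>

lemma tangent_to_curve:
  assumes rs: "length rs = k" "set rs \<subseteq> {1, 2}" and p: "p \<in> {1, 2}" and z: "z \<in> F" "z \<in> Chart M x rs"
    and foc: "\<And>v. v \<in> tangent_to (level M k) F z \<Longrightarrow> v \<in> focal M k z"
    and const: "\<forall>z\<in>F \<inter> Chart M x rs. act M x rs p z = \<kappa>"
    and \<theta>: "morphism affine_line (level M k) \<theta>" "\<And>u. \<theta> u \<in> F \<inter> Chart M x rs"
      "\<And>u. act M x rs (3 - p) (\<theta> u) = u" "\<theta> (act M x rs (3 - p) z) = z"
  shows "tangent_to (level M k) F z = {v \<in> focal M k z. v (act M x rs p) = 0}"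
proof -
  interpret coordinate_tower_chart M x rs p by (rule chart_locale[OF rs(2) p])
  define u where "u = b z"
  have \<theta>u: "\<theta> u = z" using \<theta>(4) by (simp add: u_def)
  have a0: "v a = 0" if v: "v \<in> tangent_to (level M k) F z" for v
  proof -
    have "X C (\<lambda>q. a q - \<kappa>)"
      by (rule regular_diff[OF space_level, OF a_regular
            regular_const[OF space_level, OF regular_open[OF space_level, OF a_regular]]])
    then have "v (\<lambda>q. a q - \<kappa>) = 0"
      using tangent_to_zero[OF v, of C "\<lambda>q. a q - \<kappa>"] z const rs(1) by auto
    moreover have "v (\<lambda>q. a q - \<kappa>) = v a"
      by (rule tangent_diff_const[OF space_level, OF tangent_to_tangent[OF v]])
        (use local_functionsI[OF space_level, OF a_regular z(2)] rs(1) in simp)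
    ultimately show ?thesis by simp
  qed
  obtain e where e: "e \<in> tangent_space affine_line u" "e (\<lambda>w. w) = 1"
    using affine_line_derivation[of u] by (elim bexE)
  define w where "w = pushforward X \<theta> u e"
  have \<theta>X: "morphism affine_line X \<theta>" using \<theta>(1) rs(1) by simp
  have wX: "w \<in> tangent_space X z"
    using pushforward_tangent[OF space_level \<theta>X _ e(1)] by (simp add: w_def \<theta>u points_affine_line)
  have w_apply: "w f = e (\<lambda>u. f (\<theta> u))" if "X G f" "z \<in> G" for G f
    using pushforward_apply[OF space_level, of "length rs" G f \<theta> u e] that by (simp add: w_def \<theta>u)
  have w0: "w f = 0" if f: "X G f" "z \<in> G" and f0: "\<forall>q\<in>G \<inter> F. f q = 0" for G f
  proof -
    note r = morphism_regular[OF \<theta>X, OF f(1)]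
    have "e (\<lambda>u. f (\<theta> u)) = e (\<lambda>_. 0)"
      by (rule tangent_germ[OF space_affine_line, OF e(1) regular_open[OF space_affine_line, OF r]])
        (use f(2) f0 \<theta>(2) in \<open>auto simp: points_affine_line \<theta>u\<close>)
    then show ?thesis using w_apply[OF f] tangent_const[OF e(1), of 0] by simp
  qed
  have w: "w \<in> tangent_to X F z"
    unfolding tangent_to_def
  proof (intro CollectI conjI allI impI)
    show "w f = 0" if "z \<in> G \<and> X G f \<and> (\<forall>q\<in>G \<inter> F. f q = 0)" for G f
      using w0[of G f] that by simp
  qed (rule wX)
  have wb: "w b = 1"
    using w_apply[OF b_regular z(2)] e(2) by (simp add: \<theta>(3))
  have wf: "w \<in> focal M (length rs) z" using foc w rs(1) by simp
  have wa: "w a = 0" using a0 w rs(1) by simp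
  show ?thesis
  proof
    show "tangent_to (level M k) F z \<subseteq> {v \<in> focal M k z. v a = 0}" using foc a0 by auto
    show "{v \<in> focal M k z. v a = 0} \<subseteq> tangent_to (level M k) F z"
    proof
      fix v assume "v \<in> {v \<in> focal M k z. v a = 0}"
      then have v: "v \<in> focal M (length rs) z" "v a = 0" using rs(1) by auto
      have "v = (\<lambda>f. v b * w f + 0 * w f)"
        by (rule focal_eqI[OF z(2) v(1) focal_lincomb[OF subsetD[OF C_points z(2)] wf wf]])
          (use v wa wb in simp_all)
      then have "v = (\<lambda>f. v b * w f)" by simp
      then show "v \<in> tangent_to (level M k) F z" using tangent_to_scale[OF w, of "v b"] rs(1) by simp
    qed
  qed
qed

lemma parametrized_curve_fiber:
  assumes q: "q \<in> points (level M m)"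
  shows "parametrized_curve m (Suc m) (vertical_fiber M m q)"
  unfolding parametrized_curve_def
proof (intro conjI allI impI ballI; (elim conjE)?)
  let ?F = "vertical_fiber M m q"
  show "?F \<subseteq> points (level M (Suc m))" by (auto simp: vertical_fiber_def)
  have "points (level M (Suc m)) - ?F =
      {z \<in> points (level M (Suc m)). pr M (Suc m) z \<in> points (level M m) - {q}}"
    using morphism_points[OF morphism_pr] by (auto simp: vertical_fiber_def)
  then show "zopen (level M (Suc m)) (points (level M (Suc m)) - ?F)"
    using open_pr_preimage[OF closed_point[OF q]] by simp
next
  let ?F = "vertical_fiber M m q"
  fix rs :: "nat list" assume rs: "length rs = Suc m" "set rs \<subseteq> {1, 2}"
  define ps p where "ps = butlast rs" and "p = last rs"
  have rs_eq: "rs = ps @ [p]" using rs(1) unfolding ps_def p_def by (metis append_butlast_last_id list.size(3) nat.distinct(1))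
  have lps: "length ps = m" using rs(1) rs_eq by simp
  have psp: "set ps \<subseteq> {1, 2}" "p \<in> {1, 2}" using rs(2) rs_eq by auto
  have nth: "rs ! m = p" by (simp add: rs_eq lps[symmetric])
  interpret coordinate_tower_chart M x ps p by (rule chart_locale[OF psp])
  have const: "\<forall>z\<in>?F \<inter> Chart M x rs. act M x rs p z = a q"
    by (simp add: rs_eq act_snoc_same vertical_fiber_def lps)
  then show "\<exists>\<kappa>. \<forall>z\<in>?F \<inter> Chart M x rs. act M x rs (rs ! m) z = \<kappa>" unfolding nth by (rule exI)
  fix z assume "z \<in> ?F \<inter> Chart M x rs"
  then have z: "z \<in> ?F" "z \<in> D" by (simp_all add: rs_eq)
  have zq: "pr M (Suc m) z = q" and zY: "z \<in> points (level M (Suc m))" using z(1) by (simp_all add: vertical_fiber_def)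
  have qC: "q \<in> C" using D_properties(2)[OF z(2)] zq lps by simp
  define \<theta> where "\<theta> u = lift ps p q u" for u
  have "morphism affine_line Y \<theta>"
    using morphism_lift[OF space_affine_line morphism_const[OF space_affine_line space_level subsetD[OF C_points qC]], of "\<lambda>u. u"]
      qC affine_line_id by (simp add: \<theta>_def[abs_def] points_affine_line)
  then have \<theta>: "morphism affine_line (level M (Suc m)) \<theta>" using lps by simp
  have \<theta>F: "\<theta> u \<in> ?F \<inter> Chart M x rs" for u
    using lift[OF qC, of u] D_points lps by (auto simp: \<theta>_def rs_eq vertical_fiber_def)
  have \<theta>u: "act M x rs (3 - p) (\<theta> u) = u" for u
    using lift(3)[OF qC, of u] by (simp add: \<theta>_def rs_eq)
  have \<theta>z: "\<theta> (act M x rs (3 - p) z) = z"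
    using lift_eqI[OF z(2)] zq lps by (simp add: \<theta>_def rs_eq)
  have foc: "v \<in> focal M (Suc m) z" if v: "v \<in> tangent_to (level M (Suc m)) ?F z" for v
  proof -
    have vT: "v \<in> tangent_space (level M (Suc m)) z" by (rule tangent_to_tangent[OF v])
    have "pushforward (level M m) (pr M (Suc m)) z v f = 0" for f
    proof (cases "f \<in> local_functions (level M m) (pr M (Suc m) z)")
      case True
      then obtain G where G: "pr M (Suc m) z \<in> G" "level M m G f" by (rule local_functionsE[OF space_level])
      let ?G = "{z \<in> points (level M (Suc m)). pr M (Suc m) z \<in> G}"
      have f: "level M (Suc m) ?G (\<lambda>z. f (pr M (Suc m) z))" by (rule morphism_regular[OF morphism_pr, OF G(2)])
      have f': "level M (Suc m) ?G (\<lambda>z. f (pr M (Suc m) z) - f q)"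
        by (rule regular_diff[OF space_level, OF f regular_const[OF space_level, OF regular_open[OF space_level, OF f]]])
      have zG: "z \<in> ?G" using G(1) zY by simp
      have "v (\<lambda>z. f (pr M (Suc m) z) - f q) = 0"
        using tangent_to_zero[OF v, of ?G "\<lambda>z. f (pr M (Suc m) z) - f q"] f' zG by (simp add: vertical_fiber_def)
      moreover have "v (\<lambda>z. f (pr M (Suc m) z) - f q) = v (\<lambda>z. f (pr M (Suc m) z))"
        by (rule tangent_diff_const[OF space_level, OF vT local_functionsI[OF space_level, OF f zG]])
      ultimately show ?thesis by (simp add: pushforward_def)
    qed (simp add: pushforward_def)
    then have "pushforward (level M m) (pr M (Suc m)) z v = (\<lambda>_. 0)" by (simp add: fun_eq_iff)
    moreover have "(\<lambda>_. 0) \<in> dir M (Suc m) z" using line_zero[OF D_properties(3)[OF z(2)]] lps by simp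
    ultimately show ?thesis using vT by simp
  qed
  have zC: "z \<in> Chart M x rs" using z(2) rs_eq by simp
  show "tangent_to (level M (Suc m)) ?F z = {v \<in> focal M (Suc m) z. v (act M x rs (rs ! m)) = 0}"
    unfolding nth by (rule tangent_to_curve[OF rs psp(2) z(1) zC foc const \<theta> \<theta>F \<theta>u \<theta>z])
  show "\<exists>\<theta>. morphism affine_line (level M (Suc m)) \<theta> \<and> (\<forall>u. \<theta> u \<in> ?F \<inter> Chart M x rs) \<and>
      (\<forall>u. act M x rs (3 - rs ! m) (\<theta> u) = u) \<and> \<theta> (act M x rs (3 - rs ! m) z) = z"
    unfolding nth by (intro exI[of _ \<theta>] conjI allI \<theta> \<theta>F \<theta>u \<theta>z)
qed

text \<open>The prolongation of such a curve consists of its tangent directions, and in the charts it is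
  given by a letter and the vanishing of the new coordinate.\<close>

lemma prolong_parametrized_curve:
  assumes F: "parametrized_curve m k F" and m: "m < k"
  shows prolong_directions: "prolong M k F = {y \<in> points (level M (Suc k)). pr M (Suc k) y \<in> F \<and>
        dir M (Suc k) y = tangent_to (level M k) F (pr M (Suc k) y)}"
    and prolong_chart: "\<And>rs r y. length rs = k \<Longrightarrow> set rs \<subseteq> {1, 2} \<Longrightarrow> r \<in> {1, 2} \<Longrightarrow>
        y \<in> Chart M x (rs @ [r]) \<Longrightarrow>
        y \<in> prolong M k F \<longleftrightarrow> pr M (Suc k) y \<in> F \<and> r = 3 - rs ! m \<and> act M x (rs @ [r]) (3 - r) y = 0"
    and prolong_closed: "zopen (level M (Suc k)) (points (level M (Suc k)) - prolong M k F)"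
proof -
  define A where "A = {y \<in> points (level M (Suc k)). pr M (Suc k) y \<in> F \<and>
        dir M (Suc k) y = tangent_to (level M k) F (pr M (Suc k) y)}"
  have chart: "y \<in> A \<longleftrightarrow> pr M (Suc k) y \<in> F \<and> r = 3 - rs ! m \<and> act M x (rs @ [r]) (3 - r) y = 0"
    "pr M (Suc k) y \<in> F \<Longrightarrow> is_line (tangent_to (level M k) F (pr M (Suc k) y))"
    if rs: "length rs = k" "set rs \<subseteq> {1, 2}" "r \<in> {1, 2}" and y: "y \<in> Chart M x (rs @ [r])" for rs r y
  proof -
    interpret coordinate_tower_chart M x rs r by (rule chart_locale[OF rs(2,3)])
    have yY: "y \<in> points (level M (Suc k))" using D_points y rs(1) by auto
    have yC: "pr M (Suc k) y \<in> C" using D_properties(2)[OF y] rs(1) by simp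
    have dir: "dir M (Suc k) y = {v \<in> focal M k (pr M (Suc k) y). v b = slope y * v a}"
      using dir_eq_slope[OF y] rs(1) by simp
    have T: "tangent_to (level M k) F (pr M (Suc k) y) = {v \<in> focal M k (pr M (Suc k) y). v (act M x rs (rs ! m)) = 0}"
      if "pr M (Suc k) y \<in> F"
      using F rs(1,2) that yC unfolding parametrized_curve_def by blast
    have rsm: "rs ! m \<in> {1, 2}" by (rule subsetD[OF rs(2) nth_mem]) (use m rs(1) in simp)
    have cases: "rs ! m = r \<and> r \<noteq> 3 - rs ! m \<or> rs ! m = 3 - r \<and> r = 3 - rs ! m"
      by (rule letter_cases[OF rsm rs(3)])
    have "\<exists>v\<in>focal M k (pr M (Suc k) y). v a = 1 \<and> v b = slope y"
      using focal_vector[OF yC, of 1 "slope y"] unfolding rs(1) .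
    then obtain v where v: "v \<in> focal M k (pr M (Suc k) y)" "v a = 1" "v b = slope y"
      by (elim bexE conjE)
    have v_dir: "v \<in> dir M (Suc k) y" unfolding dir using v by simp
    show "y \<in> A \<longleftrightarrow> pr M (Suc k) y \<in> F \<and> r = 3 - rs ! m \<and> slope y = 0"
    proof
      assume yA: "y \<in> A"
      then have yF: "pr M (Suc k) y \<in> F" by (simp add: A_def)
      have "v \<in> {v \<in> focal M k (pr M (Suc k) y). v (act M x rs (rs ! m)) = 0}"
        using yA v_dir T[OF yF] by (simp add: A_def)
      then show "pr M (Suc k) y \<in> F \<and> r = 3 - rs ! m \<and> slope y = 0" using cases v yF by auto
    next
      assume *: "pr M (Suc k) y \<in> F \<and> r = 3 - rs ! m \<and> slope y = 0"
      then have e: "rs ! m = 3 - r" and s: "slope y = 0" using cases by auto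
      have "tangent_to (level M k) F (pr M (Suc k) y) = dir M (Suc k) y"
        unfolding dir T[OF conjunct1[OF *]] e s by simp
      then show "y \<in> A" using * yY by (simp add: A_def)
    qed
    show "is_line (tangent_to (level M k) F (pr M (Suc k) y))" if yF: "pr M (Suc k) y \<in> F"
    proof (cases "rs ! m = r")
      case True
      interpret opp: coordinate_tower_chart M x rs "3 - r"
        by (rule chart_locale[OF rs(2) letter_opposite(1)[OF rs(3)]])
      show ?thesis
        unfolding T[OF yF] True
        using opp.line_of_slope[OF yC, of 0] by (simp only: letter_opposite(2)[OF rs(3)] rs(1) mult_zero_left)
    next
      case False
      then have e: "rs ! m = 3 - r" using cases by blast
      show ?thesis
        unfolding T[OF yF] e using line_of_slope[OF yC, of 0] by (simp only: rs(1) mult_zero_left)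
    qed
  qed
  have F_closed: "zopen (level M k) (points (level M k) - F)" using F unfolding parametrized_curve_def by simp
  have A_closed: "zopen (level M (Suc k)) (points (level M (Suc k)) - A)"
  proof (rule open_locally[OF space_level])
    fix y assume y: "y \<in> points (level M (Suc k)) - A"
    then have yY: "y \<in> points (level M (Suc k))" by simp
    obtain rs r where rs: "length rs = k" "set rs \<subseteq> {1, 2}" "r \<in> {1, 2}"
        "pr M (Suc k) y \<in> Chart M x rs" "y \<in> Chart M x (rs @ [r])"
      by (rule chart_exists_snoc[OF yY])
    interpret coordinate_tower_chart M x rs r by (rule chart_locale[OF rs(2,3)])
    note ch = chart(1)[OF rs(1,2,3)]
    have D: "zopen (level M (Suc k)) D" "D \<subseteq> points (level M (Suc k))" "y \<in> D"
      using D_open D_points rs by simp_all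
    consider "pr M (Suc k) y \<notin> F" | "r \<noteq> 3 - rs ! m" | "slope y \<noteq> 0" using ch[OF rs(5)] y by auto
    then show "\<exists>H. y \<in> H \<and> H \<subseteq> points (level M (Suc k)) - A \<and> zopen (level M (Suc k)) H"
    proof cases
      case 1
      note o = open_pr_preimage[OF F_closed]
      have "pr M (Suc k) y \<in> points (level M k)" by (rule morphism_points[OF morphism_pr yY])
      then show ?thesis using o yY 1
        by (intro exI[of _ "{z \<in> points (level M (Suc k)). pr M (Suc k) z \<in> points (level M k) - F}"]) (auto simp: A_def)
    next
      case 2
      then show ?thesis using D ch by (intro exI[of _ D]) auto
    next
      case 3
      have "level M (Suc k) D slope" using slope_regular rs(1) by simp
      from open_nonzero[OF space_level, OF this]
      have "zopen (level M (Suc k)) {z \<in> D. slope z \<noteq> 0}" .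
      then show ?thesis using D(2,3) 3 ch by (intro exI[of _ "{z \<in> D. slope z \<noteq> 0}"]) auto
    qed
  qed
  have "is_line (tangent_to (level M k) F (pr M (Suc k) y))"
    if yY: "y \<in> points (level M (Suc k))" and yF: "pr M (Suc k) y \<in> F" for y
  proof -
    obtain rs r where rs: "length rs = k" "set rs \<subseteq> {1, 2}" "r \<in> {1, 2}"
        "pr M (Suc k) y \<in> Chart M x rs" "y \<in> Chart M x (rs @ [r])"
      by (rule chart_exists_snoc[OF yY])
    show ?thesis by (rule chart(2)[OF rs(1,2,3,5) yF])
  qed
  then have "{y \<in> points (level M (Suc k)). pr M (Suc k) y \<in> F \<and>
        is_line (tangent_to (level M k) F (pr M (Suc k) y)) \<and>
        dir M (Suc k) y = tangent_to (level M k) F (pr M (Suc k) y)} = A"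
    unfolding A_def by auto
  then have "prolong M k F = zariski (level M (Suc k)) closure_of A" by (simp add: prolong_def)
  also have "\<dots> = A"
    by (rule iffD2[OF closure_of_eq]) (use A_closed in \<open>auto simp: closedin_zariski[OF space_level] A_def\<close>)
  finally have pA: "prolong M k F = A" .
  show "prolong M k F = {y \<in> points (level M (Suc k)). pr M (Suc k) y \<in> F \<and>
        dir M (Suc k) y = tangent_to (level M k) F (pr M (Suc k) y)}"
    unfolding pA A_def ..
  show "zopen (level M (Suc k)) (points (level M (Suc k)) - prolong M k F)" unfolding pA by (rule A_closed)
  show "y \<in> prolong M k F \<longleftrightarrow> pr M (Suc k) y \<in> F \<and> r = 3 - rs ! m \<and> act M x (rs @ [r]) (3 - r) y = 0"
    if "length rs = k" "set rs \<subseteq> {1, 2}" "r \<in> {1, 2}" "y \<in> Chart M x (rs @ [r])" for rs r y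
    unfolding pA by (rule chart(1)[OF that])
qed

text \<open>A tangent vector to the prolongation pushes forward to a tangent vector to the curve, hence is
  focal; a parametrization of the curve lifts with slope \<open>0\<close>.\<close>

lemma parametrized_curve_prolong:
  assumes F: "parametrized_curve m k F" and m: "m < k"
  shows "parametrized_curve m (Suc k) (prolong M k F)"
  unfolding parametrized_curve_def
proof (intro conjI allI impI ballI; (elim conjE)?)
  note directions = prolong_directions[OF F m]
  let ?F = "prolong M k F"
  show "?F \<subseteq> points (level M (Suc k))" unfolding directions by auto
  show "zopen (level M (Suc k)) (points (level M (Suc k)) - ?F)" by (rule prolong_closed[OF F m])
next
  note directions = prolong_directions[OF F m]
  let ?F = "prolong M k F"
  fix rs' :: "nat list" assume rs': "length rs' = Suc k" "set rs' \<subseteq> {1, 2}"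
  define rs r where "rs = butlast rs'" and "r = last rs'"
  have rs_eq: "rs' = rs @ [r]" using rs'(1) unfolding rs_def r_def
    by (metis append_butlast_last_id list.size(3) nat.distinct(1))
  have rs: "length rs = k" "set rs \<subseteq> {1, 2}" "r \<in> {1, 2}" using rs' rs_eq by auto
  have nth: "rs' ! m = rs ! m" using rs_eq rs(1) m by (simp add: nth_append)
  have rsm: "rs ! m \<in> {1, 2}" by (rule subsetD[OF rs(2) nth_mem]) (use m rs(1) in simp)
  interpret coordinate_tower_chart M x rs r by (rule chart_locale[OF rs(2,3)])
  have chart: "y \<in> ?F \<longleftrightarrow> pr M (Suc k) y \<in> F \<and> r = 3 - rs ! m \<and> slope y = 0" if "y \<in> D" for y
    by (rule prolong_chart[OF F m rs that])
  have opp: "3 - r = rs ! m" if "r = 3 - rs ! m" unfolding that by (rule letter_opposite(2)[OF rsm])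
  have const: "\<forall>z\<in>?F \<inter> Chart M x rs'. act M x rs' (rs ! m) z = 0"
    using chart opp rs_eq by auto
  then show "\<exists>\<kappa>. \<forall>z\<in>?F \<inter> Chart M x rs'. act M x rs' (rs' ! m) z = \<kappa>" unfolding nth by (rule exI)
  fix z assume "z \<in> ?F \<inter> Chart M x rs'"
  then have z: "z \<in> ?F" "z \<in> D" by (simp_all add: rs_eq)
  then have zr: "pr M (Suc k) z \<in> F" "r = 3 - rs ! m" "slope z = 0" using chart by auto
  have zC: "pr M (Suc k) z \<in> C" using D_properties(2)[OF z(2)] rs(1) by simp
  have "\<exists>\<theta>. morphism affine_line (level M k) \<theta> \<and> (\<forall>u. \<theta> u \<in> F \<inter> C) \<and>
      (\<forall>u. act M x rs (3 - rs ! m) (\<theta> u) = u) \<and> \<theta> (act M x rs (3 - rs ! m) (pr M (Suc k) z)) = pr M (Suc k) z"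
    using F rs(1,2) zr(1) zC unfolding parametrized_curve_def by simp
  then obtain \<theta> where \<theta>: "morphism affine_line X \<theta>" "\<forall>u. \<theta> u \<in> F \<inter> C" "\<forall>u. a (\<theta> u) = u"
      "\<theta> (a (pr M (Suc k) z)) = pr M (Suc k) z"
    using zr(2) rs(1) by auto
  define \<theta>' where "\<theta>' u = lift rs r (\<theta> u) 0" for u
  have "affine_line (points affine_line) (\<lambda>_. 0 :: 'k)"
    by (rule regular_const[OF space_affine_line, OF open_points[OF space_affine_line]])
  then have "morphism affine_line Y \<theta>'"
    using morphism_lift[OF space_affine_line \<theta>(1), of "\<lambda>_. 0"] \<theta>(2) by (simp add: \<theta>'_def[abs_def])
  then have \<theta>'_mor: "morphism affine_line (level M (Suc k)) \<theta>'" using rs(1) by simp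
  have \<theta>': "\<theta>' u \<in> D" "pr M (Suc k) (\<theta>' u) = \<theta> u" "slope (\<theta>' u) = 0" for u
    using lift[of "\<theta> u" 0] \<theta>(2) rs(1) by (auto simp: \<theta>'_def)
  have \<theta>'F: "\<theta>' u \<in> ?F \<inter> Chart M x rs'" for u
    using chart[OF \<theta>'(1)] \<theta>' \<theta>(2) zr(2) rs_eq by auto
  have coord: "act M x rs' (3 - rs ! m) y = a (pr M (Suc k) y)" for y
    using zr(2) rs(1) by (simp add: rs_eq act_snoc)
  have \<theta>'u: "act M x rs' (3 - rs ! m) (\<theta>' u) = u" for u
    unfolding coord using \<theta>'(2) \<theta>(3) by simp
  have \<theta>'z: "\<theta>' (act M x rs' (3 - rs ! m) z) = z"
    unfolding coord \<theta>'_def using lift_eqI[OF z(2)] zr(3) \<theta>(4) rs(1) by simp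
  have foc: "v \<in> focal M (Suc k) z" if v: "v \<in> tangent_to (level M (Suc k)) ?F z" for v
  proof -
    have zY: "z \<in> points (level M (Suc k))" using z(1) unfolding directions by simp
    have vT: "v \<in> tangent_space (level M (Suc k)) z" by (rule tangent_to_tangent[OF v])
    have "pushforward (level M k) (pr M (Suc k)) z v \<in> tangent_to (level M k) F (pr M (Suc k) z)"
      unfolding tangent_to_def
    proof (intro CollectI conjI allI impI)
      show "pushforward (level M k) (pr M (Suc k)) z v \<in> tangent_space (level M k) (pr M (Suc k) z)"
        by (rule pushforward_tangent[OF space_level morphism_pr zY vT])
      fix G f
      assume G: "pr M (Suc k) z \<in> G \<and> level M k G f \<and> (\<forall>q\<in>G \<inter> F. f q = 0)"
      let ?G = "{z \<in> points (level M (Suc k)). pr M (Suc k) z \<in> G}"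
      have f: "level M (Suc k) ?G (\<lambda>z. f (pr M (Suc k) z))"
        using morphism_regular[OF morphism_pr, of k G f] G by simp
      have "v (\<lambda>z. f (pr M (Suc k) z)) = 0"
        using tangent_to_zero[OF v, of ?G "\<lambda>z. f (pr M (Suc k) z)"] f zY G
        unfolding directions by simp
      then show "pushforward (level M k) (pr M (Suc k)) z v f = 0" by (simp add: pushforward_def)
    qed
    moreover have "dir M (Suc k) z = tangent_to (level M k) F (pr M (Suc k) z)"
      using z(1) unfolding directions by simp
    ultimately show ?thesis using vT by simp
  qed
  have zC': "z \<in> Chart M x rs'" using z(2) rs_eq by simp
  show "tangent_to (level M (Suc k)) ?F z = {v \<in> focal M (Suc k) z. v (act M x rs' (rs' ! m)) = 0}"
    unfolding nth by (rule tangent_to_curve[OF rs' rsm z(1) zC' foc const \<theta>'_mor \<theta>'F \<theta>'u \<theta>'z])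
  show "\<exists>\<theta>. morphism affine_line (level M (Suc k)) \<theta> \<and> (\<forall>u. \<theta> u \<in> ?F \<inter> Chart M x rs') \<and>
      (\<forall>u. act M x rs' (3 - rs' ! m) (\<theta> u) = u) \<and> \<theta> (act M x rs' (3 - rs' ! m) z) = z"
    unfolding nth by (intro exI[of _ \<theta>'] conjI allI \<theta>'_mor \<theta>'F \<theta>'u \<theta>'z)
qed

lemma fiber_prolongation_Suc:
  "fiber_prolongation m (Suc n) q = prolong M (Suc (m + n)) (fiber_prolongation m n q)"
  by (simp add: fiber_prolongation_def)

lemma parametrized_curve_fiber_prolongation:
  "q \<in> points (level M m) \<Longrightarrow> parametrized_curve m (Suc (m + n)) (fiber_prolongation m n q)"
proof (induction n)
  case 0
  then show ?case using parametrized_curve_fiber by (simp add: fiber_prolongation_def)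
next
  case (Suc n)
  then show ?case unfolding fiber_prolongation_Suc using parametrized_curve_prolong by simp
qed

lemma fiber_prolongation_points:
  "q \<in> points (level M m) \<Longrightarrow> fiber_prolongation m n q \<subseteq> points (level M (Suc (m + n)))"
  using parametrized_curve_fiber_prolongation unfolding parametrized_curve_def by blast

lemma fiber_prolongation_Suc_iff:
  assumes "q \<in> points (level M m)" "length rs = Suc (m + n)" "set rs \<subseteq> {1, 2}" "r \<in> {1, 2}"
    "y \<in> Chart M x (rs @ [r])"
  shows "y \<in> fiber_prolongation m (Suc n) q \<longleftrightarrow>
     pr M (Suc (Suc (m + n))) y \<in> fiber_prolongation m n q \<and> r = 3 - rs ! m \<and> act M x (rs @ [r]) (3 - r) y = 0"
  unfolding fiber_prolongation_Suc
  by (rule prolong_chart[OF parametrized_curve_fiber_prolongation[OF assms(1)] _ assms(2-5)]) simp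

end

section \<open>Code words\<close>

lemma is_code_word_snoc:
  "is_code_word (W @ [s]) \<longleftrightarrow>
     is_code_word W \<and> (s = R \<or> W \<noteq> [] \<and> (s = V (length W + 1) \<or> s = last W))"
proof -
  define P where "P W i \<longleftrightarrow> W ! i = R \<or> 0 < i \<and> (W ! i = V (i + 1) \<or> W ! i = W ! (i - 1))" for W i
  have P: "is_code_word W \<longleftrightarrow> (\<forall>i<length W. P W i)" for W
    by (simp only: is_code_word_def P_def)
  have "P (W @ [s]) i = P W i" if "i < length W" for i
  proof -
    have "i - 1 < length W" using that by simp
    then show ?thesis using that by (simp add: P_def nth_append)
  qed
  moreover have "P (W @ [s]) (length W) \<longleftrightarrow> s = R \<or> W \<noteq> [] \<and> (s = V (length W + 1) \<or> s = last W)"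
    by (cases "W = []") (simp_all add: P_def nth_append last_conv_nth)
  ultimately show ?thesis
    unfolding P by (simp add: All_less_Suc) blast
qed

text \<open>The occurrences of \<open>V j\<close> in a code word are consecutive and start at the \<open>j\<close>th symbol.\<close>

lemma code_word_occurrences:
  assumes W: "is_code_word W" and "i < length W" "W ! i = V j"
  shows "2 \<le> j \<and> j \<le> i + 1 \<and> (\<forall>i'. j \<le> i' + 1 \<and> i' \<le> i \<longrightarrow> W ! i' = V j)"
  using assms(2,3)
proof (induction i)
  case 0
  then show ?case using W unfolding is_code_word_def by force
next
  case (Suc i)
  have "W ! Suc i = R \<or> W ! Suc i = V (Suc i + 1) \<or> W ! Suc i = W ! i"
    using W Suc.prems(1) unfolding is_code_word_def by (metis diff_Suc_1)
  then consider "j = Suc i + 1" | "W ! i = V j" using Suc.prems(2) by auto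
  then show ?case
  proof cases
    case 1
    have "i' = Suc i" if "j \<le> i' + 1" "i' \<le> Suc i" for i' using that 1 by simp
    then show ?thesis using 1 Suc.prems(2) by auto
  next
    case 2
    then show ?thesis using Suc by (auto simp: le_Suc_eq)
  qed
qed

lemma code_word_count:
  assumes W: "is_code_word W" and n: "0 < count_list W (V j)"
  shows "2 \<le> j" "j + count_list W (V j) - 1 \<le> length W"
    and "i < length W \<and> W ! i = V j \<longleftrightarrow> j \<le> i + 1 \<and> i + 1 < j + count_list W (V j)"
proof -
  define A where "A = {i. i < length W \<and> W ! i = V j}"
  have "finite A" unfolding A_def by simp
  have c: "count_list W (V j) = card A"
    by (simp add: count_list_eq_length_filter length_filter_conv_card A_def eq_commute)
  then have "A \<noteq> {}" using n by auto
  define l where "l = Max A"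
  have l: "l \<in> A" "\<And>i. i \<in> A \<Longrightarrow> i \<le> l" using \<open>finite A\<close> \<open>A \<noteq> {}\<close> by (auto simp: l_def)
  have occ: "2 \<le> j" "j \<le> l + 1" "\<And>i'. j \<le> i' + 1 \<Longrightarrow> i' \<le> l \<Longrightarrow> W ! i' = V j"
    using code_word_occurrences[OF W, of l j] l(1) by (auto simp: A_def)
  have "A = {j - 1..l}"
  proof
    show "A \<subseteq> {j - 1..l}"
    proof
      fix i assume i: "i \<in> A"
      then have "j \<le> i + 1" using code_word_occurrences[OF W, of i j] by (simp add: A_def)
      then show "i \<in> {j - 1..l}" using l(2)[OF i] by simp
    qed
    show "{j - 1..l} \<subseteq> A" using occ l(1) by (auto simp: A_def)
  qed
  then have cA: "card A = l + 2 - j" and A: "i \<in> A \<longleftrightarrow> j \<le> i + 1 \<and> i \<le> l" for i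
    using occ by auto
  show "2 \<le> j" by (rule occ)
  show "j + count_list W (V j) - 1 \<le> length W" using l(1) cA occ c by (auto simp: A_def)
  show "i < length W \<and> W ! i = V j \<longleftrightarrow> j \<le> i + 1 \<and> i + 1 < j + count_list W (V j)"
    using A[of i] cA c occ by (auto simp: A_def)
qed

section \<open>The stratification\<close>

lemma infinity_locus_eq:
  "infinity_locus M (m + 2) n = (\<Union>q\<in>points (level M m). prolongs M (Suc m) (Suc n) (vertical_fiber M m q))"
  by (simp add: infinity_locus_def)

context coordinate_tower
begin

lemma lift_exists:
  assumes "set rs \<subseteq> {1, 2}" "r \<in> {1, 2}" "z \<in> Chart M x rs"
  obtains y where "y \<in> Chart M x (rs @ [r])" "pr M (Suc (length rs)) y = z" "act M x (rs @ [r]) (3 - r) y = c"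
  using coordinate_tower_chart.slope_point_ex[OF chart_locale[OF assms(1,2)] assms(3)] by blast

lemma chart_unique:
  assumes "set rs \<subseteq> {1, 2}" "r \<in> {1, 2}" "y \<in> Chart M x (rs @ [r])" "y' \<in> Chart M x (rs @ [r])"
    "pr M (Suc (length rs)) y = pr M (Suc (length rs)) y'"
    "act M x (rs @ [r]) (3 - r) y = act M x (rs @ [r]) (3 - r) y'"
  shows "y = y'"
  by (rule coordinate_tower_chart.slope_point_unique[OF chart_locale[OF assms(1,2)] assms(3-6)])

lemma Chart_snocD:
  assumes "y \<in> Chart M x (rs @ [r])"
  shows "y \<in> points (level M (Suc (length rs)))" "pr M (Suc (length rs)) y \<in> Chart M x rs"
  using assms unfolding Chart_snoc by auto

text \<open>Membership in \<open>I\<^sub>j[n]\<close>, with \<open>j = m + 2\<close>, read off from a chart.\<close>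

lemma infinity_locus_chart:
  assumes rs: "length rs = Suc (m + n)" "set rs \<subseteq> {1, 2}" "r \<in> {1, 2}" and y: "y \<in> Chart M x (rs @ [r])"
  shows "y \<in> infinity_locus M (m + 2) n \<longleftrightarrow>
     (n = 0 \<or> pr M (Suc (length rs)) y \<in> infinity_locus M (m + 2) (n - 1)) \<and>
     r = 3 - rs ! m \<and> act M x (rs @ [r]) (3 - r) y = 0"
proof -
  have yr: "pr M (Suc (length rs)) y \<in> points (level M (Suc (m + n)))"
    using Chart_snocD[OF y] Chart_points[OF rs(2)] rs(1) by auto
  have "y \<in> infinity_locus M (m + 2) n \<longleftrightarrow>
      (\<exists>q\<in>points (level M m). pr M (Suc (length rs)) y \<in> fiber_prolongation m n q) \<and>
      r = 3 - rs ! m \<and> act M x (rs @ [r]) (3 - r) y = 0"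
    using fiber_prolongation_Suc_iff[OF _ rs y] rs(1)
    unfolding infinity_locus_eq fiber_prolongation_def[symmetric] by auto
  moreover have "(\<exists>q\<in>points (level M m). pr M (Suc (length rs)) y \<in> fiber_prolongation m n q) \<longleftrightarrow>
      n = 0 \<or> pr M (Suc (length rs)) y \<in> infinity_locus M (m + 2) (n - 1)"
  proof (cases n)
    case 0
    then have "pr M (Suc m) (pr M (Suc (length rs)) y) \<in> points (level M m)"
      using morphism_points[OF morphism_pr] yr by simp
    then show ?thesis using 0 yr by (auto simp: fiber_prolongation_def vertical_fiber_def)
  next
    case (Suc n')
    show ?thesis unfolding infinity_locus_eq fiber_prolongation_def Suc by (simp del: prolongs.simps)
  qed
  ultimately show ?thesis by simp
qed

lemma infinity_locus_letters:
  assumes "length rs = m + 2 + n" "set rs \<subseteq> {1, 2}" "y \<in> Chart M x rs" "y \<in> infinity_locus M (m + 2) n"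
    "m < i" "i < m + 2 + n"
  shows "rs ! i = 3 - rs ! m"
  using assms
proof (induction n arbitrary: rs y)
  case 0
  obtain rs' r where rs: "rs = rs' @ [r]" using 0(1) by (cases rs rule: rev_cases) auto
  have "length rs' = Suc (m + 0)" "set rs' \<subseteq> {1, 2}" "r \<in> {1, 2}" using 0 rs by auto
  from infinity_locus_chart[OF this, of y] have "r = 3 - rs' ! m" using 0 rs by simp
  moreover have "i = Suc m" using 0 by simp
  ultimately show ?case using rs \<open>length rs' = Suc (m + 0)\<close> by (simp add: nth_append)
next
  case (Suc n)
  obtain rs' r where rs: "rs = rs' @ [r]" using Suc(2) by (cases rs rule: rev_cases) auto
  have l: "length rs' = Suc (m + Suc n)" "set rs' \<subseteq> {1, 2}" "r \<in> {1, 2}" using Suc rs by auto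
  from infinity_locus_chart[OF this, of y] have r: "r = 3 - rs' ! m"
    and pr: "pr M (Suc (length rs')) y \<in> infinity_locus M (m + 2) n"
    using Suc.prems rs by simp_all
  show ?case
  proof (cases "i < length rs'")
    case True
    have "rs' ! i = 3 - rs' ! m"
      by (rule Suc.IH[OF _ l(2) Chart_snocD(2)[OF Suc.prems(3)[unfolded rs]] pr Suc.prems(5)])
        (use l(1) True in simp_all)
    then show ?thesis using True rs l by (simp add: nth_append)
  next
    case False
    then have "i = length rs'" using Suc.prems l by simp
    then show ?thesis using rs r l by (simp add: nth_append)
  qed
qed

text \<open>At each level a point lies in at most one of the loci \<open>I\<^sub>j[l - j]\<close>: of two such
  indices \<open>j < j'\<close>, the first forces the letters \<open>j' - 1\<close> and \<open>j'\<close> of a chart to be equal, and the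
  second forces them to be opposite.\<close>

lemma infinity_locus_unique:
  assumes y: "y \<in> points (level M l)" and j: "2 \<le> j" "j \<le> l" "y \<in> infinity_locus M j (l - j)"
    and j': "2 \<le> j'" "j' \<le> l" "y \<in> infinity_locus M j' (l - j')"
  shows "j = j'"
proof -
  have False if j: "2 \<le> j" "j \<le> l" "y \<in> infinity_locus M j (l - j)"
    and j': "2 \<le> j'" "j' \<le> l" "y \<in> infinity_locus M j' (l - j')" and less: "j < j'" for j j'
  proof -
    obtain rs where rs: "length rs = l" "set rs \<subseteq> {1, 2}" "y \<in> Chart M x rs"
      using chart_exists[OF y] by blast
    obtain m m' where m: "j = m + 2" "j' = m' + 2" using j(1) j'(1) by (metis add.commute le_Suc_ex)
    have "rs ! i = 3 - rs ! m" if "m < i" "i < l" for i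
      using infinity_locus_letters[of rs m "l - j" y i] rs j that m by simp
    then have "rs ! m' = 3 - rs ! m" "rs ! Suc m' = 3 - rs ! m" using less m j'(2) by auto
    moreover have "rs ! Suc m' = 3 - rs ! m'"
      using infinity_locus_letters[of rs m' "l - j'" y "Suc m'"] rs j' m by simp
    moreover have "3 - rs ! m \<noteq> 3 - (3 - rs ! m)"
    proof -
      have "rs ! m \<in> {1, 2}" by (rule subsetD[OF rs(2) nth_mem]) (use rs(1) j(2) m in simp)
      then show ?thesis using letter_opposite by metis
    qed
    ultimately show False by simp
  qed
  from this[OF j j'] this[OF j' j] show ?thesis by (meson linorder_neqE_nat)
qed

text \<open>The symbol contributed by level \<open>l\<close> to the word of a point \<open>y\<close> of that level: \<open>V j\<close> if \<open>y\<close> lies in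
  \<open>I\<^sub>j[l - j]\<close>, and \<open>R\<close> if there is no such \<open>j\<close>. Listing these symbols for the projections of \<open>y\<close>
  to all levels gives the word of \<open>y\<close>, which is shown below to be its code word.\<close>

definition point_symbol :: "nat \<Rightarrow> 'p \<Rightarrow> code_symbol" where
  "point_symbol l y =
     (if \<exists>j. 2 \<le> j \<and> j \<le> l \<and> y \<in> infinity_locus M j (l - j)
      then V (THE j. 2 \<le> j \<and> j \<le> l \<and> y \<in> infinity_locus M j (l - j)) else R)"

primrec point_word :: "nat \<Rightarrow> 'p \<Rightarrow> code_symbol list" where
  "point_word 0 y = []"
| "point_word (Suc k) y = point_word k (pr M (Suc k) y) @ [point_symbol (Suc k) y]"

lemma point_symbol_iff:
  assumes "y \<in> points (level M l)"
  shows "point_symbol l y = V j \<longleftrightarrow> 2 \<le> j \<and> j \<le> l \<and> y \<in> infinity_locus M j (l - j)"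
proof -
  let ?Q = "\<lambda>j. 2 \<le> j \<and> j \<le> l \<and> y \<in> infinity_locus M j (l - j)"
  have unique: "i = j" if "?Q i" "?Q j" for i j
    using infinity_locus_unique[OF assms] that by blast
  have the: "(THE i. ?Q i) = j" if "?Q j" for j
    by (rule the_equality[of ?Q, OF that]) (rule unique[OF _ that])
  show ?thesis
  proof (cases "\<exists>j. ?Q j")
    case True
    then obtain i where i: "?Q i" by blast
    have "point_symbol l y = V (THE i. ?Q i)" unfolding point_symbol_def by (rule if_P[OF True])
    then have "point_symbol l y = V i" unfolding the[OF i] .
    moreover have "?Q j \<longleftrightarrow> i = j" using unique[OF i, of j] i by blast
    ultimately show ?thesis by simp
  next
    case False
    have "point_symbol l y = R" unfolding point_symbol_def by (rule if_not_P[OF False])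
    then show ?thesis using False by simp
  qed
qed

text \<open>A new symbol other than \<open>R\<close> is the vertical one or repeats the previous symbol, and in a chart
  either case means that the last letter is opposite to the letter \<open>j - 1\<close> and the new coordinate
  vanishes.\<close>

lemma point_symbol_chart:
  assumes rs: "set rs \<subseteq> {1, 2}" "r \<in> {1, 2}" and y: "y \<in> Chart M x (rs @ [r])"
  shows "point_symbol (Suc (length rs)) y = V j \<longleftrightarrow>
     2 \<le> j \<and> (j = Suc (length rs) \<or> point_symbol (length rs) (pr M (Suc (length rs)) y) = V j) \<and>
     r = 3 - rs ! (j - 2) \<and> act M x (rs @ [r]) (3 - r) y = 0"
proof (cases "2 \<le> j \<and> j \<le> Suc (length rs)")
  case True
  define m where "m = j - 2"
  define n where "n = Suc (length rs) - j"
  have j: "j = m + 2" "length rs = Suc (m + n)" using True by (auto simp: m_def n_def)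
  have yr: "pr M (Suc (length rs)) y \<in> points (level M (length rs))"
    using Chart_snocD[OF y] Chart_points[OF rs(1)] by auto
  have "point_symbol (Suc (length rs)) y = V j \<longleftrightarrow> y \<in> infinity_locus M j n"
    unfolding n_def using point_symbol_iff[OF Chart_snocD(1)[OF y], of j] True by simp
  also have "\<dots> \<longleftrightarrow> (n = 0 \<or> pr M (Suc (length rs)) y \<in> infinity_locus M j (n - 1)) \<and>
     r = 3 - rs ! m \<and> act M x (rs @ [r]) (3 - r) y = 0"
    by (rule infinity_locus_chart[OF j(2) rs y, folded j(1)])
  also have "(n = 0 \<or> pr M (Suc (length rs)) y \<in> infinity_locus M j (n - 1)) \<longleftrightarrow>
      (j = Suc (length rs) \<or> point_symbol (length rs) (pr M (Suc (length rs)) y) = V j)"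
  proof (cases "j = Suc (length rs)")
    case True
    then show ?thesis by (simp add: n_def)
  next
    case False
    then have "length rs - j = n - 1" "j \<le> length rs" "n \<noteq> 0" using True by (simp_all add: n_def)
    then show ?thesis using point_symbol_iff[OF yr, of j] True False by simp
  qed
  finally show ?thesis using True by (simp add: m_def)
next
  case False
  have yr: "pr M (Suc (length rs)) y \<in> points (level M (length rs))"
    using Chart_snocD[OF y] Chart_points[OF rs(1)] by auto
  show ?thesis
    using False point_symbol_iff[OF Chart_snocD(1)[OF y], of j] point_symbol_iff[OF yr, of j] by auto
qed

lemma length_point_word: "length (point_word k y) = k"
  by (induction k arbitrary: y) auto

lemma is_code_word_point_word: "y \<in> points (level M k) \<Longrightarrow> is_code_word (point_word k y)"
proof (induction k arbitrary: y)
  case 0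
  then show ?case by (simp add: is_code_word_def)
next
  case (Suc k)
  obtain rs r where rs: "length rs = k" "set rs \<subseteq> {1, 2}" "r \<in> {1, 2}" "y \<in> Chart M x (rs @ [r])"
    using chart_exists_snoc[OF Suc.prems] by metis
  have prp: "pr M (Suc k) y \<in> points (level M k)" by (rule morphism_points[OF morphism_pr Suc.prems])
  note IH = Suc.IH[OF prp]
  show ?case
  proof (cases "point_symbol (Suc k) y")
    case R
    then show ?thesis using IH by (simp add: is_code_word_snoc)
  next
    case (V j)
    then have j: "2 \<le> j" "j = Suc k \<or> point_symbol k (pr M (Suc k) y) = V j"
      using point_symbol_chart[OF rs(2-4), of j] rs(1) by simp_all
    have k: "k \<noteq> 0" using j point_symbol_iff[OF prp, of j] by auto
    then obtain k' where k': "k = Suc k'" using not0_implies_Suc by blast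
    have "last (point_word k (pr M (Suc k) y)) = point_symbol k (pr M (Suc k) y)"
      unfolding k' by simp
    moreover have "point_word k (pr M (Suc k) y) \<noteq> []" unfolding k' by simp
    ultimately show ?thesis using IH V j by (auto simp: is_code_word_snoc length_point_word)
  qed
qed

lemma down_points: "y \<in> points (level M (j + n)) \<Longrightarrow> down M j n y \<in> points (level M j)"
proof (induction n arbitrary: y)
  case (Suc n)
  have "pr M (Suc (j + n)) y \<in> points (level M (j + n))"
    by (rule morphism_points[OF morphism_pr]) (use Suc.prems in simp)
  from Suc.IH[OF this] show ?case by simp
qed simp

lemma nth_point_word:
  "i < k \<Longrightarrow> point_word k y ! i = point_symbol (Suc i) (down M (Suc i) (k - Suc i) y)"
proof (induction k arbitrary: y)
  case (Suc k)
  show ?case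
  proof (cases "i < k")
    case True
    then have "Suc k - Suc i = Suc (k - Suc i)" "Suc i + Suc (k - Suc i) = Suc k" by simp_all
    then have "down M (Suc i) (Suc k - Suc i) y = down M (Suc i) (k - Suc i) (pr M (Suc k) y)"
      by (metis down.simps(2))
    then show ?thesis using Suc.IH[OF True] True by (simp add: nth_append length_point_word)
  next
    case False
    then have "i = k" using Suc.prems by simp
    then show ?thesis by (simp add: nth_append length_point_word)
  qed
qed simp

lemma nth_point_word_iff:
  assumes "y \<in> points (level M k)" "i < k"
  shows "point_word k y ! i = V j \<longleftrightarrow>
     2 \<le> j \<and> j \<le> Suc i \<and> down M (Suc i) (k - Suc i) y \<in> infinity_locus M j (Suc i - j)"
  unfolding nth_point_word[OF assms(2)]
  by (rule point_symbol_iff[OF down_points]) (use assms in simp)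

text \<open>A point lies in the locus of \<open>W\<close> iff its own word is obtained from \<open>W\<close> by replacing some
  symbols \<open>R\<close>.\<close>

lemma code_locus_iff:
  assumes W: "is_code_word W" and k: "length W = k" and y: "y \<in> points (level M k)"
  shows "y \<in> code_locus M W \<longleftrightarrow> (\<forall>i<k. W ! i = R \<or> W ! i = point_word k y ! i)"
proof -
  let ?w = "point_word k y"
  have w: "is_code_word ?w" by (rule is_code_word_point_word[OF y])
  have "y \<in> code_locus M W \<longleftrightarrow> (\<forall>j\<in>{2..k}. let n = count_list W (V j) in
       n > 0 \<longrightarrow> down M (j + n - 1) (k - (j + n - 1)) y \<in> infinity_locus M j (n - 1))"
    using y k by (simp add: code_locus_def)
  also have "\<dots> \<longleftrightarrow> (\<forall>j. count_list W (V j) > 0 \<longrightarrow> ?w ! (j + count_list W (V j) - 2) = V j)"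
  proof -
    have *: "down M (j + n - 1) (k - (j + n - 1)) y \<in> infinity_locus M j (n - 1) \<longleftrightarrow>
        ?w ! (j + n - 2) = V j \<and> j \<in> {2..k}" if n: "n = count_list W (V j)" "n > 0" for j n
    proof -
      note c = code_word_count[OF W, of j, folded n(1), OF n(2)]
      have "Suc (j + n - 2) = j + n - 1" "j + n - 2 < k" "j + n - 1 - j = n - 1" "j \<le> j + n - 1" "j \<le> k"
        using c n(2) k by auto
      then show ?thesis using nth_point_word_iff[OF y, of "j + n - 2" j] c by auto
    qed
    have j: "j \<in> {2..k}" if "count_list W (V j) > 0" for j
      using code_word_count(1,2)[OF W that] that k by auto
    show ?thesis unfolding Let_def using * j by metis
  qed
  also have "\<dots> \<longleftrightarrow> (\<forall>i<k. W ! i = R \<or> W ! i = ?w ! i)"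
  proof (intro iffI allI impI)
    fix i assume h: "\<forall>j. count_list W (V j) > 0 \<longrightarrow> ?w ! (j + count_list W (V j) - 2) = V j" and i: "i < k"
    show "W ! i = R \<or> W ! i = ?w ! i"
    proof (cases "W ! i")
      case (V j)
      then have n: "count_list W (V j) > 0"
        using i k count_notin[of "V j" W] by (metis count_list_0_iff gr0I nth_mem)
      note c = code_word_count[OF W n]
      have i': "j \<le> i + 1" "i + 1 < j + count_list W (V j)" using c(3)[of i] V i k by auto
      have "j + count_list W (V j) - 2 < length ?w" using c n k by (simp add: length_point_word)
      from code_word_occurrences[OF w this] h n have "?w ! i = V j" using i' by auto
      then show ?thesis using V by simp
    qed simp
  next
    fix j assume h: "\<forall>i<k. W ! i = R \<or> W ! i = ?w ! i" and n: "count_list W (V j) > 0"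
    note c = code_word_count[OF W n]
    have "j + count_list W (V j) - 2 < length W \<and> W ! (j + count_list W (V j) - 2) = V j"
      unfolding c(3) using c(1) n by auto
    then show "?w ! (j + count_list W (V j) - 2) = V j" using h k by auto
  qed
  finally show ?thesis .
qed

text \<open>Every code word is the word of a point, since over each point the allowed values of the next
  symbol are attained by a line of slope \<open>0\<close> in a suitable chart, or of slope \<open>1\<close> for \<open>R\<close>.\<close>

lemma code_word_realized:
  "is_code_word W \<Longrightarrow> \<exists>y\<in>points (level M (length W)). point_word (length W) y = W"
proof (induction W rule: rev_induct)
  case Nil
  then show ?case using origin by auto
next
  case (snoc s W)
  let ?k = "length W"
  have W: "is_code_word W" and s: "s = R \<or> W \<noteq> [] \<and> (s = V (?k + 1) \<or> s = last W)"
    using snoc.prems by (simp_all add: is_code_word_snoc)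
  obtain z where z: "z \<in> points (level M ?k)" "point_word ?k z = W" using snoc.IH[OF W] by blast
  obtain rs where rs: "length rs = ?k" "set rs \<subseteq> {1, 2}" "z \<in> Chart M x rs" using chart_exists[OF z(1)] by blast
  have "\<exists>y. y \<in> points (level M (Suc ?k)) \<and> pr M (Suc ?k) y = z \<and> point_symbol (Suc ?k) y = s"
  proof (cases s)
    case R
    have r: "(1::nat) \<in> {1, 2}" by simp
    obtain y where y: "y \<in> Chart M x (rs @ [1])" "pr M (Suc (length rs)) y = z" "act M x (rs @ [1]) (3 - 1) y = 1"
      using lift_exists[OF rs(2) r rs(3)] by metis
    have "point_symbol (Suc ?k) y \<noteq> V j" for j
      using point_symbol_chart[OF rs(2) r y(1), of j] y(3) rs(1) by simp
    then have "point_symbol (Suc ?k) y = R" by (cases "point_symbol (Suc ?k) y") auto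
    then show ?thesis using y Chart_snocD[OF y(1)] R rs(1) by auto
  next
    case (V j)
    then have "W \<noteq> []" and j: "j = Suc ?k \<or> last W = V j" using s by auto
    then obtain k' where k': "?k = Suc k'" by (metis length_0_conv not0_implies_Suc)
    have "last (point_word ?k z) = point_symbol ?k z" unfolding k' by simp
    then have "last W = point_symbol ?k z" unfolding z(2) .
    then have sz: "j = Suc ?k \<or> point_symbol ?k z = V j" using j by simp
    then have j2: "2 \<le> j" "j \<le> Suc ?k" using point_symbol_iff[OF z(1), of j] k' by auto
    define r where "r = 3 - rs ! (j - 2)"
    have "rs ! (j - 2) \<in> {1, 2}" by (rule subsetD[OF rs(2) nth_mem]) (use rs(1) j2 k' in simp)
    then have r: "r \<in> {1, 2}" unfolding r_def by (rule letter_opposite(1))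
    obtain y where y: "y \<in> Chart M x (rs @ [r])" "pr M (Suc (length rs)) y = z" "act M x (rs @ [r]) (3 - r) y = 0"
      using lift_exists[OF rs(2) r rs(3)] by metis
    have "point_symbol (Suc ?k) y = V j"
      using point_symbol_chart[OF rs(2) r y(1), of j] y rs(1) j2 sz r_def by simp
    then show ?thesis using y Chart_snocD[OF y(1)] V rs(1) by auto
  qed
  then obtain y where "y \<in> points (level M (Suc ?k))" "pr M (Suc ?k) y = z" "point_symbol (Suc ?k) y = s" by blast
  then show ?case using z by (intro bexI[of _ y]) simp_all
qed

text \<open>Hence the inclusions between the loci are those given by the symbolwise order, and removing the
  smaller loci leaves exactly the points whose own word is \<open>W\<close>.\<close>

lemma stratum_eq:
  assumes W: "is_code_word W" and k: "length W = k"
  shows "stratum M W = {y \<in> points (level M k). point_word k y = W}"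
proof -
  have locus: "y \<in> code_locus M W' \<longleftrightarrow>
      y \<in> points (level M k) \<and> (\<forall>i<k. W' ! i = R \<or> W' ! i = point_word k y ! i)"
    if "is_code_word W'" "length W' = k" for W' y
    using code_locus_iff[OF that, of y] that(2) by (auto simp: code_locus_def)
  show ?thesis
  proof (intro set_eqI iffI)
    fix y assume y: "y \<in> stratum M W"
    then have "y \<in> code_locus M W" by (simp add: stratum_def)
    then have yp: "y \<in> points (level M k)" and le: "\<forall>i<k. W ! i = R \<or> W ! i = point_word k y ! i"
      using locus[OF W k] by auto
    let ?w = "point_word k y"
    have w: "is_code_word ?w" "length ?w = k" by (rule is_code_word_point_word[OF yp], rule length_point_word)
    have "?w = W"
    proof (rule ccontr)
      assume ne: "?w \<noteq> W"
      have "code_locus M ?w \<subseteq> code_locus M W"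
      proof
        fix z assume "z \<in> code_locus M ?w"
        then have "z \<in> points (level M k)" "\<forall>i<k. ?w ! i = R \<or> ?w ! i = point_word k z ! i"
          using locus[OF w] by auto
        then show "z \<in> code_locus M W" using le locus[OF W k] by metis
      qed
      moreover obtain z where z: "z \<in> points (level M k)" "point_word k z = W"
        using code_word_realized[OF W] k by blast
      have "z \<in> code_locus M W" using z locus[OF W k] by simp
      moreover have "z \<notin> code_locus M ?w"
      proof
        assume "z \<in> code_locus M ?w"
        then have "\<forall>i<k. ?w ! i = R \<or> ?w ! i = W ! i" using locus[OF w] z by simp
        then have "\<forall>i<k. ?w ! i = W ! i" using le by metis
        then show False using ne w k by (metis nth_equalityI)
      qed
      ultimately have "code_locus M ?w \<subset> code_locus M W" by blast
      moreover have "y \<in> code_locus M ?w" using locus[OF w] yp by simp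
      ultimately show False using y w k unfolding stratum_def by blast
    qed
    then show "y \<in> {y \<in> points (level M k). point_word k y = W}" using yp by simp
  next
    fix y assume "y \<in> {y \<in> points (level M k). point_word k y = W}"
    then have yp: "y \<in> points (level M k)" and yw: "point_word k y = W" by simp_all
    have "y \<notin> code_locus M W'"
      if W': "is_code_word W'" "length W' = k" "code_locus M W' \<subset> code_locus M W" for W'
    proof
      assume "y \<in> code_locus M W'"
      then have le: "\<forall>i<k. W' ! i = R \<or> W' ! i = W ! i" using locus[OF W'(1,2)] yw by simp
      have "code_locus M W \<subseteq> code_locus M W'"
      proof
        fix z assume "z \<in> code_locus M W"
        then have "z \<in> points (level M k)" "\<forall>i<k. W ! i = R \<or> W ! i = point_word k z ! i"
          using locus[OF W k] by auto
        then show "z \<in> code_locus M W'" using le locus[OF W'(1,2)] by metis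
      qed
      then show False using W'(3) by blast
    qed
    moreover have "y \<in> code_locus M W" using locus[OF W k] yp yw by simp
    ultimately show "y \<in> stratum M W" unfolding stratum_def k by blast
  qed
qed

lemma code_word_eq:
  assumes y: "y \<in> points (level M k)"
  shows "code_word M k y = point_word k y"
  unfolding code_word_def
proof (rule the_equality)
  show "is_code_word (point_word k y) \<and> length (point_word k y) = k \<and> y \<in> stratum M (point_word k y)"
    using stratum_eq[OF is_code_word_point_word[OF y] length_point_word] y
    by (simp add: is_code_word_point_word length_point_word)
  show "W = point_word k y" if "is_code_word W \<and> length W = k \<and> y \<in> stratum M W" for W
    using that stratum_eq[of W k] by simp
qed

end

section \<open>Nodes and twigs\<close>

context coordinate_tower
begin

text \<open>The defining property of the node with label \<open>ps\<close>.\<close>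

definition is_node :: "nat list \<Rightarrow> 'p \<Rightarrow> bool" where
  "is_node ps y \<longleftrightarrow>
     y \<in> chart M x ps (length ps) \<and>
     x 1 (down M 0 (length ps) y) = 0 \<and> x 2 (down M 0 (length ps) y) = 0 \<and>
     (\<forall>n<length ps. coord M x ps (Suc n) (3 - ps ! n) (down M (Suc n) (length ps - Suc n) y) = 0)"

lemma is_node_snoc:
  "is_node (ps @ [p]) y \<longleftrightarrow>
     y \<in> Chart M x (ps @ [p]) \<and> is_node ps (pr M (Suc (length ps)) y) \<and> act M x (ps @ [p]) (3 - p) y = 0"
proof -
  let ?k = "length ps"
  have d: "down M (Suc n) (Suc ?k - Suc n) y = down M (Suc n) (?k - Suc n) (pr M (Suc ?k) y)" if "n < ?k" for n
  proof -
    have "Suc ?k - Suc n = Suc (?k - Suc n)" "Suc n + Suc (?k - Suc n) = Suc ?k" using that by simp_all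
    then show ?thesis by (metis down.simps(2))
  qed
  have "(\<forall>n<Suc ?k. coord M x (ps @ [p]) (Suc n) (3 - (ps @ [p]) ! n) (down M (Suc n) (Suc ?k - Suc n) y) = 0) \<longleftrightarrow>
      (\<forall>n<?k. coord M x ps (Suc n) (3 - ps ! n) (down M (Suc n) (?k - Suc n) (pr M (Suc ?k) y)) = 0) \<and>
      act M x (ps @ [p]) (3 - p) y = 0"
  proof -
    have low: "coord M x (ps @ [p]) (Suc n) (3 - (ps @ [p]) ! n) (down M (Suc n) (Suc ?k - Suc n) y) =
        coord M x ps (Suc n) (3 - ps ! n) (down M (Suc n) (?k - Suc n) (pr M (Suc ?k) y))" if "n < ?k" for n
    proof -
      have "(ps @ [p]) ! n = ps ! n" using that by (simp add: nth_append)
      moreover have "coord M x (ps @ [p]) (Suc n) i = coord M x ps (Suc n) i" for i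
        by (rule coord_append) (use that in simp)
      ultimately show ?thesis unfolding d[OF that] by simp
    qed
    have top: "coord M x (ps @ [p]) (Suc ?k) (3 - (ps @ [p]) ! ?k) (down M (Suc ?k) (Suc ?k - Suc ?k) y) =
        act M x (ps @ [p]) (3 - p) y"
      by (simp add: act_def del: coord.simps)
    have split: "(\<forall>n<Suc k. F n = 0) \<longleftrightarrow> (\<forall>n<k. G n = 0) \<and> c = 0"
      if "\<And>n. n < k \<Longrightarrow> F n = G n" "F k = c" for F G :: "nat \<Rightarrow> 'k" and k c
      using that by (auto simp: All_less_Suc)
    show ?thesis by (rule split) (erule low, rule top)
  qed
  moreover have "y \<in> Chart M x (ps @ [p]) \<Longrightarrow> pr M (Suc ?k) y \<in> chart M x ps ?k"
    using Chart_snocD(2)[of y ps p] by (simp add: Chart_def)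
  moreover have "y \<in> chart M x (ps @ [p]) (length (ps @ [p])) \<longleftrightarrow> y \<in> Chart M x (ps @ [p])"
    by (simp add: Chart_def)
  moreover have "down M 0 (length (ps @ [p])) y = down M 0 ?k (pr M (Suc ?k) y)" by simp
  ultimately show ?thesis
    unfolding is_node_def by (simp only: length_append_singleton) blast
qed

lemma is_node_unique: "set ps \<subseteq> {1, 2} \<Longrightarrow> \<exists>!y. is_node ps y"
proof (induction ps rule: rev_induct)
  case Nil
  have "is_node [] y \<longleftrightarrow> y \<in> points (base M) \<and> x 1 y = 0 \<and> x 2 y = 0" for y by (simp add: is_node_def)
  then show ?case using origin by simp
next
  case (snoc p ps)
  then have ps: "set ps \<subseteq> {1, 2}" and p: "p \<in> {1, 2}" by auto
  obtain q where q: "is_node ps q" "\<And>q'. is_node ps q' \<Longrightarrow> q' = q" using snoc.IH[OF ps] by blast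
  have qC: "q \<in> Chart M x ps" using q(1) by (simp add: is_node_def Chart_def)
  obtain y where y: "y \<in> Chart M x (ps @ [p])" "pr M (Suc (length ps)) y = q" "act M x (ps @ [p]) (3 - p) y = 0"
    using lift_exists[OF ps p qC] by metis
  show ?case
  proof (rule ex1I[of _ y])
    show "is_node (ps @ [p]) y" unfolding is_node_snoc using y q(1) by simp
    fix y' assume "is_node (ps @ [p]) y'"
    then have y': "y' \<in> Chart M x (ps @ [p])" "pr M (Suc (length ps)) y' = q" "act M x (ps @ [p]) (3 - p) y' = 0"
      unfolding is_node_snoc using q(2) by simp_all
    show "y' = y" by (rule chart_unique[OF ps p y'(1) y(1)]) (simp_all only: y y')
  qed
qed

lemma node_eq: "node M x ps = (THE y. is_node ps y)"
  by (simp add: node_def is_node_def)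

lemma is_node_node: "set ps \<subseteq> {1, 2} \<Longrightarrow> is_node ps (node M x ps)"
  unfolding node_eq by (rule theI'[OF is_node_unique])

lemma node_eqI: "set ps \<subseteq> {1, 2} \<Longrightarrow> is_node ps y \<Longrightarrow> node M x ps = y"
  using is_node_unique is_node_node by blast

lemma node_Chart: "set ps \<subseteq> {1, 2} \<Longrightarrow> node M x ps \<in> Chart M x ps"
  using is_node_node by (simp add: is_node_def Chart_def)

text \<open>Over a point \<open>z\<close> of the vertical fiber there is one point of its prolongation, reached by
  repeated use of the letter opposite to \<open>p\<close> and the slope \<open>0\<close>. If \<open>z\<close> has slope \<open>0\<close>, that
  point is a node. Otherwise the direction of \<open>z\<close> is neither vertical nor tangent to a locus
  \<open>I\<^sub>j[n]\<close> through the node, as both kinds are coordinate directions; so the symbol of \<open>z\<close> is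
  \<open>R\<close>.\<close>

lemma twig_point:
  assumes ps: "set ps \<subseteq> {1, 2}" and p: "p \<in> {1, 2}"
    and y: "y \<in> fiber_prolongation (length ps) n (node M x ps)"
    and z: "z = down M (Suc (length ps)) n y" "z \<in> Chart M x (ps @ [p])"
  shows "y \<in> Chart M x (ps @ [p] @ replicate n (3 - p)) \<and>
     (act M x (ps @ [p]) (3 - p) z = 0 \<longrightarrow> is_node (ps @ [p] @ replicate n (3 - p)) y) \<and>
     (act M x (ps @ [p]) (3 - p) z \<noteq> 0 \<longrightarrow>
        point_word (Suc (length ps + n)) y =
          point_word (length ps) (node M x ps) @ [R] @ replicate n (V (length ps + 2)))"
  using y z
proof (induction n arbitrary: y)
  case 0
  then have zy: "z = y" and zN: "pr M (Suc (length ps)) y = node M x ps"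
    by (simp_all add: fiber_prolongation_def vertical_fiber_def)
  have "point_symbol (Suc (length ps)) y \<noteq> V j" if "act M x (ps @ [p]) (3 - p) z \<noteq> 0" for j
    using point_symbol_chart[OF ps p, of y j] 0(3) that zy by simp
  then have "point_symbol (Suc (length ps)) y = R" if "act M x (ps @ [p]) (3 - p) z \<noteq> 0"
    using that by (cases "point_symbol (Suc (length ps)) y") auto
  moreover have "is_node (ps @ [p]) y" if "act M x (ps @ [p]) (3 - p) z = 0"
    unfolding is_node_snoc zN using 0(3) that zy is_node_node[OF ps] by simp
  ultimately show ?case using 0(3) zy zN by simp
next
  case (Suc n)
  let ?j = "length ps" and ?N = "node M x ps"
  let ?rs = "ps @ [p] @ replicate n (3 - p)"
  define y' where "y' = pr M (Suc (Suc (?j + n))) y"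
  have N: "?N \<in> points (level M ?j)" using node_Chart[OF ps] Chart_points[OF ps] by blast
  have yY: "y \<in> points (level M (Suc (?j + Suc n)))"
    using fiber_prolongation_points[OF N] Suc.prems(1) by blast
  have "fiber_prolongation ?j (Suc n) ?N = {y \<in> points (level M (Suc (Suc (?j + n)))).
      pr M (Suc (Suc (?j + n))) y \<in> fiber_prolongation ?j n ?N \<and>
      dir M (Suc (Suc (?j + n))) y =
        tangent_to (level M (Suc (?j + n))) (fiber_prolongation ?j n ?N) (pr M (Suc (Suc (?j + n))) y)}"
    unfolding fiber_prolongation_Suc
    by (rule prolong_directions[OF parametrized_curve_fiber_prolongation[OF N]]) simp
  then have y': "y' \<in> fiber_prolongation ?j n ?N" using Suc.prems(1) by (simp add: y'_def)
  have zy': "z = down M (Suc ?j) n y'" using Suc.prems(2) by (simp add: y'_def)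
  note IH = Suc.IH[OF y' zy' Suc.prems(3)]
  have rs: "length ?rs = Suc (?j + n)" "set ?rs \<subseteq> {1, 2}"
    using ps p letter_opposite(1)[OF p] by auto
  obtain r where r: "r \<in> {1, 2}" "y \<in> Chart M x (?rs @ [r])"
    using chart_extend[OF _ _ rs(2), of y] IH yY rs(1) by (auto simp: y'_def)
  have nth: "?rs ! ?j = p" by simp
  note letters = fiber_prolongation_Suc_iff[OF N rs r, THEN iffD1, OF Suc.prems(1), unfolded nth]
  have r0: "r = 3 - p" "act M x (?rs @ [r]) (3 - r) y = 0"
    by (rule letters[THEN conjunct2, THEN conjunct1], rule letters[THEN conjunct2, THEN conjunct2])
  have e: "?rs @ [r] = ps @ [p] @ replicate (Suc n) (3 - p)" by (simp add: r0(1) replicate_append_same)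
  have word: "point_symbol (Suc (Suc (?j + n))) y = V (?j + 2)"
  proof -
    have "y \<in> infinity_locus M (?j + 2) n"
      unfolding infinity_locus_eq using Suc.prems(1) N by (auto simp: fiber_prolongation_def)
    then show ?thesis using point_symbol_iff[of y "Suc (Suc (?j + n))" "?j + 2"] yY by simp
  qed
  show ?case
  proof (intro conjI impI)
    show "y \<in> Chart M x (ps @ [p] @ replicate (Suc n) (3 - p))" using r(2) unfolding e .
    assume "act M x (ps @ [p]) (3 - p) z = 0"
    then have "is_node ?rs (pr M (Suc (length ?rs)) y)" using IH rs(1) by (simp add: y'_def)
    then have "is_node (?rs @ [r]) y" unfolding is_node_snoc[of ?rs] using r(2) r0(2) by blast
    then show "is_node (ps @ [p] @ replicate (Suc n) (3 - p)) y" unfolding e .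
  next
    assume "act M x (ps @ [p]) (3 - p) z \<noteq> 0"
    then have "point_word (Suc (?j + n)) y' = point_word ?j ?N @ [R] @ replicate n (V (?j + 2))"
      using IH by simp
    moreover have "point_word (Suc (?j + Suc n)) y =
        point_word (Suc (?j + n)) y' @ [point_symbol (Suc (Suc (?j + n))) y]"
      by (simp only: point_word.simps(2)[of "Suc (?j + n)"] y'_def add_Suc_right)
    ultimately show "point_word (Suc (?j + Suc n)) y =
        point_word ?j ?N @ [R] @ replicate (Suc n) (V (?j + 2))"
      unfolding word by (simp only: append_assoc replicate_append_same[symmetric] replicate_Suc append_Cons append_Nil)
  qed
qed

lemma fiber_prolongation_lift:
  assumes q: "q \<in> points (level M m)" and z: "z \<in> fiber_prolongation m 0 q"
  shows "\<exists>y\<in>fiber_prolongation m n q. down M (Suc m) n y = z"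
proof (induction n)
  case 0
  then show ?case using z by simp
next
  case (Suc n)
  then obtain y where y: "y \<in> fiber_prolongation m n q" "down M (Suc m) n y = z" by blast
  then have "y \<in> points (level M (Suc (m + n)))" using fiber_prolongation_points[OF q] by blast
  then obtain rs where rs: "length rs = Suc (m + n)" "set rs \<subseteq> {1, 2}" "y \<in> Chart M x rs"
    using chart_exists by blast
  define r where "r = 3 - rs ! m"
  have "rs ! m \<in> {1, 2}" by (rule subsetD[OF rs(2) nth_mem]) (use rs(1) in simp)
  then have r: "r \<in> {1, 2}" unfolding r_def by (rule letter_opposite(1))
  obtain y' where y': "y' \<in> Chart M x (rs @ [r])" "pr M (Suc (length rs)) y' = y" "act M x (rs @ [r]) (3 - r) y' = 0"
    using lift_exists[OF rs(2) r rs(3)] by metis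
  have "y' \<in> fiber_prolongation m (Suc n) q"
    using fiber_prolongation_Suc_iff[OF q rs(1,2) r y'(1)] y' y(1) rs(1) r_def by simp
  moreover have "down M (Suc m) (Suc n) y' = z" using y(2) y'(2) rs(1) by simp
  ultimately show ?case by (intro bexI[of _ y'])
qed

text \<open>The twig has infinitely many points and there are finitely many nodes, so a twig word is
  determined by a point of the twig that is not a node.\<close>

lemma finite_nodes: "finite (nodes M x k)"
proof -
  have "nodes M x k = node M x ` {ps. set ps \<subseteq> {1, 2} \<and> length ps = k}"
    by (auto simp: nodes_def)
  then show ?thesis using finite_lists_length_eq[of "{1, 2 :: nat}" k] by simp
qed

lemma infinite_fiber_prolongation:
  assumes ps: "set ps \<subseteq> {1, 2}"
  shows "infinite (fiber_prolongation (length ps) n (node M x ps))"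
proof
  let ?F = "fiber_prolongation (length ps) n (node M x ps)"
  define s where "s y = act M x (ps @ [1]) 2 (down M (Suc (length ps)) n y)" for y
  have N: "node M x ps \<in> points (level M (length ps))" using node_Chart[OF ps] Chart_points[OF ps] by blast
  assume "finite ?F"
  moreover have "UNIV \<subseteq> s ` ?F"
  proof
    fix c :: 'k
    have one: "(1::nat) \<in> {1, 2}" by simp
    obtain z where z: "z \<in> Chart M x (ps @ [1])" "pr M (Suc (length ps)) z = node M x ps"
      "act M x (ps @ [1]) (3 - 1) z = c"
      using lift_exists[OF ps one node_Chart[OF ps], of c] by metis
    have "z \<in> fiber_prolongation (length ps) 0 (node M x ps)"
      using z(2) Chart_snocD(1)[OF z(1)] by (simp add: fiber_prolongation_def vertical_fiber_def)
    from fiber_prolongation_lift[OF N this, of n] obtain y where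
      y: "y \<in> ?F" "down M (Suc (length ps)) n y = z" by blast
    have "s y = c" using z(3) y(2) by (simp add: s_def numeral_2_eq_2)
    then show "c \<in> s ` ?F" using y(1) by blast
  qed
  ultimately have "finite (UNIV :: 'k set)" by (meson finite_imageI finite_subset)
  then show False using infinite_UNIV_char_0 by blast
qed

lemma point_word_twig:
  assumes ps: "set ps \<subseteq> {1, 2}"
    and y: "y \<in> fiber_prolongation (length ps) n (node M x ps)" "y \<notin> nodes M x (Suc (length ps + n))"
  shows "point_word (Suc (length ps + n)) y =
     point_word (length ps) (node M x ps) @ [R] @ replicate n (V (length ps + 2))"
proof -
  let ?N = "node M x ps"
  have N: "?N \<in> points (level M (length ps))" using node_Chart[OF ps] Chart_points[OF ps] by blast
  define z where "z = down M (Suc (length ps)) n y"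
  have "z \<in> points (level M (Suc (length ps))) \<and> pr M (Suc (length ps)) z = ?N"
    using y(1) unfolding z_def
  proof (induction n arbitrary: y)
    case 0
    then show ?case by (simp add: fiber_prolongation_def vertical_fiber_def)
  next
    case (Suc n)
    have "pr M (Suc (Suc (length ps + n))) y \<in> fiber_prolongation (length ps) n ?N"
      using Suc.prems prolong_directions[OF parametrized_curve_fiber_prolongation[OF N, of n]]
      unfolding fiber_prolongation_Suc by auto
    from Suc.IH[OF this] show ?case by simp
  qed
  then obtain p where p: "p \<in> {1, 2}" "z \<in> Chart M x (ps @ [p])"
    using chart_extend[OF _ _ ps, of z] node_Chart[OF ps] by auto
  note tw = twig_point[OF ps p(1) y(1) z_def p(2)]
  have "act M x (ps @ [p]) (3 - p) z \<noteq> 0"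
  proof
    let ?rs = "ps @ [p] @ replicate n (3 - p)"
    assume "act M x (ps @ [p]) (3 - p) z = 0"
    then have "is_node ?rs y" using tw by simp
    moreover have rs: "length ?rs = Suc (length ps + n)" "set ?rs \<subseteq> {1, 2}"
      using ps p letter_opposite(1)[OF p(1)] by auto
    ultimately have "y = node M x ?rs" using node_eqI by simp
    then have "y \<in> nodes M x (Suc (length ps + n))"
      unfolding nodes_def using rs by (intro CollectI exI[of _ ?rs]) simp
    then show False using y(2) by simp
  qed
  then show ?thesis using tw by simp
qed

lemma twig_word_fiber_prolongation:
  assumes ps: "set ps \<subseteq> {1, 2}" and T: "T = fiber_prolongation (length ps) n (node M x ps)"
  shows "twig_word M x (Suc (length ps + n)) T = node_word M x ps @ [R] @ replicate n (V (length ps + 2))"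
proof -
  let ?N = "node M x ps" and ?k = "Suc (length ps + n)"
  let ?W = "node_word M x ps @ [R] @ replicate n (V (length ps + 2))"
  have N: "?N \<in> points (level M (length ps))" using node_Chart[OF ps] Chart_points[OF ps] by blast
  have W: "?W = point_word (length ps) ?N @ [R] @ replicate n (V (length ps + 2))"
    unfolding node_word_def code_word_eq[OF N] ..
  have T_points: "T \<subseteq> points (level M ?k)" unfolding T by (rule fiber_prolongation_points[OF N])
  have word: "point_word ?k y = ?W" if "y \<in> T - nodes M x ?k" for y
    unfolding W by (rule point_word_twig[OF ps]) (use that T in auto)
  have "T - nodes M x ?k \<noteq> {}"
    using infinite_fiber_prolongation[OF ps, of n] finite_nodes[of ?k] finite_subset[of T] unfolding T by blast
  then obtain y where y: "y \<in> T - nodes M x ?k" by blast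
  then have yp: "y \<in> points (level M ?k)" using T_points by blast
  have cW: "is_code_word ?W" "length ?W = ?k"
    using is_code_word_point_word[OF yp] length_point_word[of ?k y] unfolding word[OF y] .
  show ?thesis
    unfolding twig_word_def
  proof (rule the_equality)
    show "is_code_word ?W \<and> length ?W = ?k \<and> T - nodes M x ?k \<subseteq> stratum M ?W"
      unfolding stratum_eq[OF cW] using cW word T_points by auto
    fix W' assume "is_code_word W' \<and> length W' = ?k \<and> T - nodes M x ?k \<subseteq> stratum M W'"
    then have "y \<in> stratum M W'" "is_code_word W'" "length W' = ?k" using y by auto
    then show "W' = ?W" using stratum_eq[of W' ?k] word[OF y] by simp
  qed
qed

end

section \<open>The twig word\<close>

theorem theorem6p3:
  fixes S :: "('p, 'k::{alg_closed_field, field_char_0}) fspace"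
    and U :: "'p set"
    and x :: "nat \<Rightarrow> 'p \<Rightarrow> 'k"
    and M :: "('p, 'k) tower"
    and ps :: "nat list"
    and j k :: nat
    and T :: "'p set"
  assumes "nonsingular_surface S"
    and "zopen S U"
    and "nodal_coordinates (open_subspace S U) x"
    and "monster_tower M" and "base M = open_subspace S U"
    and "0 \<le> j" and "j < k"
    and "length ps = j" and "set ps \<subseteq> {1, 2}"
    and "is_interior_twig M x k ps T"
  shows "twig_word M x k T = node_word M x ps @ [R] @ replicate (k - 1 - j) (V (j + 2))"
proof -
  have S: "space_with_functions S" "separated_fspace S"
    using assms(1) unfolding nonsingular_surface_def variety_def by simp_all
  have U: "points (base M) = U" unfolding assms(5) by (rule points_open_subspace[OF S(1) assms(2)])
  interpret coordinate_tower M x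
  proof
    show "space_with_functions (base M)" unfolding assms(5) by (rule space_open_subspace[OF S(1) assms(2)])
    show "trivialize_cotangent (base M) x" "\<exists>!p. p \<in> points (base M) \<and> x 1 p = 0 \<and> x 2 p = 0"
      using assms(3) unfolding nodal_coordinates_def assms(5) by simp_all
    show "monster_tower M" by (rule assms(4))
    fix q assume q: "q \<in> points (base M)"
    have "U \<subseteq> points S" by (rule open_subset_points[OF assms(2)])
    then have "zopen S (points S - {q})" using closed_point_separated[OF S] q U by blast
    from open_Int[OF S(1) assms(2) this] have "zopen S (U \<inter> (points S - {q}))" .
    moreover have "U \<inter> (points S - {q}) = U - {q}" using \<open>U \<subseteq> points S\<close> by blast
    ultimately have "zopen S (U - {q})" by simp
    then obtain f where "S (U - {q}) f" unfolding zopen_def by (rule exE)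
    then have "open_subspace S U (U - {q}) f" by (simp add: open_subspace_def)
    then show "zopen (base M) (points (base M) - {q})"
      unfolding U zopen_def unfolding assms(5) by (rule exI[of "open_subspace S U (U - {q})"])
  qed
  have k: "k = Suc (length ps + (k - 1 - j))" using assms(7,8) by simp
  have "T = fiber_prolongation (length ps) (k - 1 - j) (node M x ps)"
    using assms(8,10) by (simp add: is_interior_twig_def fiber_prolongation_def)
  from twig_word_fiber_prolongation[OF assms(9) this] show ?thesis
    using k assms(8) by simp
qed

end
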